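(* Let $n\ge2$ and $V=\mathbb R^{n-1}$. Let $\theta:V\to T$ be a marked translation group, $S$ a horosphere for $T$, $\Phi$ the radial flow, and $[J(\theta)]=[\beta+c]$ with $\beta\in\mathrm S^2V$ unimodular positive definite and $c\in\mathrm S^3V$. The following are equivalent: (a) flow lines of $\Phi$ are affine normals to $S$; (b) $S$ is an affine sphere; (c) $c$ is harmonic with respect to $\beta$; (d) $T$ is conjugate in $\mathrm{Aff}(n)$ to $\mathrm{Tr}(s,\dots,s)$ for some $s\ge0$.
   Context: $\mathrm S^kV$ is the space of homogeneous polynomials of degree $k$ on $V$. $\mathbb A^n=\mathbb R^n\times\{1\}\subset\mathbb R^{n+1}$, $\mathrm{Aff}(n)\subset \mathrm{GL}(n+1,\mathbb R)$ is the subgroup preserving $\mathbb A^n$. Translation groups. Let $\Omega\subset\mathbb A^n$ be a closed convex subset bounded by a non-compact, properly embedded, strictly convex hypersurface $\partial\Omega$, and suppose the group of affine maps preserving $\Omega$ contains a subgroup $T\cong(V,+)$ acting simply transitively on $\partial\Omega$. Then $T$ is a translation group; a marked translation group is an isomorphism of Lie groups $\theta:V\to T$ onto a translation group. A horosphere is the $T$-orbit of a point of $\Omega$; horospheres are smooth strictly convex hypersurfaces foliating $\Omega$. Groups $\mathrm{Tr}(s,\dots,s)$. For $s>0$, $\mathrm{Tr}(s,\dots,s)=\{\mathrm{Diag}(e^{x_1},\dots,e^{x_n},1):\sum x_i=0\}$. For $s=0$, $\mathrm{Tr}(0,\dots,0)=\exp\{N(v):v\in V\}$ where $N(v)$ is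 the $(n+1)\times(n+1)$ matrix with first row $(0,v_1,\dots,v_{n-1},0)$, last column $(0,v_1,\dots,v_{n-1},0)^T$ and all other entries $0$. Radial flow. If $T$ has a fixed point in $\mathbb A^n$ (equivalently $T$ is diagonalizable; the point is then unique) the radial flow is the one-parameter group of homotheties centered at that point, $\Phi_t(x)=e^{-t}(x-C)+C$, $C$ the fixed point. Otherwise there is a unique one-dimensional space of vectors in $\mathbb R^n$ fixed by the linear parts of all elements of $T$, and the radial flow is the one-parameter group of translations in that direction. In both cases $\Phi$ centralizes $T$ (time orientation chosen so that $\Phi_t(\Omega)\subset\Omega$ for $t\le0$). Shape invariant. Choose $b\in\partial\Omega$ and an affine function $\tau$ on $\mathbb A^n$ vanishing on the supporting hyperplane of $\Omega$ at $b$ and positive on the interior of $\Omega$. The height function $h_\theta(v)=\tau(\theta(v)b)$ is independent of $b$ up to a positive scalar. $J(\theta)$ is the 3-jet of $h_\theta$ at $0$; it has only terms of degrees $2$ and $3$ and is defined up to positive scaling; scale so that the quadratic part $\beta$ has determinant one. A cubic $c$ is harmonic with respect to $\beta$ if $\Delta(c\circ L)=0$ where $L\in \mathrm{GL}(V)$ satisfies $\beta(Lv)=\|v\|^2$ and $\Delta$ is the standard Laplacian. Affine normals. Let $S\subset\mathbb R^n$ be a smooth strictly convex hypersurface, $p\in S$, $P$ the tangent hyperplane at $p$. For $\delta>0$ let $P(\delta)$ be the hyperplane parallel to $P$ at distance $\delta$, on the side containing $S$, and $x(\delta)$ the center of mass of $S\cap P(\delta)$. An affine normal to $S$ at $p$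 is a non-zero vector $\nu(p)$, pointing to the convex side of $S$, such that $(x(\delta)-p)/\delta$ converges to a non-zero multiple of $\nu(p)$ as $\delta\to0$; it is defined up to positive scaling. Statement (a) means that at each $p\in S$ the flow line of $\Phi$ through $p$ has the direction of the affine normal at $p$. $S$ is an affine sphere if there is a point of $\mathbb{RP}^n$ (the projective completion of $\mathbb R^n$) through which every affine normal line of $S$ passes.
   Formalization: The center of mass in the affine normal is that of the solid section of P(δ) bounded by S (the convex hull of S∩P(δ)), not of S∩P(δ) with Euclidean surface measure, for which the equivalence fails (e.g. xyz=1 at a point with unequal coordinates). *)

theory Defs
  imports "HOL-Analysis.Analysis"
begin

text \<open>
  Dimensions: with \<open>n - 1 = CARD('m)\<close>, the space \<open>V\<close> of dimension \<open>n - 1\<close> is \<open>real ^ 'm\<close>, the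
  space of dimension \<open>n\<close> is \<open>real ^ 'm option\<close>, and the space of dimension \<open>n + 1\<close> is
  \<open>real ^ 'm option option\<close>. In the latter the coordinate \<open>None\<close> is the last one, \<open>Some None\<close>
  the first one, and \<open>Some (Some i)\<close> are the \<open>n - 1\<close> coordinates in between.
\<close>

type_synonym 'm point = "(real, 'm option) vec"
type_synonym 'm hpoint = "(real, 'm option option) vec"
type_synonym 'm hmatrix = "((real, 'm option option) vec, 'm option option) vec"

text \<open>\<open>hom_point\<close> identifies the space of dimension \<open>n\<close> with the affine hyperplane of
  vectors with last coordinate 1; \<open>hom_dir\<close> embeds its directions (points at infinity).\<close>

definition hom_point :: "('m::finite) point \<Rightarrow> 'm hpoint" where
  "hom_point x = (\<chi> i. case i of None \<Rightarrow> 1 | Some j \<Rightarrow> x $ j)"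

definition hom_dir :: "('m::finite) point \<Rightarrow> 'm hpoint" where
  "hom_dir u = (\<chi> i. case i of None \<Rightarrow> 0 | Some j \<Rightarrow> u $ j)"

definition Aff :: "('m::finite) hmatrix set" where
  "Aff = {A. invertible A \<and> (*v) A ` range hom_point = range hom_point}"

definition aff_act :: "('m::finite) hmatrix \<Rightarrow> 'm point \<Rightarrow> 'm point" where
  "aff_act A x = (\<chi> i. (A *v hom_point x) $ Some i)"


subsection \<open>Translation groups\<close>

text \<open>A continuous isomorphism of Lie groups is automatically smooth with smooth inverse.\<close>

definition lie_group_iso :: "(real ^ 'm \<Rightarrow> ('m::finite) hmatrix) \<Rightarrow> 'm hmatrix set \<Rightarrow> bool" where
  "lie_group_iso \<theta> T \<longleftrightarrow>
     (\<forall>u v. \<theta> (u + v) = \<theta> u ** \<theta> v) \<and> (\<exists>\<eta>. homeomorphism UNIV T \<theta> \<eta>)"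

text \<open>The frontier of a closed convex set with non-empty interior is a closed, hence properly
  embedded, hypersurface.\<close>

definition strictly_convex_domain :: "('m::finite) point set \<Rightarrow> bool" where
  "strictly_convex_domain \<Omega> \<longleftrightarrow>
     closed \<Omega> \<and> convex \<Omega> \<and> interior \<Omega> \<noteq> {} \<and> \<not> compact (frontier \<Omega>) \<and>
     (\<forall>x\<in>frontier \<Omega>. \<forall>y\<in>frontier \<Omega>. open_segment x y \<subseteq> interior \<Omega>)"

definition translation_group :: "('m::finite) point set \<Rightarrow> 'm hmatrix set \<Rightarrow> bool" where
  "translation_group \<Omega> T \<longleftrightarrow>
     strictly_convex_domain \<Omega> \<and>
     T \<subseteq> Aff \<and> mat 1 \<in> T \<and> (\<forall>A\<in>T. \<forall>B\<in>T. A ** B \<in> T) \<and> (\<forall>A\<in>T. matrix_inv A \<in> T) \<and>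
     (\<forall>A\<in>T. aff_act A ` \<Omega> = \<Omega>) \<and>
     (\<exists>\<theta>. lie_group_iso \<theta> T) \<and>
     (\<forall>x\<in>frontier \<Omega>. \<forall>y\<in>frontier \<Omega>. \<exists>!A. A \<in> T \<and> aff_act A x = y)"

definition marked_translation_group ::
    "('m::finite) point set \<Rightarrow> 'm hmatrix set \<Rightarrow> (real ^ 'm \<Rightarrow> 'm hmatrix) \<Rightarrow> bool" where
  "marked_translation_group \<Omega> T \<theta> \<longleftrightarrow> translation_group \<Omega> T \<and> lie_group_iso \<theta> T"

definition horosphere :: "('m::finite) point set \<Rightarrow> 'm hmatrix set \<Rightarrow> 'm point set \<Rightarrow> bool" where
  "horosphere \<Omega> T S \<longleftrightarrow> (\<exists>x\<in>\<Omega>. S = (\<lambda>A. aff_act A x) ` T)"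


subsection \<open>The groups \<open>Tr(s,\<dots>,s)\<close>\<close>

definition diag_exp :: "('m::finite) point \<Rightarrow> 'm hmatrix" where
  "diag_exp x = (\<chi> i j. if i = j then (case i of None \<Rightarrow> 1 | Some k \<Rightarrow> exp (x $ k)) else 0)"

definition nilp :: "real ^ ('m::finite) \<Rightarrow> 'm hmatrix" where
  "nilp v = (\<chi> i j. case (i, j) of
       (Some None, Some (Some k)) \<Rightarrow> v $ k
     | (Some (Some k), None) \<Rightarrow> v $ k
     | _ \<Rightarrow> 0)"

definition matrix_exp :: "real ^ 'k ^ 'k \<Rightarrow> real ^ ('k::finite) ^ 'k" where
  "matrix_exp A = (\<Sum>j. (((**) A ^^ j) (mat 1)) /\<^sub>R fact j)"

definition Tr :: "real \<Rightarrow> ('m::finite) hmatrix set" where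
  "Tr s = (if s > 0 then {diag_exp x | x. (\<Sum>i\<in>UNIV. x $ i) = 0}
           else {matrix_exp (nilp v) | v. True})"

definition Aff_conjugate :: "('m::finite) hmatrix set \<Rightarrow> 'm hmatrix set \<Rightarrow> bool" where
  "Aff_conjugate T T' \<longleftrightarrow> (\<exists>P\<in>Aff. T = (\<lambda>A. P ** A ** matrix_inv P) ` T')"


subsection \<open>Radial flow\<close>

definition radial_flow ::
    "('m::finite) point set \<Rightarrow> 'm hmatrix set \<Rightarrow> (real \<Rightarrow> 'm point \<Rightarrow> 'm point) \<Rightarrow> bool" where
  "radial_flow \<Omega> T \<Phi> \<longleftrightarrow>
     (if \<exists>C. \<forall>A\<in>T. aff_act A C = C
      then \<exists>C. (\<forall>A\<in>T. aff_act A C = C) \<and> \<Phi> = (\<lambda>t x. exp (- t) *\<^sub>R (x - C) + C)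
      else \<exists>u. u \<noteq> 0 \<and> {w. \<forall>A\<in>T. A *v hom_dir w = hom_dir w} = span {u} \<and>
             \<Phi> = (\<lambda>t x. x + t *\<^sub>R u) \<and> (\<forall>t\<le>0. \<Phi> t ` \<Omega> \<subseteq> \<Omega>))"


subsection \<open>Shape invariant\<close>

definition homogeneous_poly :: "nat \<Rightarrow> (real ^ ('m::finite) \<Rightarrow> real) set" where
  "homogeneous_poly k =
     {p. real_polynomial_function p \<and> (\<forall>t x. p (t *\<^sub>R x) = t ^ k * p x)}"

text \<open>The symmetric matrix of a quadratic form, by polarization.\<close>

definition form_matrix :: "(real ^ ('m::finite) \<Rightarrow> real) \<Rightarrow> real ^ 'm ^ 'm" where
  "form_matrix \<beta> =
     (\<chi> i j. (\<beta> (axis i 1 + axis j 1) - \<beta> (axis i 1) - \<beta> (axis j 1)) / 2)"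

definition supporting_hyperplane :: "('m::finite) point set \<Rightarrow> 'm point \<Rightarrow> 'm point set \<Rightarrow> bool" where
  "supporting_hyperplane \<Omega> b H \<longleftrightarrow>
     (\<exists>a. a \<noteq> 0 \<and> H = {x. a \<bullet> (x - b) = 0} \<and> (\<forall>x\<in>\<Omega>. a \<bullet> (x - b) \<ge> 0))"

text \<open>The 3-jet at 0 as a Taylor polynomial: its degree-k part at \<open>v\<close> is the k-th Taylor
  coefficient of \<open>h\<close> along the line through \<open>v\<close>.\<close>

definition jet3 :: "(real ^ ('m::finite) \<Rightarrow> real) \<Rightarrow> real ^ 'm \<Rightarrow> real" where
  "jet3 h v = (\<Sum>k\<le>3. (deriv ^^ k) (\<lambda>t. h (t *\<^sub>R v)) 0 / fact k)"

text \<open>The class of \<open>J(\<theta>)\<close> up to positive scaling, over all admissible choices of the base point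
  and of the affine function.\<close>

definition shape_class ::
    "('m::finite) point set \<Rightarrow> (real ^ 'm \<Rightarrow> 'm hmatrix) \<Rightarrow> (real ^ 'm \<Rightarrow> real) set" where
  "shape_class \<Omega> \<theta> =
     {q. \<exists>b H a d r. b \<in> frontier \<Omega> \<and> supporting_hyperplane \<Omega> b H \<and>
           (\<forall>x\<in>H. a \<bullet> x + d = 0) \<and> (\<forall>x\<in>interior \<Omega>. a \<bullet> x + d > 0) \<and> r > 0 \<and>
           q = (\<lambda>v. r * jet3 (\<lambda>u. a \<bullet> aff_act (\<theta> u) b + d) v)}"

definition laplacian :: "(real ^ ('m::finite) \<Rightarrow> real) \<Rightarrow> real ^ 'm \<Rightarrow> real" where
  "laplacian f x = (\<Sum>i\<in>UNIV. (deriv ^^ 2) (\<lambda>t. f (x + t *\<^sub>R axis i 1)) 0)"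

definition harmonic_wrt ::
    "(real ^ ('m::finite) \<Rightarrow> real) \<Rightarrow> (real ^ 'm \<Rightarrow> real) \<Rightarrow> bool" where
  "harmonic_wrt \<beta> c \<longleftrightarrow>
     (\<exists>L :: real ^ 'm ^ 'm. invertible L \<and> (\<forall>v. \<beta> (L *v v) = (norm v)\<^sup>2) \<and>
        (\<forall>x. laplacian (\<lambda>v. c (L *v v)) x = 0))"


subsection \<open>Affine normals\<close>

definition tangent_space :: "('m::finite) point set \<Rightarrow> 'm point \<Rightarrow> 'm point set" where
  "tangent_space S p =
     {v. \<exists>\<gamma>. \<gamma> 0 = p \<and> (\<forall>t. \<gamma> t \<in> S) \<and> (\<gamma> has_vector_derivative v) (at (0::real))}"

text \<open>Unit normal of the tangent hyperplane at \<open>p\<close>, towards the side containing \<open>S\<close>.\<close>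

definition inner_unit_normal :: "('m::finite) point set \<Rightarrow> 'm point \<Rightarrow> 'm point \<Rightarrow> bool" where
  "inner_unit_normal S p w \<longleftrightarrow>
     norm w = 1 \<and> tangent_space S p = {v. w \<bullet> v = 0} \<and> (\<forall>x\<in>S. w \<bullet> (x - p) \<ge> 0)"

text \<open>The part of the parallel hyperplane at distance \<open>\<delta>\<close> enclosed by \<open>S\<close>. The centre of mass
  has to be that of this solid section: the centre of mass of its boundary with respect to
  Euclidean surface measure is not affinely invariant.\<close>

definition hyperplane_section ::
    "('m::finite) point set \<Rightarrow> 'm point \<Rightarrow> 'm point \<Rightarrow> real \<Rightarrow> 'm point set" where
  "hyperplane_section S p w \<delta> = convex hull (S \<inter> {x. w \<bullet> (x - p) = \<delta>})"

text \<open>Centre of mass of a subset of a hyperplane for the Lebesgue measure of the hyperplane,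
  which is transported by an isometric parametrization.\<close>

definition is_center_of_mass :: "('m::finite) point set \<Rightarrow> 'm point \<Rightarrow> bool" where
  "is_center_of_mass K x \<longleftrightarrow>
     (\<exists>f :: real ^ 'm \<Rightarrow> 'm point.
        (\<forall>y z. dist (f y) (f z) = dist y z) \<and> K \<subseteq> range f \<and>
        measure lebesgue (f -` K) > 0 \<and>
        (f has_integral measure lebesgue (f -` K) *\<^sub>R x) (f -` K))"

definition affine_normal :: "('m::finite) point set \<Rightarrow> 'm point \<Rightarrow> 'm point \<Rightarrow> bool" where
  "affine_normal S p \<nu> \<longleftrightarrow>
     \<nu> \<noteq> 0 \<and>
     (\<exists>w x k. inner_unit_normal S p w \<and> w \<bullet> \<nu> > 0 \<and>
        (\<forall>\<^sub>F \<delta> in at_right 0. is_center_of_mass (hyperplane_section S p w \<delta>) (x \<delta>)) \<and>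
        k \<noteq> 0 \<and> ((\<lambda>\<delta>. (x \<delta> - p) /\<^sub>R \<delta>) \<longlongrightarrow> k *\<^sub>R \<nu>) (at_right (0::real)))"

definition flow_lines_affine_normal ::
    "(real \<Rightarrow> ('m::finite) point \<Rightarrow> 'm point) \<Rightarrow> 'm point set \<Rightarrow> bool" where
  "flow_lines_affine_normal \<Phi> S \<longleftrightarrow>
     (\<forall>p\<in>S. \<exists>\<nu> k. affine_normal S p \<nu> \<and> k \<noteq> 0 \<and>
        ((\<lambda>t. \<Phi> t p) has_vector_derivative k *\<^sub>R \<nu>) (at 0))"

text \<open>The point \<open>z\<close> of the projective completion is given by homogeneous coordinates; the
  projective line through \<open>p\<close> in direction \<open>\<nu>\<close> is the span below.\<close>

definition affine_sphere :: "('m::finite) point set \<Rightarrow> bool" where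
  "affine_sphere S \<longleftrightarrow>
     (\<exists>z. z \<noteq> 0 \<and> (\<forall>p\<in>S. \<exists>\<nu>. affine_normal S p \<nu> \<and> z \<in> span {hom_point p, hom_dir \<nu>}))"

end

theory Submission
  imports Defs
begin

text \<open>
  Let \<open>X v\<close> be the derivative of \<open>t \<mapsto> \<theta> (t v)\<close> at \<open>0\<close>, and choose coordinates on \<open>V\<close> in which the quadratic
  part of the height function is the standard inner product. Together with the identity, the
  matrices \<open>X v\<close> generate a commutative algebra for which a boundary point \<open>b\<close> is a cyclic vector; it
  is spanned by \<open>1\<close>, the \<open>X v\<close>, and one further element \<open>e\<close> with \<open>e X v = \<kappa> X v\<close> and \<open>e\<^sup>2 = \<kappa> e\<close>. The vector
  \<open>e b\<close> is the direction of the radial flow at \<open>b\<close>, and \<open>\<kappa> \<ge> 0\<close> because the boundary is not compact.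

  All four conditions are equivalent to \<open>tr (X v) = 0\<close> for all \<open>v\<close>. The Laplacian of the cubic is a
  multiple of this trace. The affine vector field \<open>X v\<close> is tangent to the boundary and has constant
  divergence \<open>tr (X v)\<close>, so by the divergence theorem the centre of mass of the section at height \<open>\<delta>\<close>
  differs from \<open>b + \<delta> e b\<close> by \<open>\<rho> \<delta> X t b\<close>, where \<open>t \<bullet> v = tr (X v)\<close> and \<open>\<rho>\<close> is the volume of the cap
  divided by \<open>\<delta>\<close> times the area of the section. Hence the affine normal is \<open>(e + \<rho> X t) b\<close> with
  \<open>0 < \<rho> < 1\<close>. If the trace vanishes, then the algebra is either nilpotent, giving \<open>Tr 0\<close>, or its
  maximal ideal is diagonalized by the spectral theorem, giving \<open>Tr s\<close> with \<open>s > 0\<close>; conversely all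
  elements of \<open>Tr s\<close> have determinant one.
\<close>

subsection \<open>Lebesgue measure under linear maps\<close>

text \<open>An affine normal is a limit whose existence is not known in advance. If the trace is
  nonzero, convergence of \<rho> is extracted from the hypothesis that an affine normal exists, and
  only uniform bounds on \<rho> are proved, instead of its value 2/(n+1) for a paraboloid. If the
  trace vanishes, the centroids lie exactly on a line and the limit is trivial. The lower bound on
  \<rho> is what lets (a) force trace zero; the upper bound, together with \<kappa> \<ge> 0, does so
  for (b).

  Two symmetries keep the computation local. By transitivity the domain has the same equations in
  the frames at all boundary points, so one estimate at \<open>b\<close> suffices. The matrices 1 +
  \<mu> e commute with the group and carry the boundary to any other horosphere, so every horosphere
  bounds a domain of the same kind, with the same \<open>X\<close>. Since \<open>\<theta>\<close> is
  only assumed continuous, the derivatives \<open>X v\<close> have to be shown to exist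
  first.\<close>

text \<open>The library states the determinant formula for the measure of a linear image only for
  well-ordered index types; \<open>'n idx\<close> is one with as many elements as \<open>'n\<close>.\<close>

typedef ('n::finite) idx = "{..<CARD('n)}"
  by (rule exI[of _ 0]) simp

instantiation idx :: (finite) "{finite, wellorder}"
begin

definition less_eq_idx :: "'a idx \<Rightarrow> 'a idx \<Rightarrow> bool" where
  "i \<le> j \<longleftrightarrow> Rep_idx i \<le> Rep_idx j"

definition less_idx :: "'a idx \<Rightarrow> 'a idx \<Rightarrow> bool" where
  "i < j \<longleftrightarrow> Rep_idx i < Rep_idx j"

instance
proof
  fix P :: "'a idx \<Rightarrow> bool" and a
  assume step: "\<And>x. (\<And>y. y < x \<Longrightarrow> P y) \<Longrightarrow> P x"
  show "P a"
    by (induction a rule: measure_induct_rule[of Rep_idx]) (use step less_idx_def in blast)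
next
  have "Rep_idx x < CARD('a)" for x :: "'a idx"
    using Rep_idx[of x] by simp
  then have "range (Rep_idx :: 'a idx \<Rightarrow> nat) \<subseteq> {..<CARD('a)}"
    by auto
  then show "finite (UNIV :: 'a idx set)"
    by (rule finite_imageD[OF finite_subset[OF _ finite_lessThan]]) (simp add: inj_def Rep_idx_inject)
qed (auto simp: less_eq_idx_def less_idx_def Rep_idx_inject)

end

lemma card_idx: "CARD('n::finite idx) = CARD('n)"
proof -
  have "card (UNIV :: 'n idx set) = card {..<CARD('n)}"
    by (rule type_definition.card[OF type_definition_idx])
  then show ?thesis by simp
qed

definition ix :: "'n::finite idx \<Rightarrow> 'n" where
  "ix = (SOME \<pi>. bij \<pi>)"

lemma bij_ix: "bij (ix :: 'n::finite idx \<Rightarrow> 'n)"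
proof -
  have "\<exists>\<pi> :: 'n idx \<Rightarrow> 'n. bij \<pi>"
    by (rule finite_same_card_bij) (simp_all add: card_idx)
  then show ?thesis
    unfolding ix_def by (rule someI_ex)
qed

lemma prod_Basis_vec:
  fixes f :: "real ^ 'n \<Rightarrow> 'b::comm_monoid_mult"
  shows "(\<Prod>b\<in>Basis. f b) = (\<Prod>i\<in>UNIV. f (axis i 1))"
proof -
  have "(Basis :: (real ^ 'n) set) = range (\<lambda>i. axis i 1)"
    by (auto simp: Basis_vec_def)
  moreover have "inj (\<lambda>i. axis i 1 :: real ^ 'n)"
    by (auto simp: inj_def axis_eq_axis)
  ultimately show ?thesis
    using prod.reindex[of "\<lambda>i. axis i 1 :: real ^ 'n" UNIV f] by (simp only: o_def)
qed

text \<open>Relabelling coordinates carries boxes to boxes with the same side lengths, and boxes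
  determine Lebesgue measure.\<close>

lemma distr_lborel_reindex:
  fixes \<pi> :: "'a::finite \<Rightarrow> 'b::finite"
  assumes "bij \<pi>"
  shows "distr lborel borel (\<lambda>x::real^'b. \<chi> i. x $ \<pi> i) = lborel"
proof (rule lborel_eqI[symmetric])
  have meas: "(\<lambda>x::real^'b. \<chi> i. x $ \<pi> i) \<in> borel_measurable borel"
    by (intro borel_measurable_continuous_onI continuous_intros)
  fix l u :: "real ^ 'a"
  assume le: "\<And>b. b \<in> Basis \<Longrightarrow> l \<bullet> b \<le> u \<bullet> b"
  then have le': "l $ i \<le> u $ i" for i
    by (metis axis_in_Basis_iff cart_eq_inner_axis Basis_real_def insertI1)
  let ?l = "\<chi> j. l $ inv \<pi> j" and ?u = "\<chi> j. u $ inv \<pi> j"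
  have "(\<lambda>x::real^'b. \<chi> i. x $ \<pi> i) -` box l u = box ?l ?u"
    using assms by (auto simp: mem_box_cart bij_is_inj bij_is_surj surj_f_inv_f)
      (metis assms bij_inv_eq_iff)+
  moreover have "emeasure lborel (box ?l ?u) = ennreal (\<Prod>b\<in>Basis. (?u - ?l) \<bullet> b)"
    using le' by (subst emeasure_lborel_box) (auto simp: Basis_vec_def inner_axis)
  moreover have "(\<Prod>b\<in>Basis. (?u - ?l) \<bullet> b) = (\<Prod>b\<in>Basis. (u - l) \<bullet> b)"
    by (simp add: prod_Basis_vec inner_axis)
      (rule prod.reindex_bij_betw[OF bij_imp_bij_inv[OF assms], of "\<lambda>i. u $ i - l $ i"])
  ultimately show "emeasure (distr lborel borel (\<lambda>x::real^'b. \<chi> i. x $ \<pi> i)) (box l u)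
      = ennreal (\<Prod>b\<in>Basis. (u - l) \<bullet> b)"
    using meas by (simp add: emeasure_distr)
qed simp

text \<open>The ordinary determinant of \<open>g\<close>, with rows and columns relabelled by
  \<open>ix\<close>.\<close>

definition idx_det :: "(real ^ 'n \<Rightarrow> real ^ 'n) \<Rightarrow> real" where
  "idx_det g = det (\<chi> i j. g (axis (ix j) 1) $ ix i :: real ^ ('n::finite) idx ^ 'n idx)"

text \<open>Stated as a density so that the transformation rules for measures and for integrals both
  follow. It is enough to compare boxes; the preimage of a box is its image under the inverse map,
  hence measurable and of finite measure.\<close>

lemma lborel_linear_wellorder:
  fixes g :: "real ^ 'n::{finite,wellorder} \<Rightarrow> real ^ 'n::{finite,wellorder}"
  assumes "linear g" "inj g"
  shows "lborel = density (distr lborel borel g) (\<lambda>_. ennreal \<bar>det (matrix g)\<bar>)"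
proof (rule lborel_eqI)
  have g [measurable]: "g \<in> borel_measurable borel"
    using assms(1) by (simp add: borel_measurable_continuous_onI linear_continuous_on linear_linear)
  have surj: "surj g"
    using assms linear_injective_imp_surjective by blast
  fix l u :: "real ^ 'n::{finite,wellorder}"
  assume le: "\<And>b. b \<in> Basis \<Longrightarrow> l \<bullet> b \<le> u \<bullet> b"
  let ?S = "g -` box l u"
  obtain h where h: "linear h" "\<And>x. h (g x) = x" "\<And>x. g (h x) = x"
    using linear_injective_isomorphism[OF assms] by metis
  have S: "?S = h ` box l u"
    using h by (auto simp: image_iff) (metis h(2))
  have meas: "?S \<in> lmeasurable"
    unfolding S by (rule measurable_linear_image) (use h in auto)
  have Sb: "?S \<in> sets borel"
    using measurable_sets[OF g, of "box l u"] by simp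
  have "measure lebesgue (g ` ?S) = \<bar>det (matrix g)\<bar> * measure lebesgue ?S"
    by (rule measure_linear_image) (use assms meas in auto)
  then have eq: "measure lborel (box l u) = \<bar>det (matrix g)\<bar> * measure lborel ?S"
    using surj Sb by (simp add: surj_image_vimage_eq measure_completion)
  have fin: "emeasure lborel ?S < \<infinity>"
    unfolding S using h(1) by (intro emeasure_bounded_finite)
      (metis bounded_box bounded_linear_image linear_linear)
  have "emeasure (density (distr lborel borel g) (\<lambda>_. ennreal \<bar>det (matrix g)\<bar>)) (box l u)
      = ennreal \<bar>det (matrix g)\<bar> * emeasure lborel ?S"
    by (simp add: emeasure_density nn_integral_cmult emeasure_distr)
  also have "\<dots> = ennreal (measure lborel (box l u))"
    using fin by (simp add: eq ennreal_mult emeasure_eq_ennreal_measure less_top)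
  also have "\<dots> = ennreal (\<Prod>b\<in>Basis. (u - l) \<bullet> b)"
    using le by (simp add: measure_lborel_box)
  finally show "emeasure (density (distr lborel borel g) (\<lambda>_. ennreal \<bar>det (matrix g)\<bar>)) (box l u)
      = ennreal (\<Prod>b\<in>Basis. (u - l) \<bullet> b)" .
qed simp

text \<open>Conjugation by the measure-preserving relabellings \<open>R\<close> and \<open>Q\<close>
  reduces this to the well-ordered index type.\<close>

lemma lborel_linear:
  fixes g :: "real ^ 'n \<Rightarrow> real ^ 'n"
  assumes "linear g" "inj g"
  shows "lborel = density (distr lborel borel g) (\<lambda>_. ennreal \<bar>idx_det g\<bar>)"
proof (rule measure_eqI)
  define R :: "real ^ 'n \<Rightarrow> real ^ 'n idx" where "R x = (\<chi> i. x $ ix i)" for x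
  define Q :: "real ^ 'n idx \<Rightarrow> real ^ 'n" where "Q x = (\<chi> i. x $ inv ix i)" for x
  have RQ: "R (Q x) = x" for x
    by (simp add: R_def Q_def vec_eq_iff bij_ix bij_is_inj)
  have QR: "Q (R x) = x" for x
    by (simp add: R_def Q_def vec_eq_iff bij_ix bij_is_surj surj_f_inv_f)
  have lin: "linear R" "linear Q"
    by (auto intro!: linearI simp: R_def Q_def vec_eq_iff)
  have R [measurable]: "R \<in> borel_measurable borel" and Q [measurable]: "Q \<in> borel_measurable borel"
    and g [measurable]: "g \<in> borel_measurable borel"
    using lin assms(1) by (simp_all add: borel_measurable_continuous_onI linear_continuous_on linear_linear)
  have lR: "distr lborel borel R = lborel"
    unfolding R_def by (rule distr_lborel_reindex[OF bij_ix])
  have eR: "emeasure lborel (R -` B) = emeasure lborel B" if "B \<in> sets borel" for B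
    using that emeasure_distr[of R lborel borel B] by (simp add: lR)
  let ?g = "R \<circ> g \<circ> Q"
  have lg: "linear ?g"
    using assms lin by (intro linear_compose)
  have ig: "inj ?g"
    by (rule injI) (metis assms(2) RQ QR comp_apply injD)
  have Qax: "Q (axis j 1) = axis (ix j) 1" for j
  proof -
    have "inv ix i = j \<longleftrightarrow> i = ix j" for i
      by (metis bij_inv_eq_iff bij_ix)
    then show ?thesis
      by (simp add: Q_def axis_def vec_eq_iff)
  qed
  have mg: "det (matrix ?g) = idx_det g"
    by (simp add: idx_det_def matrix_def Qax) (simp add: R_def)
  show "sets lborel = sets (density (distr lborel borel g) (\<lambda>_. ennreal \<bar>idx_det g\<bar>))"
    by simp
  fix A :: "(real ^ 'n) set"
  assume "A \<in> sets lborel"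
  then have A [measurable]: "A \<in> sets borel"
    by simp
  have A': "Q -` A \<in> sets borel"
    using measurable_sets[OF Q A] by simp
  have A'': "g -` A \<in> sets borel"
    using measurable_sets[OF g A] by simp
  have A3: "?g -` (Q -` A) \<in> sets borel"
  proof -
    have "?g -` (Q -` A) = Q -` (g -` A)"
      by (auto simp: QR)
    then show ?thesis
      using measurable_sets[OF Q A''] by simp
  qed
  have "emeasure lborel A = emeasure lborel (R -` (Q -` A))"
    by (simp add: vimage_def QR)
  also have "\<dots> = emeasure lborel (Q -` A)"
    by (rule eR[OF A'])
  also have "\<dots> = emeasure (density (distr lborel borel ?g) (\<lambda>_. ennreal \<bar>det (matrix ?g)\<bar>)) (Q -` A)"
    using lborel_linear_wellorder[OF lg ig] by simp
  also have "\<dots> = ennreal \<bar>idx_det g\<bar> * emeasure lborel (?g -` (Q -` A))"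
    using A' unfolding mg by (simp add: emeasure_density nn_integral_cmult emeasure_distr)
  also have "emeasure lborel (?g -` (Q -` A)) = emeasure lborel (R -` (?g -` (Q -` A)))"
    by (rule eR[OF A3, symmetric])
  also have "R -` (?g -` (Q -` A)) = g -` A"
    by (auto simp: QR)
  finally show "emeasure lborel A = emeasure (density (distr lborel borel g) (\<lambda>_. ennreal \<bar>idx_det g\<bar>)) A"
    by (simp add: emeasure_density nn_integral_cmult emeasure_distr)
qed

lemma measure_affine_vimage:
  fixes g :: "real ^ 'n \<Rightarrow> real ^ 'n"
  assumes "linear g" "inj g" "A \<in> sets borel"
  shows "measure lborel A = \<bar>idx_det g\<bar> * measure lborel ((\<lambda>x. a + g x) -` A)"
proof -
  have g [measurable]: "g \<in> borel_measurable borel"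
    using assms(1) by (simp add: borel_measurable_continuous_onI linear_continuous_on linear_linear)
  let ?B = "(\<lambda>x. a + x) -` A"
  have B: "?B \<in> sets borel"
    using measurable_sets[of "\<lambda>x. a + x" borel borel A] assms(3) by simp
  have "emeasure lborel A = emeasure lborel ?B"
    using assms(3) lborel_distr_plus[of a] emeasure_distr[of "(+) a" lborel borel A] by simp
  also have "\<dots> = ennreal \<bar>idx_det g\<bar> * emeasure lborel (g -` ?B)"
    using B by (subst lborel_linear[OF assms(1,2)]) (simp add: emeasure_density nn_integral_cmult emeasure_distr)
  also have "g -` ?B = (\<lambda>x. a + g x) -` A"
    by auto
  finally show ?thesis
    by (simp add: measure_def enn2real_mult)
qed

text \<open>In the Leibniz expansion a permutation other than the identity moves at least two
  indices. After one factor is differentiated, another off-diagonal entry of the identity matrix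
  survives and annihilates the term.\<close>

lemma det_derivative_at_identity:
  fixes A :: "real \<Rightarrow> real ^ 'n ^ 'n"
  assumes A0: "A 0 = mat 1"
    and der: "\<And>i j. ((\<lambda>t. A t $ i $ j) has_real_derivative X $ i $ j) (at 0)"
  shows "((\<lambda>t. det (A t)) has_real_derivative trace X) (at 0)"
proof -
  have summand: "((\<lambda>t. of_int (sign p) * (\<Prod>i\<in>UNIV. A t $ i $ p i)) has_real_derivative
      (if p = id then trace X else 0)) (at 0)" if p: "p permutes (UNIV :: 'n set)" for p
  proof -
    let ?P = "\<lambda>i. X $ i $ p i * (\<Prod>j\<in>UNIV - {i}. A 0 $ j $ p j)"
    have "((\<lambda>t. \<Prod>i\<in>UNIV. A t $ i $ p i) has_derivative
        (\<lambda>y. \<Sum>i\<in>UNIV. (X $ i $ p i * y) * (\<Prod>j\<in>UNIV - {i}. A 0 $ j $ p j))) (at 0)"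
      by (rule has_derivative_prod) (use der in \<open>auto simp: has_field_derivative_def\<close>)
    also have "(\<lambda>y. \<Sum>i\<in>UNIV. (X $ i $ p i * y) * (\<Prod>j\<in>UNIV - {i}. A 0 $ j $ p j))
        = (*) (\<Sum>i\<in>UNIV. ?P i)"
      by (auto simp: sum_distrib_right sum_distrib_left fun_eq_iff algebra_simps intro!: sum.cong)
    finally have d: "((\<lambda>t. \<Prod>i\<in>UNIV. A t $ i $ p i) has_real_derivative (\<Sum>i\<in>UNIV. ?P i)) (at 0)"
      by (simp add: has_field_derivative_def)
    have "of_int (sign p) * (\<Sum>i\<in>UNIV. ?P i) = (if p = id then trace X else 0)"
    proof (cases "p = id")
      case True
      then show ?thesis
        by (simp add: A0 mat_def trace_def sign_id)
    next
      case False
      have "?P i = 0" for i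
      proof -
        obtain j where j: "j \<noteq> i" "p j \<noteq> j"
        proof -
          obtain k where k: "p k \<noteq> k"
            using False by (auto simp: fun_eq_iff)
          have "p (p k) \<noteq> p k"
            using k permutes_inj[OF p] by (auto dest: injD)
          then show thesis
            using that[of k] that[of "p k"] k by (cases "k = i") auto
        qed
        then have "(\<Prod>j\<in>UNIV - {i}. A 0 $ j $ p j) = 0"
          by (intro prod_zero) (auto simp: A0 mat_def intro!: bexI[of _ j])
        then show ?thesis by simp
      qed
      then have "(\<Sum>i\<in>UNIV. ?P i) = 0"
        by (intro sum.neutral) blast
      then show ?thesis
        using False by simp
    qed
    then show ?thesis
      using DERIV_cmult[OF d, of "of_int (sign p)"] by simp
  qed
  have "((\<lambda>t. \<Sum>p\<in>{p. p permutes UNIV}. of_int (sign p) * (\<Prod>i\<in>UNIV. A t $ i $ p i))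
      has_real_derivative (\<Sum>p\<in>{p. p permutes (UNIV :: 'n set)}. if p = id then trace X else 0)) (at 0)"
    by (rule DERIV_sum) (use summand in simp)
  moreover have "(\<Sum>p\<in>{p. p permutes (UNIV :: 'n set)}. if p = id then trace X else 0) = trace X"
    by (simp add: permutes_id finite_permutations)
  ultimately show ?thesis
    by (simp add: det_def)
qed

subsection \<open>Commuting self-adjoint operators\<close>

text \<open>The maximum of the Rayleigh quotient on the unit sphere of \<open>W\<close> is attained
  at an eigenvector: the defect \<open>y\<close> is a direction along which the quotient would
  otherwise grow to first order.\<close>

lemma selfadjoint_eigenvector:
  fixes f :: "'a::euclidean_space \<Rightarrow> 'a"
  assumes "linear f" and sym: "\<And>x y. f x \<bullet> y = x \<bullet> f y"
    and W: "subspace W" "W \<noteq> {0}" and inv: "\<And>x. x \<in> W \<Longrightarrow> f x \<in> W"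
  obtains x c where "x \<in> W" "norm x = 1" "f x = c *\<^sub>R x"
proof -
  interpret linear f by fact
  let ?S = "sphere 0 1 \<inter> W"
  have "compact ?S"
    by (simp add: W(1) closed_subspace compact_Int_closed)
  moreover have "?S \<noteq> {}"
  proof -
    obtain z where "z \<in> W" "z \<noteq> 0"
      using W subspace_0 by blast
    then have "z /\<^sub>R norm z \<in> ?S"
      by (simp add: W(1) subspace_scale)
    then show ?thesis by blast
  qed
  moreover have "continuous_on ?S (\<lambda>x. x \<bullet> f x)"
    by (intro continuous_intros linear_continuous_on linear_conv_bounded_linear[THEN iffD1] \<open>linear f\<close>)
  ultimately obtain x where x: "x \<in> ?S" and max: "\<And>y. y \<in> ?S \<Longrightarrow> y \<bullet> f y \<le> x \<bullet> f x"
    using continuous_attains_sup by (metis (no_types, lifting))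
  define c where "c = x \<bullet> f x"
  have le: "y \<bullet> f y \<le> c * (y \<bullet> y)" if "y \<in> W" for y
  proof (cases "y = 0")
    case False
    then have "y /\<^sub>R norm y \<in> ?S"
      using that by (simp add: W(1) subspace_scale)
    from max[OF this] have "(y \<bullet> f y) / (norm y)\<^sup>2 \<le> c"
      by (simp add: c_def scale power2_eq_square divide_simps)
    then show ?thesis
      using False by (simp add: divide_simps power2_norm_eq_inner)
  qed (simp add: zero)
  have xW: "x \<in> W" "norm x = 1"
    using x by auto
  define y where "y = f x - c *\<^sub>R x"
  have yW: "y \<in> W"
    unfolding y_def by (intro subspace_diff subspace_scale W(1) inv xW)
  define b where "b = y \<bullet> f y - c * (y \<bullet> y)"
  have quad: "2 * t * (y \<bullet> y) + t\<^sup>2 * b \<le> 0" for t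
  proof -
    have "x + t *\<^sub>R y \<in> W"
      by (intro subspace_add subspace_scale W(1) yW xW)
    from le[OF this] have "(x + t *\<^sub>R y) \<bullet> f (x + t *\<^sub>R y) - c * ((x + t *\<^sub>R y) \<bullet> (x + t *\<^sub>R y)) \<le> 0"
      by simp
    also have "(x + t *\<^sub>R y) \<bullet> f (x + t *\<^sub>R y) - c * ((x + t *\<^sub>R y) \<bullet> (x + t *\<^sub>R y))
        = (c - c * (x \<bullet> x)) + 2 * t * (y \<bullet> f x - c * (x \<bullet> y)) + t\<^sup>2 * b"
      by (simp add: add scale inner_simps c_def b_def algebra_simps power2_eq_square inner_commute
          sym[of y x, symmetric] sym[of x y])
    also have "y \<bullet> f x - c * (x \<bullet> y) = y \<bullet> y"
      by (simp add: y_def inner_simps inner_commute algebra_simps)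
    finally show ?thesis
      using xW by (simp add: dot_square_norm)
  qed
  have "y \<bullet> y = 0"
  proof (rule ccontr)
    assume "y \<bullet> y \<noteq> 0"
    then have pos: "y \<bullet> y > 0"
      by (simp add: less_le)
    \<comment> \<open>So small that the linear term 2 t (y \<bullet> y) dominates the quadratic
      one.\<close>
    define t where "t = (y \<bullet> y) / (\<bar>b\<bar> + 1)"
    have t: "t > 0" "t * \<bar>b\<bar> < 2 * (y \<bullet> y)"
      using pos by (auto simp: t_def add_nonneg_pos divide_simps algebra_simps)
    have "t * (2 * (y \<bullet> y) + t * b) \<le> 0"
      using quad[of t] by (simp add: algebra_simps power2_eq_square)
    then have "2 * (y \<bullet> y) + t * b \<le> 0"
      using t(1) by (simp add: mult_le_0_iff)
    moreover have "- (t * \<bar>b\<bar>) \<le> t * b"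
      using mult_left_mono[of "- \<bar>b\<bar>" b t] t(1) by simp
    ultimately show False
      using t by linarith
  qed
  then have "f x = c *\<^sub>R x"
    by (simp add: y_def)
  with xW that show thesis by blast
qed

text \<open>Induction on the dimension. Unless every operator is scalar on \<open>W\<close>, one of
  them has a proper eigenspace; it is invariant under the family by commutation, and its complement
  in \<open>W\<close> by symmetry.\<close>

lemma commuting_selfadjoint_eigenbasis:
  fixes F :: "('a::euclidean_space \<Rightarrow> 'a) set"
  assumes "subspace W"
    and lin: "\<And>f. f \<in> F \<Longrightarrow> linear f"
    and sym: "\<And>f x y. f \<in> F \<Longrightarrow> f x \<bullet> y = x \<bullet> f y"
    and comm: "\<And>f g x. f \<in> F \<Longrightarrow> g \<in> F \<Longrightarrow> f (g x) = g (f x)"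
    and inv: "\<And>f x. f \<in> F \<Longrightarrow> x \<in> W \<Longrightarrow> f x \<in> W"
  shows "\<exists>B \<subseteq> W. pairwise orthogonal B \<and> (\<forall>b\<in>B. norm b = 1) \<and> span B = W \<and>
      (\<forall>b\<in>B. \<forall>f\<in>F. \<exists>c. f b = c *\<^sub>R b)"
  using assms(1) inv
proof (induction "dim W" arbitrary: W rule: less_induct)
  case (less W)
  show ?case
  proof (cases "\<forall>f\<in>F. \<exists>c. \<forall>x\<in>W. f x = c *\<^sub>R x")
    case True
    obtain B where "B \<subseteq> W" "pairwise orthogonal B" "\<And>x. x \<in> B \<Longrightarrow> norm x = 1" "span B = W"
      using orthonormal_basis_subspace[OF less.prems(1)] by metis
    then show ?thesis
      using True by (intro exI[of _ B]) blast
  next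
    case False
    then obtain f where f: "f \<in> F" and nonscalar: "\<And>c. \<exists>x\<in>W. f x \<noteq> c *\<^sub>R x"
      by blast
    interpret f: linear f
      using lin f by blast
    have "W \<noteq> {0}"
      using nonscalar[of 0] f.zero by auto
    then obtain x c where x: "x \<in> W" "norm x = 1" "f x = c *\<^sub>R x"
      using selfadjoint_eigenvector[OF lin[OF f] sym[OF f] less.prems(1)] less.prems(2)[OF f] by metis
    define E where "E = {x \<in> W. f x = c *\<^sub>R x}"
    define E' where "E' = {x \<in> W. \<forall>y\<in>E. y \<bullet> x = 0}"
    have W: "subspace W" by fact
    have sE: "subspace E"
      using W by (auto simp: E_def subspace_def f.add f.scale f.zero algebra_simps)
    have sE': "subspace E'"
      using W by (auto simp: E'_def subspace_def inner_simps)
    have "E \<noteq> W"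
      using nonscalar[of c] by (auto simp: E_def)
    moreover have EW: "E \<subseteq> W"
      by (auto simp: E_def)
    ultimately have dE: "dim E < dim W"
      by (metis W dim_psubset psubsetI sE span_eq_iff)
    have E'W: "E' \<subseteq> W"
      by (auto simp: E'_def)
    have "x \<in> E"
      using x by (simp add: E_def)
    then have "x \<notin> E'"
      using x by (auto simp: E'_def dot_square_norm intro!: bexI[of _ x])
    then have dE': "dim E' < dim W"
      by (metis W E'W dim_psubset psubsetI sE' span_eq_iff x(1))
    have iE: "g x \<in> E" if "g \<in> F" "x \<in> E" for g x
    proof -
      have "f (g x) = c *\<^sub>R g x"
        using that comm[OF f that(1)] linear_scale[OF lin[OF that(1)]] by (simp add: E_def)
      then show ?thesis
        using that less.prems(2) by (simp add: E_def)
    qed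
    have iE': "g x \<in> E'" if "g \<in> F" "x \<in> E'" for g x
    proof -
      have "y \<bullet> g x = 0" if "y \<in> E" for y
        using iE[OF \<open>g \<in> F\<close> that] \<open>x \<in> E'\<close> sym[OF \<open>g \<in> F\<close>, of y x] by (simp add: E'_def)
      then show ?thesis
        using that less.prems(2) by (simp add: E'_def)
    qed
    obtain B where B: "B \<subseteq> E" "pairwise orthogonal B" "\<forall>b\<in>B. norm b = 1" "span B = E"
        "\<forall>b\<in>B. \<forall>f\<in>F. \<exists>c. f b = c *\<^sub>R b"
      using less.hyps[OF dE sE] iE by (smt (verit, best))
    obtain B' where B': "B' \<subseteq> E'" "pairwise orthogonal B'" "\<forall>b\<in>B'. norm b = 1" "span B' = E'"
        "\<forall>b\<in>B'. \<forall>f\<in>F. \<exists>c. f b = c *\<^sub>R b"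
      using less.hyps[OF dE' sE'] iE' by (smt (verit, best))
    have orth: "b \<bullet> b' = 0" if "b \<in> B" "b' \<in> B'" for b b'
      using that B(1) B'(1) by (auto simp: E'_def)
    have "pairwise orthogonal (B \<union> B')"
      using B(2) B'(2) orth by (auto simp: pairwise_def orthogonal_def) (metis inner_commute)
    moreover have "span (B \<union> B') = W"
    proof
      show "span (B \<union> B') \<subseteq> W"
        using B(1) B'(1) EW E'W W by (intro span_minimal) auto
      show "W \<subseteq> span (B \<union> B')"
      proof
        fix w assume w: "w \<in> W"
        obtain y z where yz: "y \<in> span E" "\<And>u. u \<in> span E \<Longrightarrow> orthogonal z u" "w = y + z"
          using orthogonal_subspace_decomp_exists[of E w] by metis
        have "y \<in> E"
          using yz(1) sE span_eq_iff by blast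
        have "z = w - y"
          using yz by simp
        then have "z \<in> W"
          using w \<open>y \<in> E\<close> EW W by (auto intro: subspace_diff)
        then have "z \<in> E'"
          using yz(2) span_base by (auto simp: E'_def orthogonal_def inner_commute)
        then have "y \<in> span (B \<union> B')" "z \<in> span (B \<union> B')"
          using \<open>y \<in> E\<close> B(4) B'(4) by (metis Un_upper1 Un_upper2 span_mono subsetD)+
        then show "w \<in> span (B \<union> B')"
          using yz(3) span_add by blast
      qed
    qed
    ultimately show ?thesis
      using B B' EW E'W by (intro exI[of _ "B \<union> B'"]) auto
  qed
qed

subsection \<open>Splitting off one coordinate\<close>

text \<open>The pair \<open>ypart\<close>, \<open>join\<close> is used at two levels: to split off
  the last homogeneous coordinate of a vector in dimension n + 1, and to split frame coordinates in
  dimension n into a tangential part in V and a height.\<close>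

definition ypart :: "real ^ 'm option \<Rightarrow> real ^ 'm::finite" where
  "ypart x = (\<chi> i. x $ Some i)"

definition join :: "real ^ 'm \<Rightarrow> real \<Rightarrow> real ^ ('m::finite) option" where
  "join y s = (\<chi> i. case i of None \<Rightarrow> s | Some j \<Rightarrow> y $ j)"

lemma ypart_nth [simp]: "ypart x $ i = x $ Some i"
  by (simp add: ypart_def)

lemma join_nth [simp]: "join y s $ None = s" "join y s $ Some i = y $ i"
  by (simp_all add: join_def)

lemma ypart_join [simp]: "ypart (join y s) = y"
  by (simp add: vec_eq_iff)

lemma vec_option_eq_iff: "x = y \<longleftrightarrow> x $ None = y $ None \<and> (\<forall>i. x $ Some i = y $ Some i)"
  for x y :: "'a ^ ('m::finite) option"
  by (metis not_Some_eq vec_eq_iff)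

lemma join_ypart [simp]: "join (ypart x) (x $ None) = x"
  by (simp add: vec_option_eq_iff)

lemma linear_ypart: "linear ypart"
  by (auto intro!: linearI simp: vec_eq_iff)

lemma ypart_simps [simp]: "ypart (x + y) = ypart x + ypart y" "ypart (r *\<^sub>R x) = r *\<^sub>R ypart x"
  "ypart 0 = 0" "ypart (x - y) = ypart x - ypart y" "ypart (- x) = - ypart x"
  by (simp_all add: vec_eq_iff)

lemma linear_join: "linear (\<lambda>(y, s). join y s)"
  by (auto intro!: linearI simp: vec_option_eq_iff)

lemma sum_UNIV_option: "(\<Sum>i\<in>UNIV. f i) = f None + (\<Sum>i\<in>UNIV. f (Some i))"
  for f :: "'m::finite option \<Rightarrow> 'a::comm_monoid_add"
  by (simp add: UNIV_option_conv sum.reindex)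

lemma prod_UNIV_option: "(\<Prod>i\<in>UNIV. f i) = f None * (\<Prod>i\<in>UNIV. f (Some i))"
  for f :: "'m::finite option \<Rightarrow> 'a::comm_monoid_mult"
  by (simp add: UNIV_option_conv prod.reindex)

lemma distr_lborel_join:
  "distr lborel borel (\<lambda>(y, s). join y s :: real ^ ('m::finite) option) = lborel"
proof (rule lborel_eqI[symmetric])
  have meas: "(\<lambda>(y, s). join y s :: real ^ 'm option) \<in> borel_measurable borel"
    by (intro borel_measurable_continuous_onI linear_continuous_on linear_conv_bounded_linear[THEN iffD1] linear_join)
  fix l u :: "real ^ 'm option"
  assume le: "\<And>b. b \<in> Basis \<Longrightarrow> l \<bullet> b \<le> u \<bullet> b"
  then have le': "l $ i \<le> u $ i" for i
    using le[of "axis i 1"] by (simp add: inner_axis)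
  have "(\<lambda>(y, s). join y s) -` box l u = box (ypart l) (ypart u) \<times> box (l $ None) (u $ None)"
    by (auto simp: mem_box_cart split: option.splits) (metis join_nth not_Some_eq)+
  moreover have "emeasure lborel (box (ypart l) (ypart u) \<times> box (l $ None) (u $ None))
      = emeasure lborel (box (ypart l) (ypart u)) * emeasure lborel (box (l $ None) (u $ None))"
    unfolding lborel_prod[symmetric] by (rule lborel.emeasure_pair_measure_Times) auto
  moreover have "emeasure lborel (box (ypart l) (ypart u)) = ennreal (\<Prod>b\<in>Basis. (ypart u - ypart l) \<bullet> b)"
    using le' by (subst emeasure_lborel_box) (auto simp: Basis_vec_def inner_axis)
  moreover have "emeasure lborel (box (l $ None) (u $ None)) = ennreal (u $ None - l $ None)"
    using le' by simp
  moreover have "(\<Prod>b\<in>Basis. (u - l) \<bullet> b)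
      = (\<Prod>b\<in>Basis. (ypart u - ypart l) \<bullet> b) * (u $ None - l $ None)"
    by (simp add: prod_Basis_vec inner_axis prod_UNIV_option mult.commute)
  moreover have "(\<Prod>b\<in>Basis. (ypart u - ypart l) \<bullet> b) \<ge> 0"
    using le' by (auto simp: prod_Basis_vec inner_axis intro!: prod_nonneg)
  ultimately show "emeasure (distr lborel borel (\<lambda>(y, s). join y s)) (box l u)
      = ennreal (\<Prod>b\<in>Basis. (u - l) \<bullet> b)"
    using meas le' by (simp add: emeasure_distr ennreal_mult)
qed simp

text \<open>Compactness makes every slice bounded, so real-valued slice lengths can be integrated
  instead of extended ones.\<close>

lemma fubini_join:
  fixes A :: "(real ^ ('m::finite) option) set"
  assumes "compact A"
  shows "integrable lborel (\<lambda>y. measure lborel {s. join y s \<in> A})" (is ?int)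
    and "measure lborel A = (\<integral>y. measure lborel {s. join y s \<in> A} \<partial>lborel)" (is ?eq)
proof -
  let ?J = "\<lambda>(y, s). join y s :: real ^ 'm option"
  have [measurable]: "A \<in> sets borel"
    using assms by (simp add: borel_compact)
  have J [measurable]: "?J \<in> borel_measurable borel"
    by (intro borel_measurable_continuous_onI linear_continuous_on linear_conv_bounded_linear[THEN iffD1] linear_join)
  have set: "?J -` A \<in> sets borel"
    using measurable_sets[OF J, of A] by simp
  then have set': "?J -` A \<in> sets (lborel \<Otimes>\<^sub>M lborel)"
    unfolding lborel_prod by simp
  have fin: "emeasure lborel A < \<infinity>"
    using assms by (intro emeasure_bounded_finite compact_imp_bounded)
  have slice: "emeasure lborel {s. join y s \<in> A} = ennreal (measure lborel {s. join y s \<in> A})" for y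
  proof -
    have "{s. join y s \<in> A} \<subseteq> (\<lambda>x. x $ None) ` A"
      by (auto simp: image_iff intro!: bexI[of _ "join y _"])
    moreover have "bounded ((\<lambda>x. x $ None) ` A)"
      using assms by (intro compact_imp_bounded compact_continuous_image) (auto intro!: continuous_intros)
    ultimately have "bounded {s. join y s \<in> A}"
      by (rule bounded_subset[rotated])
    then show ?thesis
      using emeasure_bounded_finite emeasure_eq_ennreal_measure less_top by (metis infinity_ennreal_def less_irrefl)
  qed
  have "emeasure lborel A = emeasure lborel (?J -` A)"
    using emeasure_distr[of ?J lborel borel A] by (simp add: distr_lborel_join)
  also have "\<dots> = (\<integral>\<^sup>+y. emeasure lborel (Pair y -` (?J -` A)) \<partial>lborel)"
    using lborel.emeasure_pair_measure_alt[OF set'] by (simp add: lborel_prod)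
  also have "\<dots> = (\<integral>\<^sup>+y. ennreal (measure lborel {s. join y s \<in> A}) \<partial>lborel)"
    by (simp add: vimage_def slice[symmetric])
  finally have eq: "emeasure lborel A = (\<integral>\<^sup>+y. ennreal (measure lborel {s. join y s \<in> A}) \<partial>lborel)" .
  have "(\<lambda>y. emeasure lborel (Pair y -` (?J -` A))) \<in> borel_measurable lborel"
    by (rule lborel.measurable_emeasure_Pair[OF set'])
  then have "(\<lambda>y. enn2real (emeasure lborel {s. join y s \<in> A})) \<in> borel_measurable lborel"
    by (simp add: vimage_def)
  then have meas: "(\<lambda>y. measure lborel {s. join y s \<in> A}) \<in> borel_measurable lborel"
    by (simp add: measure_def)
  show ?int
    by (rule integrableI_nonneg) (use meas fin eq in auto)
  show ?eq
    using integral_eq_nn_integral[OF meas] eq by (simp add: measure_def[of lborel A])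
qed

subsection \<open>Continuous homomorphisms into matrix groups are smooth\<close>

lemma bounded_bilinear_matrix_mult:
  "bounded_bilinear ((**) :: real ^ 'n ^ 'm \<Rightarrow> real ^ 'p ^ 'n \<Rightarrow> real ^ 'p ^ 'm)"
  unfolding bilinear_conv_bounded_bilinear[symmetric] bilinear_def
  by (auto intro!: linearI simp: matrix_matrix_mult_def vec_eq_iff algebra_simps sum.distrib sum_distrib_left)

lemma bounded_bilinear_matrix_vector_mult:
  "bounded_bilinear ((*v) :: real ^ 'n ^ 'm \<Rightarrow> real ^ 'n \<Rightarrow> real ^ 'm)"
  unfolding bilinear_conv_bounded_bilinear[symmetric] bilinear_def
  by (auto intro!: linearI simp: matrix_vector_mult_def vec_eq_iff algebra_simps sum.distrib sum_distrib_left)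

lemmas has_vector_derivative_matrix_mult =
  bounded_bilinear.has_vector_derivative[OF bounded_bilinear_matrix_mult]

lemmas has_vector_derivative_matrix_vector_mult =
  bounded_bilinear.has_vector_derivative[OF bounded_bilinear_matrix_vector_mult]

lemma continuous_det: "continuous_on UNIV (det :: real ^ 'n ^ 'n \<Rightarrow> real)"
  unfolding det_def by (intro continuous_intros)

text \<open>The average \<open>F r = \<integral>\<^bsub>0\<^esub>\<^bsup>r\<^esup> f\<close> is invertible for small \<open>r > 0\<close>, and \<open>f t ** F r\<close> is an
  integral of \<open>f\<close> over \<open>[t, t + r]\<close>, hence differentiable in \<open>t\<close>.\<close>

lemma one_parameter_group_differentiable:
  fixes f :: "real \<Rightarrow> real ^ 'n ^ 'n"
  assumes cont: "continuous_on UNIV f" and f0: "f 0 = mat 1" and hom: "\<And>s t. f (s + t) = f s ** f t"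
  shows "\<exists>X. (f has_vector_derivative X) (at 0)"
proof -
  have c: "continuous_on A f" for A
    using cont continuous_on_subset by blast
  define F where "F r = integral {0..r} f" for r
  have "(F has_vector_derivative f 0) (at 0 within {0..1})"
    unfolding F_def by (rule integral_has_vector_derivative) (use c in auto)
  then have "((\<lambda>r. (1 / \<bar>r\<bar>) *\<^sub>R (F r - r *\<^sub>R mat 1)) \<longlongrightarrow> 0) (at 0 within {0..1})"
    by (simp add: has_vector_derivative_def has_derivative_within F_def f0)
  moreover have "\<forall>\<^sub>F r in at 0 within {0..1}. (1 / \<bar>r\<bar>) *\<^sub>R (F r - r *\<^sub>R mat 1) = F r /\<^sub>R r - mat 1"
    unfolding eventually_at_filter
  proof (intro always_eventually allI impI)
    fix r :: real
    assume "r \<noteq> 0" "r \<in> {0..1}"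
    then have "\<bar>r\<bar> = r" "inverse r * r = 1"
      by auto
    then show "(1 / \<bar>r\<bar>) *\<^sub>R (F r - r *\<^sub>R mat 1) = F r /\<^sub>R r - mat 1"
      by (metis inverse_eq_divide scaleR_diff_right scaleR_one scaleR_scaleR)
  qed
  ultimately have "((\<lambda>r. F r /\<^sub>R r - mat 1) \<longlongrightarrow> 0) (at 0 within {0..1})"
    by (rule Lim_transform_eventually)
  then have "((\<lambda>r. F r /\<^sub>R r) \<longlongrightarrow> mat 1) (at 0 within {0..1})"
    by (simp add: LIM_zero_iff)
  then have "((\<lambda>r. det (F r /\<^sub>R r)) \<longlongrightarrow> det (mat 1 :: real ^ 'n ^ 'n)) (at 0 within {0..1})"
    using continuous_det by (intro isCont_tendsto_compose[of _ det])
      (auto simp: continuous_on_eq_continuous_at)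
  then have "\<forall>\<^sub>F r in at 0 within {0..1}. det (F r /\<^sub>R r) > 0"
    by (rule order_tendstoD) simp
  then have "\<forall>\<^sub>F r in at 0 within {0..1}. 0 < r \<and> det (F r /\<^sub>R r) > 0"
    by (auto simp: eventually_at_filter elim!: eventually_mono)
  moreover have "at 0 within {0..1::real} \<noteq> bot"
    by (simp add: at_within_Icc_at_right trivial_limit_at_right_real)
  ultimately have "\<exists>r. 0 < r \<and> det (F r /\<^sub>R r) > 0"
    by (rule eventually_happens'[rotated])
  then obtain r where r: "r > 0" "det (F r /\<^sub>R r) > 0"
    by blast
  then obtain G where G: "(F r /\<^sub>R r) ** G = mat 1"
    by (metis invertible_def invertible_det_nz less_irrefl)
  define H where "H = G /\<^sub>R r"
  have H: "F r ** H = mat 1"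
    using G by (simp add: H_def matrix_scalar_ac scalar_matrix_assoc)
  \<comment> \<open>The lower limit -1 puts t = 0 in the interior of the interval of integration, so
    that the fundamental theorem gives a two-sided derivative there.\<close>
  have fF: "f t ** F r = integral {-1..t + r} f - integral {-1..t} f" if t: "t \<in> {-1<..<1}" for t
  proof -
    have "f t ** F r = integral {0..r} (\<lambda>s. f t ** f s)"
      unfolding F_def
      by (rule integral_linear[OF _ bounded_bilinear.bounded_linear_right[OF bounded_bilinear_matrix_mult],
            unfolded o_def, symmetric])
        (use c in \<open>auto intro!: integrable_continuous_real\<close>)
    also have "\<dots> = integral {0..r} (f \<circ> (\<lambda>x. x + t))"
      by (simp add: hom[symmetric] o_def add.commute)
    also have "\<dots> = integral {0 + t..r + t} f"
      by (rule integral_shift) (rule c)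
    finally have "f t ** F r = integral {t..t + r} f"
      by (simp add: add.commute)
    moreover have "integral {-1..t} f + integral {t..t + r} f = integral {-1..t + r} f"
      by (rule Henstock_Kurzweil_Integration.integral_combine)
        (use t r c in \<open>auto intro!: integrable_continuous_real\<close>)
    ultimately show ?thesis
      by (simp add: algebra_simps)
  qed
  have d: "((\<lambda>u. integral {-1..u} f) has_vector_derivative f x) (at x)" if "x > -1" for x
  proof -
    have "((\<lambda>u. integral {-1..u} f) has_vector_derivative f x) (at x within {-1..x + 1})"
      by (rule integral_has_vector_derivative) (use c that in auto)
    moreover have "at x within {-1..x + 1} = at x"
      by (rule at_within_interior) (use that in auto)
    ultimately show ?thesis by simp
  qed
  have "((\<lambda>t. t + r) has_real_derivative 1) (at 0)"
    by (auto intro!: derivative_eq_intros)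
  then have "((\<lambda>t. t + r) has_vector_derivative 1) (at 0)"
    by (rule has_real_derivative_iff_has_vector_derivative[THEN iffD1])
  from vector_diff_chain_at[OF this, of "\<lambda>u. integral {-1..u} f" "f r"]
  have "((\<lambda>t. integral {-1..t + r} f) has_vector_derivative f r) (at 0)"
    using d[of r] r by (simp add: o_def)
  then have "((\<lambda>t. integral {-1..t + r} f - integral {-1..t} f) has_vector_derivative f r - f 0) (at 0)"
    using d[of 0] by (auto intro!: has_vector_derivative_diff)
  then have "((\<lambda>t. f t ** F r) has_vector_derivative f r - f 0) (at 0)"
    by (rule has_vector_derivative_transform_within_open[where S="{-1<..<1}"]) (auto simp: fF)
  then have "((\<lambda>t. (f t ** F r) ** H) has_vector_derivative (f r - f 0) ** H) (at 0)"
    by (rule bounded_linear.has_vector_derivative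
        [OF bounded_bilinear.bounded_linear_left[OF bounded_bilinear_matrix_mult]])
  moreover have "(f t ** F r) ** H = f t" for t
    by (simp add: matrix_mul_assoc[symmetric] H)
  ultimately show ?thesis
    by auto
qed

lemma one_parameter_group_derivative:
  fixes f :: "real \<Rightarrow> real ^ 'n ^ 'n"
  assumes "(f has_vector_derivative X) (at 0)" and hom: "\<And>s t. f (s + t) = f s ** f t"
  shows "(f has_vector_derivative X ** f t) (at t)"
proof -
  have "((\<lambda>s. f (s - t) ** f t) has_vector_derivative X ** f t) (at t)"
  proof (rule bounded_linear.has_vector_derivative
        [OF bounded_bilinear.bounded_linear_left[OF bounded_bilinear_matrix_mult]])
    show "((\<lambda>s. f (s - t)) has_vector_derivative X) (at t)"
    proof -
      have "((\<lambda>s. s - t) has_real_derivative 1) (at t)"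
        by (auto intro!: derivative_eq_intros)
      then have "((\<lambda>s. s - t) has_vector_derivative 1) (at t)"
        by (rule has_real_derivative_iff_has_vector_derivative[THEN iffD1])
      from vector_diff_chain_at[OF this, of f X] show ?thesis
        using assms(1) by (simp add: o_def)
    qed
  qed
  then show ?thesis
    by (simp add: hom[symmetric])
qed

text \<open>Multiplicativity carries the vanishing derivative of the determinant from 0 to every
  t.\<close>

lemma det_one_parameter_group:
  fixes f :: "real \<Rightarrow> real ^ 'n ^ 'n"
  assumes der: "(f has_vector_derivative X) (at 0)" and f0: "f 0 = mat 1"
    and hom: "\<And>s t. f (s + t) = f s ** f t" and "trace X = 0"
  shows "det (f t) = 1"
proof -
  have entries: "((\<lambda>t. f t $ i $ j) has_real_derivative X $ i $ j) (at 0)" for i j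
    unfolding has_real_derivative_iff_has_vector_derivative
    by (rule bounded_linear.has_vector_derivative[OF bounded_linear_compose[OF bounded_linear_vec_nth bounded_linear_vec_nth] der])
  have d0: "((\<lambda>t. det (f t)) has_real_derivative 0) (at 0)"
    using det_derivative_at_identity[OF f0 entries] assms(4) by simp
  have "((\<lambda>t. det (f t)) has_real_derivative 0) (at t)" for t
  proof -
    have "((\<lambda>s. det (f (s - t))) has_real_derivative 0 * 1) (at t)"
      by (rule DERIV_chain2[where f="\<lambda>s. det (f s)"]) (use d0 in \<open>auto intro!: derivative_eq_intros\<close>)
    then have "((\<lambda>s. det (f (s - t)) * det (f t)) has_real_derivative 0) (at t)"
      by (auto intro!: derivative_eq_intros)
    then show ?thesis
      by (simp add: det_mul[symmetric] hom[symmetric])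
  qed
  then have "det (f t) = det (f 0)"
    using DERIV_isconst_all[of "\<lambda>t. det (f t)" t 0] by simp
  then show ?thesis
    by (simp add: f0)
qed

section \<open>Homogeneous coordinates and linear functionals\<close>

lemma hom_point_join: "hom_point x = join x 1"
  by (simp add: vec_option_eq_iff hom_point_def)

lemma hom_dir_join: "hom_dir x = join x 0"
  by (simp add: vec_option_eq_iff hom_dir_def)

lemma aff_act_ypart: "aff_act A x = ypart (A *v hom_point x)"
  by (simp add: vec_eq_iff aff_act_def)

lemma hom_point_None [simp]: "hom_point x $ None = 1"
  by (simp add: hom_point_join)

lemma ypart_hom_point [simp]: "ypart (hom_point x) = x"
  by (simp add: hom_point_join)

lemma hom_point_ypart: "z $ None = 1 \<Longrightarrow> hom_point (ypart z) = z"
  by (simp add: vec_option_eq_iff hom_point_join)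

lemma hom_dir_ypart: "z $ None = 0 \<Longrightarrow> hom_dir (ypart z) = z"
  by (simp add: vec_option_eq_iff hom_dir_join)

lemma linear_functional_vec:
  fixes f :: "real ^ 'm \<Rightarrow> real"
  assumes "linear f"
  shows "f u = u \<bullet> (\<chi> i. f (axis i 1))"
proof -
  have "f u = f (\<Sum>i\<in>UNIV. u $ i *\<^sub>R axis i 1)"
    using basis_expansion[of u] by (simp add: scalar_mult_eq_scaleR)
  also have "\<dots> = (\<Sum>i\<in>UNIV. u $ i * f (axis i 1))"
    using assms by (simp add: linear_sum linear_scale)
  finally show ?thesis
    by (simp add: inner_vec_def)
qed

lemma matrix_vector_scaleR_left: "(r *\<^sub>R A) *v z = r *\<^sub>R (A *v z)" for A :: "real ^ 'n ^ 'k"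
  by (simp add: scaleR_matrix_vector_assoc)

lemmas mv_simps = matrix_vector_right_distrib matrix_vector_mult_add_rdistrib
  matrix_vector_mult_diff_distrib matrix_vector_mult_diff_rdistrib
  matrix_vector_mult_scaleR matrix_vector_scaleR_left

subsection \<open>Affine actions of a vector group\<close>

text \<open>The group enters only through its parametrization, so that the locale also applies after
  a linear change of variable on V. The last assumption says that the matrices preserve the affine
  hyperplane.\<close>

locale vector_group =
  fixes \<theta> X :: "real ^ ('m::finite) \<Rightarrow> 'm hmatrix"
  assumes hom: "\<theta> (u + v) = \<theta> u ** \<theta> v"
    and theta_0 [simp]: "\<theta> 0 = mat 1"
    and continuous_theta: "continuous_on UNIV \<theta>"
    and derivative_0: "((\<lambda>t. \<theta> (t *\<^sub>R v)) has_vector_derivative X v) (at 0)"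
    and theta_None [simp]: "(\<theta> v *v z) $ None = z $ None"
begin

lemma derivative: "((\<lambda>t. \<theta> (t *\<^sub>R v)) has_vector_derivative X v ** \<theta> (t *\<^sub>R v)) (at t)"
  by (rule one_parameter_group_derivative[OF derivative_0]) (simp add: scaleR_add_left hom)

lemma theta_commute: "\<theta> u *v (\<theta> v *v z) = \<theta> v *v (\<theta> u *v z)"
  by (metis hom add.commute matrix_vector_mul_assoc)

lemma theta_inverse [simp]: "\<theta> v *v (\<theta> (- v) *v z) = z" "\<theta> (- v) *v (\<theta> v *v z) = z"
  by (metis hom add.right_inverse add.left_inverse matrix_vector_mul_assoc theta_0 matrix_vector_mul_lid)+

lemma vector_derivative_0:
  "((\<lambda>t. \<theta> (t *\<^sub>R v) *v z) has_vector_derivative X v *v z) (at 0)"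
  by (rule bounded_linear.has_vector_derivative
      [OF bounded_bilinear.bounded_linear_left[OF bounded_bilinear_matrix_vector_mult] derivative_0])

lemma vector_derivative:
  "((\<lambda>t. \<theta> (t *\<^sub>R v) *v z) has_vector_derivative X v *v (\<theta> (t *\<^sub>R v) *v z)) (at t)"
  using bounded_linear.has_vector_derivative
      [OF bounded_bilinear.bounded_linear_left[OF bounded_bilinear_matrix_vector_mult] derivative]
  by (simp add: matrix_vector_mul_assoc)

lemma X_add: "X (u + v) = X u + X v"
proof -
  have "((\<lambda>t. \<theta> (t *\<^sub>R u) ** \<theta> (t *\<^sub>R v)) has_vector_derivative
      \<theta> (0 *\<^sub>R u) ** X v + X u ** \<theta> (0 *\<^sub>R v)) (at 0)"
    by (rule has_vector_derivative_matrix_mult[OF derivative_0 derivative_0])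
  then have "((\<lambda>t. \<theta> (t *\<^sub>R (u + v))) has_vector_derivative X v + X u) (at 0)"
    by (simp add: hom[symmetric] scaleR_add_right)
  from vector_derivative_unique_at[OF this derivative_0] show ?thesis
    by (simp add: add.commute)
qed

lemma X_scaleR: "X (c *\<^sub>R v) = c *\<^sub>R X v"
proof -
  have "((\<lambda>t. t * c) has_real_derivative c) (at 0)"
    by (auto intro!: derivative_eq_intros)
  then have "((\<lambda>t. t * c) has_vector_derivative c) (at 0)"
    by (rule has_real_derivative_iff_has_vector_derivative[THEN iffD1])
  from vector_diff_chain_at[OF this, of "\<lambda>t. \<theta> (t *\<^sub>R v)" "X v"] derivative_0[of v]
  have "((\<lambda>t. \<theta> (t *\<^sub>R (c *\<^sub>R v))) has_vector_derivative c *\<^sub>R X v) (at 0)"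
    by (simp add: o_def)
  from vector_derivative_unique_at[OF this derivative_0] show ?thesis
    by simp
qed

lemma linear_X: "linear X"
  by (auto intro!: linearI X_add X_scaleR)

lemma X_0 [simp]: "X 0 = 0"
  using linear_X by (rule linear_0)

lemma X_minus: "X (- v) = - X v"
  using linear_X by (rule linear_neg)

lemma X_diff: "X (u - v) = X u - X v"
  using linear_X by (rule linear_diff)

lemmas X_simps = X_add X_scaleR X_diff X_minus

lemma X_theta_commute: "X u *v (\<theta> v *v z) = \<theta> v *v (X u *v z)"
proof -
  have "((\<lambda>t. \<theta> v *v (\<theta> (t *\<^sub>R u) *v z)) has_vector_derivative \<theta> v *v (X u *v z)) (at 0)"
    by (rule bounded_linear.has_vector_derivative
        [OF bounded_bilinear.bounded_linear_right[OF bounded_bilinear_matrix_vector_mult] vector_derivative_0])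
  then have "((\<lambda>t. \<theta> (t *\<^sub>R u) *v (\<theta> v *v z)) has_vector_derivative \<theta> v *v (X u *v z)) (at 0)"
    by (simp add: theta_commute)
  from vector_derivative_unique_at[OF vector_derivative_0 this] show ?thesis .
qed

lemma X_commute: "X u *v (X v *v z) = X v *v (X u *v z)"
proof -
  have "((\<lambda>t. X u *v (\<theta> (t *\<^sub>R v) *v z)) has_vector_derivative X u *v (X v *v z)) (at 0)"
    by (rule bounded_linear.has_vector_derivative
        [OF bounded_bilinear.bounded_linear_right[OF bounded_bilinear_matrix_vector_mult] vector_derivative_0])
  then have "((\<lambda>t. \<theta> (t *\<^sub>R v) *v (X u *v z)) has_vector_derivative X u *v (X v *v z)) (at 0)"
    by (simp add: X_theta_commute)
  from vector_derivative_unique_at[OF this vector_derivative_0] show ?thesis .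
qed

lemma X_None [simp]: "(X v *v z) $ None = 0"
proof -
  have "((\<lambda>t. (\<theta> (t *\<^sub>R v) *v z) $ None) has_vector_derivative (X v *v z) $ None) (at 0)"
    by (rule bounded_linear.has_vector_derivative[OF bounded_linear_vec_nth vector_derivative_0])
  then have "((\<lambda>t::real. z $ None) has_vector_derivative (X v *v z) $ None) (at 0)"
    by simp
  from vector_derivative_unique_at[OF this has_vector_derivative_const] show ?thesis .
qed

text \<open>Uniqueness for the linear equation f' = X v f: the product of f with the inverse flow is
  constant. It identifies \<open>\<theta> v\<close> with explicit exponentials later on.\<close>

lemma theta_unique:
  assumes "f 0 = z" and "\<And>t. (f has_vector_derivative X v *v f t) (at t)"
  shows "\<theta> v *v z = f 1"
proof -
  let ?g = "\<lambda>t. \<theta> (t *\<^sub>R (- v)) *v f t"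
  have "(?g has_vector_derivative 0) (at t)" for t
  proof -
    have "(?g has_vector_derivative
        \<theta> (t *\<^sub>R (- v)) *v (X v *v f t) + (X (- v) ** \<theta> (t *\<^sub>R (- v))) *v f t) (at t)"
      by (rule has_vector_derivative_matrix_vector_mult[OF derivative assms(2)])
    moreover have "(X (- v) ** \<theta> (t *\<^sub>R (- v))) *v f t = - (\<theta> (t *\<^sub>R (- v)) *v (X v *v f t))"
      by (simp add: matrix_vector_mul_assoc[symmetric] X_theta_commute X_minus)
        (metis X_theta_commute minus_mult_minus mult_minus1 scaleR_minus1_left matrix_vector_scaleR_left)
    ultimately show ?thesis by simp
  qed
  then have "?g 1 = ?g 0"
    using has_derivative_zero_unique_connected[of UNIV ?g 1 0]
    by (auto simp: has_vector_derivative_def)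
  then have "\<theta> (- v) *v f 1 = z"
    by (simp add: assms)
  then show ?thesis
    by (metis theta_inverse(1))
qed

text \<open>Each Taylor remainder along t v has as derivative \<open>X v\<close> times the preceding
  remainder, so three mean value estimates raise the order one at a time.\<close>

lemma theta_bounds:
  obtains A where "A \<ge> 0"
    "\<And>v. norm v \<le> 1 \<Longrightarrow> norm (\<theta> v - mat 1) \<le> A * norm v"
    "\<And>v. norm v \<le> 1 \<Longrightarrow> norm (\<theta> v - mat 1 - X v) \<le> A * (norm v)^2"
    "\<And>v. norm v \<le> 1 \<Longrightarrow> norm (\<theta> v - mat 1 - X v - (1/2) *\<^sub>R (X v ** X v)) \<le> A * (norm v)^3"
proof -
  obtain K where K: "K > 0" "\<And>(A :: 'm hmatrix) (B :: 'm hmatrix). norm (A ** B) \<le> norm A * norm B * K"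
    using bounded_bilinear.pos_bounded[OF bounded_bilinear_matrix_mult] by blast
  obtain L where L: "L > 0" "\<And>v. norm (X v) \<le> norm v * L"
    using linear_X linear_conv_bounded_linear bounded_linear.pos_bounded by metis
  have "compact (\<theta> ` cball 0 1)"
    using continuous_theta continuous_on_subset by (intro compact_continuous_image) auto
  then obtain M where M: "M > 0" "\<And>v. norm v \<le> 1 \<Longrightarrow> norm (\<theta> v) \<le> M"
    using compact_imp_bounded bounded_pos by (metis (no_types, lifting) imageI mem_cball_0)
  have step: "norm (f 1 - f 0) \<le> B"
    if "\<And>t. t \<in> {0..1} \<Longrightarrow> (f has_vector_derivative f' t) (at t)" "\<And>t. t \<in> {0..1} \<Longrightarrow> norm (f' t) \<le> B"
    for f f' :: "real \<Rightarrow> 'm hmatrix" and B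
  proof -
    have "onorm (\<lambda>h. h *\<^sub>R f' t) \<le> B" if "t \<in> {0..1}" for t
      using \<open>\<And>t. t \<in> {0..1} \<Longrightarrow> norm (f' t) \<le> B\<close>[OF that]
      by (intro onorm_le) (simp add: mult.commute[of B] mult_left_mono)
    then show ?thesis
      using differentiable_bound[of "{0..1::real}" f "\<lambda>t h. h *\<^sub>R f' t" B 1 0] that(1)
      by (auto simp: has_vector_derivative_def has_derivative_at_withinI)
  qed
  have XB: "norm (X v ** B) \<le> K * L * norm v * norm B" for v and B :: "'m hmatrix"
  proof -
    have "norm (X v ** B) \<le> norm (X v) * norm B * K"
      using K(2)[of "X v" B] .
    also have "\<dots> \<le> (norm v * L) * norm B * K"
      using K L by (intro mult_right_mono) auto
    finally show ?thesis by (simp add: mult_ac)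
  qed
  have s1: "norm (\<theta> v - mat 1) \<le> K * L * norm v * M" if v: "norm v \<le> 1" for v
  proof -
    have "norm (\<theta> (1 *\<^sub>R v) - \<theta> (0 *\<^sub>R v)) \<le> K * L * norm v * M"
    proof (rule step)
      show "((\<lambda>t. \<theta> (t *\<^sub>R v)) has_vector_derivative X v ** \<theta> (t *\<^sub>R v)) (at t)" for t
        by (rule derivative)
      fix t :: real assume t: "t \<in> {0..1}"
      then have "norm (t *\<^sub>R v) \<le> 1"
        using v by (simp add: mult_le_one)
      then have "norm (\<theta> (t *\<^sub>R v)) \<le> M"
        by (rule M)
      then have "K * L * norm v * norm (\<theta> (t *\<^sub>R v)) \<le> K * L * norm v * M"
        using K L by (intro mult_left_mono) auto
      then show "norm (X v ** \<theta> (t *\<^sub>R v)) \<le> K * L * norm v * M"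
        using XB order_trans by blast
    qed
    then show ?thesis by simp
  qed
  have s2: "norm (\<theta> v - mat 1 - X v) \<le> K * L * norm v * (K * L * norm v * M)" if v: "norm v \<le> 1" for v
  proof -
    have "norm ((\<theta> (1 *\<^sub>R v) - 1 *\<^sub>R X v) - (\<theta> (0 *\<^sub>R v) - 0 *\<^sub>R X v)) \<le> K * L * norm v * (K * L * norm v * M)"
    proof (rule step)
      show "((\<lambda>t. \<theta> (t *\<^sub>R v) - t *\<^sub>R X v) has_vector_derivative X v ** (\<theta> (t *\<^sub>R v) - mat 1)) (at t)" for t
        by (auto intro!: derivative_eq_intros derivative simp: bounded_bilinear.diff_right[OF bounded_bilinear_matrix_mult])
      fix t :: real assume t: "t \<in> {0..1}"
      then have tv: "norm (t *\<^sub>R v) \<le> norm v"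
        by (simp add: mult_left_le_one_le)
      have "norm (\<theta> (t *\<^sub>R v) - mat 1) \<le> K * L * norm (t *\<^sub>R v) * M"
        using tv v by (intro s1) simp
      also have "\<dots> \<le> K * L * norm v * M"
        using K L M tv by (intro mult_right_mono mult_left_mono) auto
      finally have "K * L * norm v * norm (\<theta> (t *\<^sub>R v) - mat 1) \<le> K * L * norm v * (K * L * norm v * M)"
        using K L by (intro mult_left_mono) auto
      then show "norm (X v ** (\<theta> (t *\<^sub>R v) - mat 1)) \<le> K * L * norm v * (K * L * norm v * M)"
        using XB order_trans by blast
    qed
    then show ?thesis by (simp add: algebra_simps)
  qed
  have s3: "norm (\<theta> v - mat 1 - X v - (1/2) *\<^sub>R (X v ** X v)) \<le> K * L * norm v * (K * L * norm v * (K * L * norm v * M))"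
    if v: "norm v \<le> 1" for v
  proof -
    let ?f = "\<lambda>t. \<theta> (t *\<^sub>R v) - t *\<^sub>R X v - (t^2 / 2) *\<^sub>R (X v ** X v)"
    have "norm (?f 1 - ?f 0) \<le> K * L * norm v * (K * L * norm v * (K * L * norm v * M))"
    proof (rule step)
      show "(?f has_vector_derivative X v ** (\<theta> (t *\<^sub>R v) - mat 1 - X (t *\<^sub>R v))) (at t)" for t
        by (auto intro!: derivative_eq_intros derivative
            simp: bounded_bilinear.diff_right[OF bounded_bilinear_matrix_mult] X_scaleR
              bounded_bilinear.scaleR_right[OF bounded_bilinear_matrix_mult])
      fix t :: real assume t: "t \<in> {0..1}"
      then have tv: "norm (t *\<^sub>R v) \<le> norm v"
        by (simp add: mult_left_le_one_le)
      have "norm (\<theta> (t *\<^sub>R v) - mat 1 - X (t *\<^sub>R v)) \<le> K * L * norm (t *\<^sub>R v) * (K * L * norm (t *\<^sub>R v) * M)"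
        using tv v by (intro s2) simp
      also have "\<dots> \<le> K * L * norm v * (K * L * norm v * M)"
        using K L M tv by (intro mult_mono mult_right_mono mult_left_mono) auto
      finally have "K * L * norm v * norm (\<theta> (t *\<^sub>R v) - mat 1 - X (t *\<^sub>R v))
          \<le> K * L * norm v * (K * L * norm v * (K * L * norm v * M))"
        using K L by (intro mult_left_mono) auto
      then show "norm (X v ** (\<theta> (t *\<^sub>R v) - mat 1 - X (t *\<^sub>R v)))
          \<le> K * L * norm v * (K * L * norm v * (K * L * norm v * M))"
        using XB order_trans by blast
    qed
    then show ?thesis by (simp add: algebra_simps)
  qed
  define A where "A = K * L * M + (K * L)^2 * M + (K * L)^3 * M"
  have pos: "0 \<le> K * L * M" "0 \<le> (K * L)^2 * M" "0 \<le> (K * L)^3 * M"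
    using K L M by auto
  show thesis
  proof
    show "A \<ge> 0"
      using pos by (simp add: A_def)
    fix v :: "real ^ 'm"
    assume v: "norm v \<le> 1"
    have "K * L * norm v * M = (K * L * M) * norm v"
      by simp
    also have "\<dots> \<le> A * norm v"
      using pos by (intro mult_right_mono) (auto simp: A_def)
    finally show "norm (\<theta> v - mat 1) \<le> A * norm v"
      using s1[OF v] by simp
    have "K * L * norm v * (K * L * norm v * M) = ((K * L)^2 * M) * (norm v)^2"
      by (simp add: power2_eq_square)
    also have "\<dots> \<le> A * (norm v)^2"
      using pos by (intro mult_right_mono) (auto simp: A_def)
    finally show "norm (\<theta> v - mat 1 - X v) \<le> A * (norm v)^2"
      using s2[OF v] by simp
    have "K * L * norm v * (K * L * norm v * (K * L * norm v * M)) = ((K * L)^3 * M) * (norm v)^3"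
      by (simp add: power3_eq_cube)
    also have "\<dots> \<le> A * (norm v)^3"
      using pos by (intro mult_right_mono) (auto simp: A_def)
    finally show "norm (\<theta> v - mat 1 - X v - (1/2) *\<^sub>R (X v ** X v)) \<le> A * (norm v)^3"
      using s3[OF v] by simp
  qed
qed

end

lemma matrix_mult_linear: "linear f \<Longrightarrow> matrix f *v x = f x" for f :: "real ^ 'n \<Rightarrow> real ^ 'k"
  by (simp add: matrix_works linear_matrix_vector_mul_eq)

subsection \<open>The algebra generated by the infinitesimal action\<close>

text \<open>Here \<tau> is the affine function supporting the domain at \<open>b\<close>, written in
  homogeneous coordinates. The last two assumptions say that the height of the orbit has a critical
  point at \<open>b\<close> and that its Hessian there is the standard inner product.\<close>

locale vector_group_frame = vector_group \<theta> X
  for \<theta> X :: "real ^ ('m::finite) \<Rightarrow> 'm hmatrix" +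
  fixes b :: "'m point" and \<tau> :: "'m hpoint"
  assumes tau_b [simp]: "\<tau> \<bullet> hom_point b = 0"
    and tau_X_b [simp]: "\<tau> \<bullet> (X v *v hom_point b) = 0"
    and tau_XX_b [simp]: "\<tau> \<bullet> (X u *v (X v *v hom_point b)) = u \<bullet> v"
begin

abbreviation "bh \<equiv> hom_point b"

text \<open>Any unit vector would serve: the square of its \<open>X\<close> sends \<open>b\<close>
  to a vector of height 1, which \<open>e\<close> then corrects by a tangential term.\<close>

definition unit_dir :: "real ^ 'm" where
  "unit_dir = axis undefined 1"

text \<open>The element \<open>e\<close> is normalized by \<open>\<tau> \<bullet> e b = 1\<close> and \<open>\<tau> \<bullet> X v e b = 0\<close>, and \<open>crd\<close> gives the
  coordinates with respect to the frame \<open>X v b\<close>, \<open>e b\<close>.\<close>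

definition e :: "'m hmatrix" where
  "e = X unit_dir ** X unit_dir
     - X (\<chi> i. \<tau> \<bullet> (X (axis i 1) *v (X unit_dir *v (X unit_dir *v bh))))"

text \<open>Zero exactly when the group has no fixed point in the affine space; otherwise the fixed
  point is \<open>bh - (1 / \<kappa>) *\<^sub>R (e *v bh)\<close>.\<close>

definition \<kappa> :: real where
  "\<kappa> = \<tau> \<bullet> (e *v (e *v bh))"

definition E :: "'m point \<Rightarrow> 'm hmatrix" where
  "E x = X (ypart x) + (x $ None) *\<^sub>R e"

definition crd :: "'m hpoint \<Rightarrow> 'm point" where
  "crd z = join (\<chi> i. \<tau> \<bullet> (X (axis i 1) *v z)) (\<tau> \<bullet> z)"

text \<open>The contraction of the symmetric cubic form \<tau> X X X b, hence a multiple of the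
  Laplacian of the associated cubic; \<open>trace_X\<close> identifies it with the matrix
  trace.\<close>

definition tr :: "real ^ 'm \<Rightarrow> real" where
  "tr v = (\<Sum>i\<in>UNIV. \<tau> \<bullet> (X (axis i 1) *v (X (axis i 1) *v (X v *v bh))))"

lemma e_mult: "e *v z = X unit_dir *v (X unit_dir *v z)
    - X (\<chi> i. \<tau> \<bullet> (X (axis i 1) *v (X unit_dir *v (X unit_dir *v bh)))) *v z"
  by (simp add: e_def mv_simps matrix_vector_mul_assoc)

lemma e_X_commute: "e *v (X v *v z) = X v *v (e *v z)"
  by (simp add: e_mult mv_simps X_commute[of _ v])

lemma e_theta_commute: "e *v (\<theta> v *v z) = \<theta> v *v (e *v z)"
  by (simp add: e_mult mv_simps X_theta_commute)

lemma linear_tau_X: "linear (\<lambda>u. \<tau> \<bullet> (X u *v z))"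
  by (auto intro!: linearI simp: X_simps mv_simps inner_simps)

lemma tau_X: "\<tau> \<bullet> (X u *v z) = u \<bullet> (\<chi> i. \<tau> \<bullet> (X (axis i 1) *v z))"
  by (rule linear_functional_vec[OF linear_tau_X])

lemma tau_X_crd: "\<tau> \<bullet> (X u *v z) = u \<bullet> ypart (crd z)"
  by (subst tau_X) (simp add: crd_def)

lemma tau_crd: "\<tau> \<bullet> z = crd z $ None"
  by (simp add: crd_def)

lemma e_None [simp]: "(e *v z) $ None = 0"
  by (simp add: e_mult)

lemma tau_e_b [simp]: "\<tau> \<bullet> (e *v bh) = 1"
  by (simp add: e_mult inner_simps unit_dir_def inner_axis)

lemma tau_X_e_b [simp]: "\<tau> \<bullet> (X u *v (e *v bh)) = 0"
  by (simp add: e_mult inner_simps mv_simps) (subst tau_X, simp)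

lemma tau_e_X_b [simp]: "\<tau> \<bullet> (e *v (X u *v bh)) = 0"
  by (simp add: e_X_commute)

lemma linear_crd: "linear crd"
  by (auto intro!: linearI simp: crd_def vec_option_eq_iff mv_simps inner_simps)

lemma E_mult: "E x *v z = X (ypart x) *v z + (x $ None) *\<^sub>R (e *v z)"
  by (simp add: E_def mv_simps)

lemma linear_E: "linear E"
  by (auto intro!: linearI simp: E_def X_simps algebra_simps)

lemma E_None [simp]: "(E x *v z) $ None = 0"
  by (simp add: E_mult)

lemma crd_b [simp]: "crd bh = 0"
  by (simp add: crd_def vec_option_eq_iff)

lemma crd_E [simp]: "crd (E x *v bh) = x"
  by (simp add: crd_def vec_option_eq_iff E_mult mv_simps inner_simps inner_axis')

text \<open>The coordinate map is a left inverse of the map that builds a vector from the frame;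
  both spaces have the same dimension, so it is also a right inverse. Thus \<open>b\<close> is a
  cyclic vector.\<close>

lemma decomp: "z = (z $ None) *\<^sub>R bh + E (crd z) *v bh"
proof -
  let ?f = "\<lambda>w :: 'm hpoint. (w $ None) *\<^sub>R bh + E (ypart w) *v bh"
  let ?g = "\<lambda>z. join (crd z) (z $ None)"
  have f: "linear ?f"
    by (auto intro!: linearI simp: linear_add[OF linear_E] linear_scale[OF linear_E] mv_simps algebra_simps)
  have g: "linear ?g"
    by (auto intro!: linearI simp: linear_add[OF linear_crd] linear_scale[OF linear_crd] vec_option_eq_iff)
  have "?g \<circ> ?f = id"
    by (auto simp: fun_eq_iff linear_add[OF linear_crd] linear_scale[OF linear_crd])
  then have "?f \<circ> ?g = id"
    by (rule linear_inverse_left[OF g f, THEN iffD1])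
  then have "(?f \<circ> ?g) z = id z"
    by (rule fun_cong)
  then show ?thesis
    by (simp only: o_apply id_apply join_nth ypart_join)
qed

lemma E_crd: "z $ None = 0 \<Longrightarrow> E (crd z) *v bh = z"
  using decomp[of z, symmetric] by simp

lemma E_inj: "E x *v bh = E y *v bh \<longleftrightarrow> x = y"
  by (metis crd_E)

lemma X_b_inj: "X u *v bh = X v *v bh \<longleftrightarrow> u = v"
proof
  assume "X u *v bh = X v *v bh"
  then have "X (u - v) *v bh = 0"
    by (simp add: X_diff mv_simps)
  then have "(u - v) \<bullet> (u - v) = 0"
    using tau_XX_b[of "u - v" "u - v"] by simp
  then show "u = v"
    by simp
qed simp

text \<open>An operator commuting with all \<open>X u\<close> is determined by its value at the
  cyclic vector, so identities in the algebra need checking only at \<open>b\<close>.\<close>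

lemma commuting_ext:
  assumes M: "\<And>u z. M *v (X u *v z) = X u *v (M *v z)"
    and N: "\<And>u z. N *v (X u *v z) = X u *v (N *v z)"
    and eq: "M *v bh = N *v bh"
  shows "M *v z = N *v z"
proof -
  have Me: "M *v (e *v z) = e *v (M *v z)" for z
    by (simp add: e_mult mv_simps M)
  have Ne: "N *v (e *v z) = e *v (N *v z)" for z
    by (simp add: e_mult mv_simps N)
  have "M *v z = M *v ((z $ None) *\<^sub>R bh + E (crd z) *v bh)"
    by (rule arg_cong[OF decomp])
  also have "\<dots> = N *v ((z $ None) *\<^sub>R bh + E (crd z) *v bh)"
    by (simp add: mv_simps E_mult M N Me Ne eq)
  also have "\<dots> = N *v z"
    by (rule arg_cong[OF decomp, symmetric])
  finally show ?thesis .
qed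

text \<open>In \<tau> X v e X u b the matrix \<open>e\<close> may be applied last. The vector X v X
  u b has \<open>e\<close>-coordinate v \<bullet> u, and \<tau> e vanishes on its tangential part,
  which leaves \<kappa> (v \<bullet> u). The coordinates of e X u b are therefore those of \<kappa>
  X u b.\<close>

lemma e_X: "e *v (X u *v z) = \<kappa> *\<^sub>R (X u *v z)"
proof -
  have "\<tau> \<bullet> (X v *v (e *v (X u *v bh))) = \<kappa> * (v \<bullet> u)" for v
  proof -
    define z where "z = X v *v (X u *v bh)"
    have z: "E (crd z) *v bh = z" "crd z $ None = v \<bullet> u"
      by (simp_all add: E_crd z_def tau_crd[symmetric])
    have "\<tau> \<bullet> (e *v (E (crd z) *v bh)) = \<kappa> * (v \<bullet> u)"
      by (simp add: E_mult mv_simps inner_simps \<kappa>_def[symmetric] z(2))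
    then have "\<tau> \<bullet> (e *v z) = \<kappa> * (v \<bullet> u)"
      by (simp add: z(1))
    then show ?thesis
      by (simp add: z_def e_X_commute)
  qed
  then have "crd (e *v (X u *v bh)) = crd (\<kappa> *\<^sub>R (X u *v bh))"
    by (simp add: crd_def vec_option_eq_iff mv_simps inner_simps)
  then have "E (crd (e *v (X u *v bh))) *v bh = E (crd (\<kappa> *\<^sub>R (X u *v bh))) *v bh"
    by simp
  then have "e *v (X u *v bh) = \<kappa> *\<^sub>R (X u *v bh)"
    by (subst (asm) (1 2) E_crd) simp_all
  then have base: "(e ** X u) *v bh = (\<kappa> *\<^sub>R X u) *v bh"
    by (simp add: matrix_vector_mul_assoc[symmetric] mv_simps)
  have "(e ** X u) *v z = (\<kappa> *\<^sub>R X u) *v z"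
  proof (rule commuting_ext[OF _ _ base])
    fix w z
    show "(e ** X u) *v (X w *v z) = X w *v ((e ** X u) *v z)"
      by (simp only: matrix_vector_mul_assoc[symmetric] X_commute[of u w] e_X_commute[of w])
    show "(\<kappa> *\<^sub>R X u) *v (X w *v z) = X w *v ((\<kappa> *\<^sub>R X u) *v z)"
      by (simp only: mv_simps X_commute[of u w])
  qed
  then show ?thesis
    by (simp only: matrix_vector_mul_assoc mv_simps)
qed

lemma X_e: "X u *v (e *v z) = \<kappa> *\<^sub>R (X u *v z)"
  by (simp add: e_X_commute[symmetric] e_X)

lemma tau_X_0_imp: "(\<And>u. \<tau> \<bullet> (X u *v (X v *v bh)) = 0) \<Longrightarrow> v = 0"
  by (metis inner_eq_zero_iff tau_XX_b)

text \<open>Write e e b = X y b + \<kappa> e b. By \<open>X_e\<close>, applying any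
  \<open>X u\<close> gives X u X y b = 0, and nondegeneracy of the form forces y = 0.\<close>

lemma e_e: "e *v (e *v z) = \<kappa> *\<^sub>R (e *v z)"
proof -
  define y where "y = ypart (crd (e *v (e *v bh)))"
  have "E (crd (e *v (e *v bh))) *v bh = X y *v bh + \<kappa> *\<^sub>R (e *v bh)"
    by (simp add: E_mult tau_crd[symmetric] \<kappa>_def y_def)
  then have ee: "e *v (e *v bh) = X y *v bh + \<kappa> *\<^sub>R (e *v bh)"
    by (simp add: E_crd)
  have "X u *v (X y *v bh) = 0" for u
  proof -
    have "X u *v (X y *v bh) = X u *v (e *v (e *v bh)) - \<kappa> *\<^sub>R (X u *v (e *v bh))"
      by (simp add: ee mv_simps)
    also have "\<dots> = 0"
      by (simp add: X_e mv_simps)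
    finally show ?thesis .
  qed
  then have "y = 0"
    by (intro tau_X_0_imp) simp
  then have "e *v (e *v bh) = \<kappa> *\<^sub>R (e *v bh)"
    using ee by simp
  then have base: "(e ** e) *v bh = (\<kappa> *\<^sub>R e) *v bh"
    by (simp only: matrix_vector_mul_assoc mv_simps)
  have "(e ** e) *v z = (\<kappa> *\<^sub>R e) *v z"
  proof (rule commuting_ext[OF _ _ base])
    fix w z
    show "(e ** e) *v (X w *v z) = X w *v ((e ** e) *v z)"
      by (simp only: matrix_vector_mul_assoc[symmetric] e_X_commute)
    show "(\<kappa> *\<^sub>R e) *v (X w *v z) = X w *v ((\<kappa> *\<^sub>R e) *v z)"
      by (simp only: mv_simps e_X_commute)
  qed
  then show ?thesis
    by (simp only: matrix_vector_mul_assoc mv_simps)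
qed

text \<open>Equivalently, e z - \<kappa> z is constant along orbits. At \<open>b\<close> this
  constant is the point through which all radial lines pass.\<close>

lemma e_theta: "e *v (\<theta> v *v z) = e *v z + \<kappa> *\<^sub>R (\<theta> v *v z - z)"
proof -
  let ?g = "\<lambda>t. e *v (\<theta> (t *\<^sub>R v) *v z) - \<kappa> *\<^sub>R (\<theta> (t *\<^sub>R v) *v z)"
  have "(?g has_vector_derivative e *v (X v *v (\<theta> (t *\<^sub>R v) *v z)) - \<kappa> *\<^sub>R (X v *v (\<theta> (t *\<^sub>R v) *v z))) (at t)" for t
    by (intro has_vector_derivative_diff bounded_linear.has_vector_derivative[OF bounded_linear_scaleR_right]
        bounded_linear.has_vector_derivative[OF bounded_bilinear.bounded_linear_right[OF bounded_bilinear_matrix_vector_mult]]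
        vector_derivative)
  then have "(?g has_vector_derivative 0) (at t)" for t
    by (simp add: e_X)
  then have "?g 1 = ?g 0"
    using has_derivative_zero_unique_connected[of UNIV ?g 1 0]
    by (auto simp: has_vector_derivative_def)
  then show ?thesis
    by (simp add: algebra_simps)
qed

section \<open>The height function and its expansion at the base point\<close>

definition h :: "real ^ 'm \<Rightarrow> real" where
  "h v = \<tau> \<bullet> (\<theta> v *v bh)"

text \<open>The derivative of \<open>h\<close> at \<open>v\<close> in direction
  \<open>y\<close>.\<close>

definition \<phi> :: "real ^ 'm \<Rightarrow> real ^ 'm \<Rightarrow> real" where
  "\<phi> v y = \<tau> \<bullet> (\<theta> v *v (X y *v bh))"

lemma tau_theta_e_b: "\<tau> \<bullet> (\<theta> v *v (e *v bh)) = 1 + \<kappa> * h v"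
  by (simp add: e_theta_commute[symmetric] e_theta inner_simps h_def)

text \<open>In frame coordinates the supporting functionals at all orbit points are expressed by
  \<open>h\<close>, its derivative and \<kappa> alone; these are the inequalities that cut out the
  domain.\<close>

lemma tau_theta_frame:
  "\<tau> \<bullet> (\<theta> v *v (bh + E x *v bh)) = h v + \<phi> v (ypart x) + x $ None * (1 + \<kappa> * h v)"
  by (simp add: E_mult mv_simps inner_simps tau_theta_e_b) (simp add: h_def \<phi>_def)

lemma ypart_crd_theta: "y \<bullet> ypart (crd (\<theta> v *v bh)) = \<phi> v y"
  by (simp add: tau_X_crd[symmetric] X_theta_commute \<phi>_def)

lemma linear_phi: "linear (\<phi> v)"
  by (auto intro!: linearI simp: \<phi>_def X_simps mv_simps inner_simps)

lemma frame_bounds: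
  obtains A where "A \<ge> 0"
    "\<And>v. norm v \<le> 1 \<Longrightarrow> \<bar>h v\<bar> \<le> A * norm v"
    "\<And>v. norm v \<le> 1 \<Longrightarrow> \<bar>h v - (norm v)\<^sup>2 / 2\<bar> \<le> A * norm v ^ 3"
    "\<And>v y. norm v \<le> 1 \<Longrightarrow> \<bar>\<phi> v y\<bar> \<le> A * norm v * norm y"
    "\<And>v y. norm v \<le> 1 \<Longrightarrow> \<bar>\<phi> v y - v \<bullet> y\<bar> \<le> A * norm v ^ 2 * norm y"
proof -
  obtain A where A: "A \<ge> 0"
    "\<And>v. norm v \<le> 1 \<Longrightarrow> norm (\<theta> v - mat 1) \<le> A * norm v"
    "\<And>v. norm v \<le> 1 \<Longrightarrow> norm (\<theta> v - mat 1 - X v) \<le> A * (norm v)^2"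
    "\<And>v. norm v \<le> 1 \<Longrightarrow> norm (\<theta> v - mat 1 - X v - (1/2) *\<^sub>R (X v ** X v)) \<le> A * (norm v)^3"
    using theta_bounds by blast
  obtain K where K: "K > 0" "\<And>(B :: 'm hmatrix) (z :: 'm hpoint). norm (B *v z) \<le> norm B * norm z * K"
    using bounded_bilinear.pos_bounded[OF bounded_bilinear_matrix_vector_mult] by blast
  obtain L where L: "L > 0" "\<And>y. norm (X y *v bh) \<le> norm y * L"
  proof -
    have "linear (\<lambda>y. X y *v bh)"
      by (auto intro!: linearI simp: X_simps mv_simps)
    then show thesis
      using that linear_conv_bounded_linear bounded_linear.pos_bounded by metis
  qed
  have T: "\<bar>\<tau> \<bullet> (B *v z)\<bar> \<le> (norm \<tau> * K) * norm B * norm z" for B :: "'m hmatrix" and z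
  proof -
    have "\<bar>\<tau> \<bullet> (B *v z)\<bar> \<le> norm \<tau> * norm (B *v z)"
      by (rule Cauchy_Schwarz_ineq2)
    also have "\<dots> \<le> norm \<tau> * (norm B * norm z * K)"
      using K by (intro mult_left_mono) auto
    finally show ?thesis by (simp add: mult_ac)
  qed
  have T': "\<bar>\<tau> \<bullet> (B *v z)\<bar> \<le> (norm \<tau> * K * A * M) * r"
    if "norm B \<le> A * r" "norm z \<le> M" "r \<ge> 0" for B :: "'m hmatrix" and z r M
  proof -
    have "\<bar>\<tau> \<bullet> (B *v z)\<bar> \<le> (norm \<tau> * K) * norm B * norm z"
      by (rule T)
    also have "\<dots> \<le> (norm \<tau> * K) * (A * r) * M"
      using that K A(1) by (intro mult_mono mult_left_mono) auto
    finally show ?thesis by (simp add: mult_ac)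
  qed
  define C where "C = norm \<tau> * K * A * norm bh + norm \<tau> * K * A * L"
  have C: "norm \<tau> * K * A * norm bh \<le> C" "norm \<tau> * K * A * L \<le> C" "C \<ge> 0"
    using K A L by (auto simp: C_def)
  show thesis
  proof
    show "C \<ge> 0" by fact
    fix v :: "real ^ 'm"
    assume v: "norm v \<le> 1"
    have "h v = \<tau> \<bullet> ((\<theta> v - mat 1) *v bh)"
      by (simp add: h_def mv_simps inner_simps)
    also have "\<bar>\<dots>\<bar> \<le> (norm \<tau> * K * A * norm bh) * norm v"
      by (rule T') (use A v in auto)
    also have "\<dots> \<le> C * norm v"
      using C by (intro mult_right_mono) auto
    finally show "\<bar>h v\<bar> \<le> C * norm v" .
    have "h v - (norm v)\<^sup>2 / 2 = \<tau> \<bullet> ((\<theta> v - mat 1 - X v - (1/2) *\<^sub>R (X v ** X v)) *v bh)"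
      by (simp add: h_def mv_simps inner_simps matrix_vector_mul_assoc[symmetric] power2_norm_eq_inner)
    also have "\<bar>\<dots>\<bar> \<le> (norm \<tau> * K * A * norm bh) * norm v ^ 3"
      by (rule T') (use A v in auto)
    also have "\<dots> \<le> C * norm v ^ 3"
      using C by (intro mult_right_mono) auto
    finally show "\<bar>h v - (norm v)\<^sup>2 / 2\<bar> \<le> C * norm v ^ 3" .
    fix y
    have "\<phi> v y = \<tau> \<bullet> ((\<theta> v - mat 1) *v (X y *v bh))"
      by (simp add: \<phi>_def mv_simps inner_simps)
    also have "\<bar>\<dots>\<bar> \<le> (norm \<tau> * K * A * (norm y * L)) * norm v"
      by (rule T') (use A L v in auto)
    also have "\<dots> = (norm \<tau> * K * A * L) * norm v * norm y"
      by (simp add: mult_ac)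
    also have "\<dots> \<le> C * norm v * norm y"
      using C by (intro mult_right_mono) auto
    finally show "\<bar>\<phi> v y\<bar> \<le> C * norm v * norm y" .
    have "\<phi> v y - v \<bullet> y = \<tau> \<bullet> ((\<theta> v - mat 1 - X v) *v (X y *v bh))"
      by (simp add: \<phi>_def mv_simps inner_simps)
    also have "\<bar>\<dots>\<bar> \<le> (norm \<tau> * K * A * (norm y * L)) * norm v ^ 2"
      by (rule T') (use A L v in auto)
    also have "\<dots> = (norm \<tau> * K * A * L) * norm v ^ 2 * norm y"
      by (simp add: mult_ac)
    also have "\<dots> \<le> C * norm v ^ 2 * norm y"
      using C by (intro mult_right_mono) auto
    finally show "\<bar>\<phi> v y - v \<bullet> y\<bar> \<le> C * norm v ^ 2 * norm y" .
  qed
qed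

section \<open>The trace of the infinitesimal action\<close>

lemma linear_tr: "linear tr"
  by (auto intro!: linearI simp: tr_def X_simps mv_simps inner_simps sum.distrib sum_distrib_left)

lemma sum_crd_X: "(\<Sum>i\<in>UNIV. crd (X v *v (E (axis i 1) *v bh)) $ i) = tr v"
proof -
  have "ypart (axis (Some i) 1) = (axis i 1 :: real ^ 'm)" "ypart (axis None 1) = (0 :: real ^ 'm)" for i
    by (auto simp: vec_eq_iff axis_def)
  then have "(\<Sum>i\<in>UNIV. crd (X v *v (E (axis i 1) *v bh)) $ i)
      = (\<Sum>i\<in>UNIV. \<tau> \<bullet> (X (axis i 1) *v (X v *v (X (axis i 1) *v bh))))"
    by (simp add: sum_UNIV_option crd_def E_mult X_e mv_simps) (simp add: axis_def)
  also have "\<dots> = tr v"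
    by (simp add: tr_def X_commute[of v])
  finally show ?thesis .
qed

text \<open>The trace is computed in the frame. The vector \<open>b\<close> contributes nothing
  because \<open>X v\<close> kills the last homogeneous coordinate, and \<open>e b\<close>
  contributes nothing because X v e b = \<kappa> X v b has height zero.\<close>

lemma trace_X: "trace (X v) = tr v"
proof -
  define P :: "'m hmatrix" where "P = matrix (\<lambda>w. (w $ None) *\<^sub>R bh + E (ypart w) *v bh)"
  define Q :: "'m hmatrix" where "Q = matrix (\<lambda>z. join (crd z) (z $ None))"
  have P: "P *v w = (w $ None) *\<^sub>R bh + E (ypart w) *v bh" for w
    unfolding P_def
    by (rule matrix_mult_linear)
      (auto intro!: linearI simp: linear_add[OF linear_E] linear_scale[OF linear_E] mv_simps algebra_simps)
  have Q: "Q *v z = join (crd z) (z $ None)" for z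
    unfolding Q_def
    by (rule matrix_mult_linear)
      (auto intro!: linearI simp: linear_add[OF linear_crd] linear_scale[OF linear_crd] vec_option_eq_iff)
  have PQ: "P ** Q = mat 1"
    by (simp add: matrix_eq matrix_vector_mul_assoc[symmetric] P Q decomp[symmetric])
  have ent: "M $ i $ j = (M *v axis j 1) $ i" for M :: "'m hmatrix" and i j
    by (simp add: matrix_vector_mul_component inner_axis)
  have "trace (X v) = trace (X v ** (P ** Q))"
    by (simp add: PQ)
  also have "\<dots> = trace (Q ** (X v ** P))"
    by (subst trace_mul_sym[symmetric]) (simp add: matrix_mul_assoc)
  also have "\<dots> = (\<Sum>i\<in>UNIV. (Q *v (X v *v (P *v axis i 1))) $ i)"
    unfolding trace_def by (subst ent) (simp add: matrix_vector_mul_assoc[symmetric])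
  also have "\<dots> = (\<Sum>i\<in>UNIV. crd (X v *v (E (axis i 1) *v bh)) $ i)"
    by (simp add: sum_UNIV_option[where 'm="'m option"] Q P) (simp add: axis_def ypart_def)
  also have "\<dots> = tr v"
    by (rule sum_crd_X)
  finally show ?thesis .
qed

end

text \<open>Bounds a step taken along a vector of length \<open>n\<close> that has to stay in a ball
  of radius \<open>r\<close>; the summand 1 allows \<open>n\<close> = 0.\<close>

lemma half_radius_scale: "r / (2 * (n + 1)) * n \<le> r / 2" if "r > 0" "n \<ge> 0" for r n :: real
  using that by (simp add: field_simps)

lemma continuous_join_left: "continuous_on A (\<lambda>y. join y s)"
  unfolding join_def
proof (rule continuous_on_vec_lambda)
  show "continuous_on A (\<lambda>y. case i of None \<Rightarrow> s | Some j \<Rightarrow> y $ j)" for i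
    by (cases i) (auto intro!: continuous_intros)
qed

lemma continuous_join_right: "continuous_on A (\<lambda>s. join y s)"
  unfolding join_def
proof (rule continuous_on_vec_lambda)
  show "continuous_on A (\<lambda>s. case i of None \<Rightarrow> s | Some j \<Rightarrow> y $ j)" for i
    by (cases i) (auto intro!: continuous_intros)
qed

lemma convex_slice:
  assumes "convex A"
  shows "convex {y. join y s \<in> A}"
proof (rule convexI)
  fix y z and u v :: real
  assume *: "y \<in> {y. join y s \<in> A}" "z \<in> {y. join y s \<in> A}" "0 \<le> u" "0 \<le> v" "u + v = 1"
  have "join (u *\<^sub>R y + v *\<^sub>R z) s = u *\<^sub>R join y s + v *\<^sub>R join z s"
    using *(5) by (simp add: vec_option_eq_iff distrib_right[symmetric])
  then show "u *\<^sub>R y + v *\<^sub>R z \<in> {y. join y s \<in> A}"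
    using convexD[OF assms, of "join y s" "join z s" u v] * by simp
qed

subsection \<open>Domains bounded by an orbit\<close>

text \<open>Base point, functional and domain are parameters because the locale is instantiated
  again, with the same \<open>\<theta>\<close> and \<open>X\<close>, for the domain bounded by an
  arbitrary horosphere.\<close>

locale orbit_domain = vector_group_frame \<theta> X b \<tau>
  for \<theta> X :: "real ^ ('m::finite) \<Rightarrow> 'm hmatrix" and b \<tau> +
  fixes \<Omega> :: "'m point set"
  assumes closed_dom: "closed \<Omega>" and convex_dom: "convex \<Omega>" and interior_dom: "interior \<Omega> \<noteq> {}"
    and noncompact: "\<not> compact (frontier \<Omega>)"
    and invariant: "x \<in> \<Omega> \<Longrightarrow> aff_act (\<theta> v) x \<in> \<Omega>"
    and frontier_orbit: "frontier \<Omega> = range (\<lambda>v. aff_act (\<theta> v) b)"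
    and tau_nonneg: "x \<in> \<Omega> \<Longrightarrow> \<tau> \<bullet> hom_point x \<ge> 0"
begin

lemma hom_point_theta: "hom_point (aff_act (\<theta> v) x) = \<theta> v *v hom_point x"
  by (simp add: aff_act_ypart hom_point_ypart)

lemma tau_theta_nonneg: "x \<in> \<Omega> \<Longrightarrow> \<tau> \<bullet> (\<theta> v *v hom_point x) \<ge> 0"
  using tau_nonneg[OF invariant] by (simp add: hom_point_theta)

lemma frontier_subset_dom: "frontier \<Omega> \<subseteq> \<Omega>"
  using closed_dom by (simp add: frontier_subset_closed)

lemma b_in_frontier: "b \<in> frontier \<Omega>"
  unfolding frontier_orbit by (rule range_eqI[of _ _ 0]) (simp add: aff_act_ypart)

lemma b_in_dom: "b \<in> \<Omega>"
  using b_in_frontier frontier_subset_dom by blast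

lemma h_nonneg: "h v \<ge> 0"
  unfolding h_def by (rule tau_theta_nonneg[OF b_in_dom])

lemma hom_point_add_dir: "z $ None = 0 \<Longrightarrow> hom_point (x + ypart z) = hom_point x + z"
  by (simp add: vec_option_eq_iff hom_point_join)

lemma tau_theta_interior:
  assumes "x \<in> interior \<Omega>"
  shows "\<tau> \<bullet> (\<theta> v *v hom_point x) > 0"
proof -
  \<comment> \<open>A direction on which the functional in question has value 1; stepping backwards
    along it inside the domain makes the inequality strict.\<close>
  define d where "d = \<theta> (- v) *v (e *v bh)"
  have d0: "d $ None = 0"
    by (simp add: d_def)
  have "open (interior \<Omega>)" by simp
  then obtain r where r: "r > 0" "ball x r \<subseteq> interior \<Omega>"
    using assms open_contains_ball by blast
  define s where "s = r / (2 * (norm (ypart d) + 1))"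
  have s0: "s > 0"
    using r by (simp add: s_def add_nonneg_pos)
  have "s * norm (ypart d) \<le> r / 2"
    unfolding s_def by (rule half_radius_scale) (use r in auto)
  then have s: "s > 0" "x - s *\<^sub>R ypart d \<in> ball x r"
    using r s0 by (simp_all add: dist_norm)
  have "x - s *\<^sub>R ypart d \<in> \<Omega>"
    using s(2) r(2) interior_subset by blast
  moreover have "x - s *\<^sub>R ypart d = x + ypart (- s *\<^sub>R d)"
    by simp
  ultimately have "0 \<le> \<tau> \<bullet> (\<theta> v *v (hom_point x + (- s *\<^sub>R d)))"
    using tau_theta_nonneg hom_point_add_dir[of "- s *\<^sub>R d" x] d0 by (metis vector_scaleR_component scale_zero_right)
  also have "\<dots> = \<tau> \<bullet> (\<theta> v *v hom_point x) - s"
    by (simp add: mv_simps inner_simps d_def)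
  finally show ?thesis
    using s(1) by simp
qed

lemma crosses_frontier:
  assumes "x \<in> interior \<Omega>" "y \<notin> interior \<Omega>"
  obtains l v where "0 \<le> l" "l < 1" "l *\<^sub>R x + (1 - l) *\<^sub>R y = aff_act (\<theta> v) b"
proof -
  have "closed_segment x y \<inter> frontier (interior \<Omega>) \<noteq> {}"
    using assms by (intro connected_Int_frontier) (auto simp: connected_segment)
  then obtain q where q: "q \<in> closed_segment x y" "q \<in> frontier (interior \<Omega>)"
    by blast
  have qn: "q \<notin> interior \<Omega>"
    using q(2) by (simp add: frontier_def)
  have "q \<in> frontier \<Omega>"
    using q(2) qn closed_dom by (auto simp: frontier_def dest: closure_mono[OF interior_subset, THEN subsetD])
  then obtain v where v: "q = aff_act (\<theta> v) b"
    using frontier_orbit by blast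
  obtain u where u: "0 \<le> u" "u \<le> 1" "q = (1 - u) *\<^sub>R x + u *\<^sub>R y"
    using q(1) by (auto simp: in_segment)
  have "u \<noteq> 0"
    using u qn assms by auto
  then show thesis
    using u v by (intro that[of "1 - u" v]) auto
qed

lemma hom_point_convex: "hom_point (l *\<^sub>R x + (1 - l) *\<^sub>R y) = l *\<^sub>R hom_point x + (1 - l) *\<^sub>R hom_point y"
  by (simp add: vec_option_eq_iff hom_point_join)

text \<open>The segment from an interior point to \<open>y\<close> meets the boundary at an orbit
  point. The supporting functional there vanishes at the crossing and is positive at the interior
  end, so it is not positive at \<open>y\<close>.\<close>

lemma dom_support:
  assumes "y \<notin> interior \<Omega>"
  shows "\<exists>v. \<tau> \<bullet> (\<theta> v *v hom_point y) \<le> 0"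
proof -
  obtain x where x: "x \<in> interior \<Omega>"
    using interior_dom by blast
  obtain l v where l: "0 \<le> l" "l < 1" "l *\<^sub>R x + (1 - l) *\<^sub>R y = aff_act (\<theta> v) b"
    using crosses_frontier[OF x assms] by blast
  have "\<tau> \<bullet> (\<theta> (- v) *v hom_point (aff_act (\<theta> v) b)) = 0"
    by (simp add: hom_point_theta)
  then have "l * (\<tau> \<bullet> (\<theta> (- v) *v hom_point x)) + (1 - l) * (\<tau> \<bullet> (\<theta> (- v) *v hom_point y)) = 0"
    by (simp add: l(3)[symmetric] hom_point_convex mv_simps inner_simps)
  moreover have "l * (\<tau> \<bullet> (\<theta> (- v) *v hom_point x)) \<ge> 0"
    using tau_theta_interior[OF x, of "- v"] l by simp
  ultimately have "(1 - l) * (\<tau> \<bullet> (\<theta> (- v) *v hom_point y)) \<le> 0"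
    by linarith
  then have "\<tau> \<bullet> (\<theta> (- v) *v hom_point y) \<le> 0"
    using l by (simp add: mult_le_0_iff)
  then show ?thesis by blast
qed

text \<open>The half-spaces at the orbit points suffice: moving slightly towards an interior point
  makes all inequalities strict, which \<open>dom_support\<close> allows only inside the domain, and
  the domain is closed.\<close>

lemma dom_eq: "x \<in> \<Omega> \<longleftrightarrow> (\<forall>v. \<tau> \<bullet> (\<theta> v *v hom_point x) \<ge> 0)"
proof
  show "\<forall>v. \<tau> \<bullet> (\<theta> v *v hom_point x) \<ge> 0" if "x \<in> \<Omega>"
    using that tau_theta_nonneg by blast
  assume all: "\<forall>v. \<tau> \<bullet> (\<theta> v *v hom_point x) \<ge> 0"
  show "x \<in> \<Omega>"
  proof -
    obtain x0 where x0: "x0 \<in> interior \<Omega>"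
      using interior_dom by blast
    have "(1 - s) *\<^sub>R x + s *\<^sub>R x0 \<in> \<Omega>" if s: "0 < s" "s \<le> 1" for s
    proof (rule ccontr)
      let ?y = "(1 - s) *\<^sub>R x + s *\<^sub>R x0"
      assume "?y \<notin> \<Omega>"
      then have "?y \<notin> interior \<Omega>"
        using interior_subset by blast
      then obtain v where v: "\<tau> \<bullet> (\<theta> v *v hom_point ?y) \<le> 0"
        using dom_support by blast
      have "hom_point ?y = s *\<^sub>R hom_point x0 + (1 - s) *\<^sub>R hom_point x"
        by (metis add.commute hom_point_convex)
      then have "\<tau> \<bullet> (\<theta> v *v hom_point ?y) = s * (\<tau> \<bullet> (\<theta> v *v hom_point x0)) + (1 - s) * (\<tau> \<bullet> (\<theta> v *v hom_point x))"
        by (simp add: mv_simps inner_simps)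
      moreover have "s * (\<tau> \<bullet> (\<theta> v *v hom_point x0)) > 0"
        using tau_theta_interior[OF x0] s by simp
      moreover have "(1 - s) * (\<tau> \<bullet> (\<theta> v *v hom_point x)) \<ge> 0"
        using all s by simp
      ultimately show False
        using v by linarith
    qed
    moreover have "((\<lambda>s. (1 - s) *\<^sub>R x + s *\<^sub>R x0) \<longlongrightarrow> (1 - 0) *\<^sub>R x + 0 *\<^sub>R x0) (at_right 0)"
      by (intro tendsto_intros)
    moreover have "\<forall>\<^sub>F s in at_right 0. s \<in> {0<..1::real}"
      unfolding eventually_at_right_field by (auto intro!: exI[of _ 1])
    ultimately have "(1 - 0) *\<^sub>R x + (0::real) *\<^sub>R x0 \<in> \<Omega>"
      by (intro Lim_in_closed_set[OF closed_dom]) (auto elim!: eventually_mono)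
    then show ?thesis by simp
  qed
qed

lemma fixed_point:
  assumes "\<kappa> \<noteq> 0"
  shows "\<theta> v *v (bh - (1 / \<kappa>) *\<^sub>R (e *v bh)) = bh - (1 / \<kappa>) *\<^sub>R (e *v bh)"
proof -
  have "(1 / \<kappa>) *\<^sub>R (e *v (\<theta> v *v bh)) = (1 / \<kappa>) *\<^sub>R (e *v bh) + (\<theta> v *v bh - bh)"
    using assms by (simp add: e_theta scaleR_add_right)
  then show ?thesis
    by (simp add: mv_simps e_theta_commute[symmetric] algebra_simps)
qed

text \<open>If \<open>\<kappa> < 0\<close>, then the fixed point of the group is interior to \<open>\<Omega>\<close>. The supporting functionals at
  all boundary points take the same value there, so they are bounded, and so is the orbit.\<close>

lemma kappa_nonneg: "\<kappa> \<ge> 0"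
proof (rule ccontr)
  assume "\<not> \<kappa> \<ge> 0"
  then have k: "\<kappa> < 0" by simp
  define Ch where "Ch = bh - (1 / \<kappa>) *\<^sub>R (e *v bh)"
  define C where "C = ypart Ch"
  have Ch: "hom_point C = Ch"
    unfolding C_def by (rule hom_point_ypart) (simp add: Ch_def)
  have fixC: "\<theta> v *v Ch = Ch" for v
    unfolding Ch_def by (rule fixed_point) (use k in simp)
  have tC: "\<tau> \<bullet> Ch > 0"
    using k by (simp add: Ch_def inner_simps)
  have "C \<in> interior \<Omega>"
    using dom_support[of C] tC by (fastforce simp: Ch fixC)
  then obtain r where r: "r > 0" "ball C r \<subseteq> interior \<Omega>"
    using open_contains_ball open_interior by blast
  \<comment> \<open>Both points C \<plusminus> s d lie in the domain, where every moved functional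
    is nonnegative, and all these functionals agree at the fixed point. This bounds their values on
    \<open>d\<close> independently of \<open>v\<close>.\<close>
  have bnd: "\<exists>K. \<forall>v. \<bar>\<tau> \<bullet> (\<theta> v *v d)\<bar> \<le> K" if d: "d $ None = 0" for d
  proof -
    define s where "s = r / (2 * (norm (ypart d) + 1))"
    have s: "s > 0"
      using r by (simp add: s_def add_nonneg_pos)
    have "s * norm (ypart d) \<le> r / 2"
      unfolding s_def by (rule half_radius_scale) (use r in auto)
    then have in': "C + ypart (s *\<^sub>R d) \<in> \<Omega>" "C + ypart (- s *\<^sub>R d) \<in> \<Omega>"
      using r s interior_subset[of \<Omega>] by (auto simp: dist_norm subset_iff)
    have "\<bar>\<tau> \<bullet> (\<theta> v *v d)\<bar> \<le> (\<tau> \<bullet> Ch) / s" for v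
    proof -
      have "0 \<le> \<tau> \<bullet> (\<theta> v *v (Ch + s *\<^sub>R d))"
        using tau_theta_nonneg[OF in'(1)] hom_point_add_dir[of "s *\<^sub>R d" C] d Ch by simp
      moreover have "0 \<le> \<tau> \<bullet> (\<theta> v *v (Ch + (- s *\<^sub>R d)))"
        using tau_theta_nonneg[OF in'(2)] hom_point_add_dir[of "- s *\<^sub>R d" C] d Ch by simp
      ultimately have "s * \<bar>\<tau> \<bullet> (\<theta> v *v d)\<bar> \<le> \<tau> \<bullet> Ch"
        using s by (simp add: mv_simps inner_simps fixC abs_if)
      then show ?thesis
        using s by (simp add: pos_le_divide_eq mult.commute)
    qed
    then show ?thesis by blast
  qed
  define d where "d = bh - Ch"
  have d0: "d $ None = 0"
    by (simp add: d_def Ch_def)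
  obtain K0 where K0: "\<And>v. \<bar>\<tau> \<bullet> (\<theta> v *v d)\<bar> \<le> K0"
    using bnd[OF d0] by blast
  have "\<forall>i. \<exists>K. \<forall>v. \<bar>\<tau> \<bullet> (\<theta> v *v (X (axis i 1) *v d))\<bar> \<le> K"
    using bnd by simp
  then obtain K where K: "\<And>i v. \<bar>\<tau> \<bullet> (\<theta> v *v (X (axis i 1) *v d))\<bar> \<le> K i"
    by metis
  have "norm (crd (\<theta> v *v d)) \<le> K0 + (\<Sum>i\<in>UNIV. K i)" for v
  proof -
    have "norm (crd (\<theta> v *v d)) \<le> (\<Sum>i\<in>UNIV. \<bar>crd (\<theta> v *v d) $ i\<bar>)"
      by (rule norm_le_l1_cart)
    also have "\<dots> = \<bar>\<tau> \<bullet> (\<theta> v *v d)\<bar> + (\<Sum>i\<in>UNIV. \<bar>\<tau> \<bullet> (\<theta> v *v (X (axis i 1) *v d))\<bar>)"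
      by (simp add: sum_UNIV_option crd_def X_theta_commute)
    also have "\<dots> \<le> K0 + (\<Sum>i\<in>UNIV. K i)"
      by (intro add_mono sum_mono K0 K)
    finally show ?thesis .
  qed
  then have bc: "bounded (range (\<lambda>v. crd (\<theta> v *v d)))"
    unfolding bounded_iff by blast
  have lin: "linear (\<lambda>x. ypart (E x *v bh))"
    by (auto intro!: linearI simp: linear_add[OF linear_E] linear_scale[OF linear_E] mv_simps)
  have "frontier \<Omega> \<subseteq> (+) C ` (\<lambda>x. ypart (E x *v bh)) ` range (\<lambda>v. crd (\<theta> v *v d))"
  proof
    fix q assume "q \<in> frontier \<Omega>"
    then obtain v where q: "q = aff_act (\<theta> v) b"
      using frontier_orbit by blast
    have "\<theta> v *v bh = Ch + \<theta> v *v d"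
      by (simp add: d_def mv_simps fixC)
    also have "\<theta> v *v d = E (crd (\<theta> v *v d)) *v bh"
      by (rule E_crd[symmetric]) (simp add: d0)
    finally have "q = C + ypart (E (crd (\<theta> v *v d)) *v bh)"
      by (simp add: q aff_act_ypart C_def)
    then show "q \<in> (+) C ` (\<lambda>x. ypart (E x *v bh)) ` range (\<lambda>v. crd (\<theta> v *v d))"
      by blast
  qed
  moreover have "bounded ((+) C ` (\<lambda>x. ypart (E x *v bh)) ` range (\<lambda>v. crd (\<theta> v *v d)))"
    using bounded_linear_image[OF bc] lin by (intro bounded_translation) (simp add: linear_linear)
  ultimately have "bounded (frontier \<Omega>)"
    using bounded_subset by blast
  then show False
    using noncompact compact_eq_bounded_closed frontier_closed by blast
qed

section \<open>The domain in frame coordinates\<close>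

definition pt :: "'m point \<Rightarrow> 'm point" where
  "pt x = ypart (bh + E x *v bh)"

text \<open>In the frame at a boundary point \<open>p\<close> the domain has the same coordinates \<open>D\<close> for every \<open>p\<close>.\<close>

definition D :: "'m point set" where
  "D = {x. pt x \<in> \<Omega>}"

lemma hom_point_pt: "hom_point (pt x) = bh + E x *v bh"
  unfolding pt_def by (rule hom_point_ypart) simp

lemma pt_affine: "pt x = b + ypart (E x *v bh)"
  by (simp add: pt_def)

lemma linear_pt_dir: "linear (\<lambda>x. ypart (E x *v bh))"
  by (auto intro!: linearI simp: linear_add[OF linear_E] linear_scale[OF linear_E] mv_simps)

lemma continuous_pt: "continuous_on A pt"
  unfolding pt_affine[abs_def]
  by (intro continuous_intros linear_continuous_on linear_pt_dir[THEN linear_conv_bounded_linear[THEN iffD1]])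

lemma closed_D: "closed D"
  using closed_vimage[OF closed_dom continuous_pt] by (simp add: D_def vimage_def)

lemma convex_D: "convex D"
proof -
  have "D = (\<lambda>x. ypart (E x *v bh)) -` ((\<lambda>x. - b + x) ` \<Omega>)"
    by (auto simp: D_def pt_affine image_iff intro: bexI[rotated] simp: algebra_simps)
  then show ?thesis
    using convex_linear_vimage[OF linear_pt_dir] convex_translation[OF convex_dom] by metis
qed

lemma D_iff: "x \<in> D \<longleftrightarrow> (\<forall>v. h v + \<phi> v (ypart x) + x $ None * (1 + \<kappa> * h v) \<ge> 0)"
  by (simp add: D_def dom_eq hom_point_pt tau_theta_frame)

lemma zero_in_D: "0 \<in> D"
  by (simp add: D_iff h_nonneg linear_0[OF linear_phi])

lemma D_nonneg: "x \<in> D \<Longrightarrow> x $ None \<ge> 0"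
  using D_iff[of x] by (drule_tac iffD1) (simp, drule spec[of _ 0], simp add: h_def \<phi>_def)

text \<open>Since \<kappa> and \<open>h\<close> are nonnegative, the height enters every defining
  inequality with coefficient at least 1.\<close>

lemma D_upward:
  assumes "join y s \<in> D" "s \<le> s'"
  shows "join y s' \<in> D"
proof -
  have "s * (1 + \<kappa> * h v) \<le> s' * (1 + \<kappa> * h v)" for v
    using assms(2) h_nonneg kappa_nonneg by (intro mult_right_mono) auto
  then show ?thesis
    using assms(1) unfolding D_iff by (simp) (meson add_left_mono order_trans)
qed

lemma D_scale: "x \<in> D \<Longrightarrow> 0 \<le> l \<Longrightarrow> l \<le> 1 \<Longrightarrow> l *\<^sub>R x \<in> D"
  using convexD[OF convex_D _ zero_in_D, of x l "1 - l"] by simp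

text \<open>Near the base point the domain lies between two paraboloids close to s = \<bar>y\<bar>^2
  / 2. The constants 9/20 < 1/2 and 7/5 < 2 are close enough for the ball comparisons in
  \<open>V_upper\<close> and \<open>V_lower\<close>.\<close>

lemma D_sandwich:
  obtains \<delta>\<^sub>0 where "\<delta>\<^sub>0 > 0"
    "\<And>x. x \<in> D \<Longrightarrow> x $ None \<le> \<delta>\<^sub>0 \<Longrightarrow> 9 / 20 * (norm (ypart x))\<^sup>2 \<le> x $ None"
    "\<And>y \<delta>. 0 < \<delta> \<Longrightarrow> \<delta> \<le> \<delta>\<^sub>0 \<Longrightarrow> (norm y)\<^sup>2 \<le> 7 / 5 * \<delta> \<Longrightarrow> join y \<delta> \<in> D"
proof -
  obtain A where A: "A \<ge> 0"
    "\<And>v. norm v \<le> 1 \<Longrightarrow> \<bar>h v - (norm v)\<^sup>2 / 2\<bar> \<le> A * norm v ^ 3"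
    "\<And>v y. norm v \<le> 1 \<Longrightarrow> \<bar>\<phi> v y - v \<bullet> y\<bar> \<le> A * norm v ^ 2 * norm y"
    using frame_bounds by metis
  \<comment> \<open>Within this radius the Taylor errors are at most 1/100 of \<bar>y\<bar>^2 and
    the coefficient 1 + \<kappa> h is at most 21/20.\<close>
  define r where "r = min 1 (min (1 / (100 * (A + 1))) (1 / (20 * (\<kappa> * (1/2 + A) + 1))))"
  have pos: "\<kappa> * (1/2 + A) \<ge> 0"
    using A(1) kappa_nonneg by simp
  have r: "r > 0" "r \<le> 1" "r \<le> 1 / (100 * (A + 1))" "r \<le> 1 / (20 * (\<kappa> * (1/2 + A) + 1))"
    using A(1) pos by (auto simp: r_def)
  have Ar: "A * r \<le> 1 / 100"
  proof -
    have "(A + 1) * r \<le> 1 / 100"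
      using r(3) A(1) by (simp add: pos_le_divide_eq mult_ac)
    moreover have "A * r \<le> (A + 1) * r"
      using r by simp
    ultimately show ?thesis by linarith
  qed
  have kr: "\<kappa> * (1/2 + A) * r \<le> 1 / 20"
  proof -
    have "r \<le> 1 / (20 * (k + 1)) \<Longrightarrow> 0 \<le> k \<Longrightarrow> (k + 1) * r \<le> 1 / 20" for k
      by (simp add: field_simps)
    from this[OF r(4) pos] have "(\<kappa> * (1/2 + A) + 1) * r \<le> 1 / 20" .
    moreover have "\<kappa> * (1/2 + A) * r \<le> (\<kappa> * (1/2 + A) + 1) * r"
      using r by simp
    ultimately show ?thesis by linarith
  qed
  \<comment> \<open>The inequality of \<open>D_iff\<close> is tested at v = - y, where
    \<open>h\<close> is about \<bar>y\<bar>^2 / 2 and \<phi> about - \<bar>y\<bar>^2. This gives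
    48/100 \<bar>y\<bar>^2 \<le> 21/20 s, and 48/105 exceeds 9/20.\<close>
  have low: "9 / 20 * (norm (ypart x))\<^sup>2 \<le> x $ None" if x: "x \<in> D" and n: "norm (ypart x) \<le> r" for x
  proof -
    let ?y = "ypart x" and ?s = "x $ None"
    let ?N = "norm ?y"
    have N: "?N \<le> 1" "0 \<le> ?N"
      using n r by auto
    have N3: "A * ?N ^ 3 \<le> 1 / 100 * ?N ^ 2"
    proof -
      have "A * ?N \<le> A * r"
        using A(1) n by (rule mult_left_mono[rotated])
      then have "(A * ?N) * ?N ^ 2 \<le> 1 / 100 * ?N ^ 2"
        using Ar by (intro mult_right_mono) auto
      then show ?thesis
        by (simp add: power3_eq_cube power2_eq_square mult_ac)
    qed
    have h1: "h (- ?y) \<le> ?N ^ 2 / 2 + 1 / 100 * ?N ^ 2"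
      using A(2)[of "- ?y"] N N3 by (simp add: abs_le_iff)
    have "\<phi> (- ?y) ?y \<le> - (?N ^ 2) + A * ?N ^ 2 * ?N"
      using A(3)[of "- ?y" ?y] N by (simp add: abs_le_iff power2_norm_eq_inner)
    also have "A * ?N ^ 2 * ?N = A * ?N ^ 3"
      by (simp add: power3_eq_cube power2_eq_square)
    finally have p1: "\<phi> (- ?y) ?y \<le> - (?N ^ 2) + 1 / 100 * ?N ^ 2"
      using N3 by linarith
    have "\<kappa> * h (- ?y) \<le> \<kappa> * ((1/2 + A) * ?N)"
    proof (rule mult_left_mono[OF _ kappa_nonneg])
      have "h (- ?y) \<le> ?N ^ 2 / 2 + A * ?N ^ 3"
        using A(2)[of "- ?y"] N by (simp add: abs_le_iff)
      moreover have "?N ^ 2 \<le> ?N"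
        using N by (simp add: power2_eq_square mult_left_le)
      moreover have "A * ?N ^ 3 \<le> A * ?N"
        using N power_decreasing[of 1 3 ?N] A(1) by (intro mult_left_mono) auto
      ultimately show "h (- ?y) \<le> (1/2 + A) * ?N"
        by (simp add: algebra_simps)
    qed
    also have "\<dots> \<le> \<kappa> * (1/2 + A) * r"
      using n pos by (simp add: mult.assoc[symmetric] mult_left_mono)
    finally have k1: "\<kappa> * h (- ?y) \<le> 1 / 20"
      using kr by linarith
    have s0: "?s \<ge> 0"
      using x by (rule D_nonneg)
    have "?s * (1 + \<kappa> * h (- ?y)) \<le> ?s * (1 + 1 / 20)"
      using s0 k1 by (intro mult_left_mono) auto
    moreover have "h (- ?y) + \<phi> (- ?y) ?y + ?s * (1 + \<kappa> * h (- ?y)) \<ge> 0"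
      using x D_iff by blast
    ultimately have "?N ^ 2 * 48 / 100 \<le> ?s * (21 / 20)"
      using h1 p1 by simp
    moreover have "?N ^ 2 \<ge> 0" by simp
    ultimately show ?thesis by linarith
  qed
  \<comment> \<open>Orbit points raised to height 11/20 q^2 give points of the convex slice close to
    every vector of length q. A hyperplane separating a point of norm at most 9/10 q from the slice
    is contradicted by the one near the vector of length q opposite to its normal.\<close>
  have up: "join y (11 / 20 * q\<^sup>2) \<in> D" if q: "0 < q" "q \<le> r" and y: "norm y \<le> 9 / 10 * q" for q y
  proof (rule ccontr)
    let ?Y = "{y. join y (11 / 20 * q\<^sup>2) \<in> D}"
    assume "join y (11 / 20 * q\<^sup>2) \<notin> D"
    have Aq: "A * q \<le> 1 / 100"
      using Ar mult_left_mono[OF q(2) A(1)] by linarith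
    have mem: "\<exists>z\<in>?Y. norm (z - v) \<le> A * q ^ 2" if v: "norm v = q" for v
    proof -
      let ?x = "crd (\<theta> v *v bh)"
      have v1: "norm v \<le> 1"
        using v q r by simp
      have "E ?x *v bh = \<theta> v *v bh - bh"
        using decomp[of "\<theta> v *v bh", symmetric] by (simp add: algebra_simps)
      then have "pt ?x = aff_act (\<theta> v) b"
        by (simp add: pt_def aff_act_ypart)
      then have "?x \<in> D"
        using invariant[OF b_in_dom, of v] by (simp add: D_def)
      moreover have "?x $ None = h v"
        by (simp add: tau_crd[symmetric] h_def)
      moreover have "h v \<le> 11 / 20 * q\<^sup>2"
      proof -
        have "h v \<le> q ^ 2 / 2 + (A * q) * q ^ 2"
          using A(2)[OF v1] by (simp add: v abs_le_iff power3_eq_cube power2_eq_square)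
        also have "(A * q) * q ^ 2 \<le> 1 / 100 * q ^ 2"
          using Aq by (intro mult_right_mono) auto
        finally have "h v \<le> q ^ 2 / 2 + 1 / 100 * q ^ 2"
          by simp
        moreover have "q ^ 2 \<ge> 0" by simp
        ultimately show ?thesis by linarith
      qed
      ultimately have "ypart ?x \<in> ?Y"
        using D_upward[of "ypart ?x" "?x $ None" "11 / 20 * q\<^sup>2"]
        by (metis (no_types, lifting) join_ypart mem_Collect_eq)
      moreover have "norm (ypart ?x - v) \<le> A * q ^ 2"
      proof -
        let ?d = "ypart ?x - v"
        have "norm ?d * norm ?d = ?d \<bullet> ypart ?x - ?d \<bullet> v"
          by (metis inner_diff_right power2_eq_square power2_norm_eq_inner)
        also have "\<dots> = \<phi> v ?d - v \<bullet> ?d"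
          by (metis ypart_crd_theta inner_commute)
        also have "\<dots> \<le> A * q ^ 2 * norm ?d"
          using A(3)[OF v1, of ?d] by (simp add: v abs_le_iff)
        finally show ?thesis
          using A(1) by (cases "norm ?d = 0") (auto simp: mult_le_cancel_right)
      qed
      ultimately show ?thesis by blast
    qed
    have "closed ?Y"
      using closed_vimage[OF closed_D continuous_join_left, of "11 / 20 * q\<^sup>2"] by (simp add: vimage_def)
    moreover have "convex ?Y"
      by (rule convex_slice[OF convex_D])
    moreover have "y \<notin> ?Y"
      using \<open>join y (11 / 20 * q\<^sup>2) \<notin> D\<close> by simp
    ultimately obtain a c where ac: "a \<bullet> y < c" "\<And>z. z \<in> ?Y \<Longrightarrow> c < a \<bullet> z"
      using separating_hyperplane_closed_point[of ?Y y] by blast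
    have a0: "a \<noteq> 0"
    proof
      assume "a = 0"
      moreover obtain z where "z \<in> ?Y"
        using mem[of "q *\<^sub>R axis undefined 1"] q by auto
      ultimately show False
        using ac(1) ac(2)[of z] by simp
    qed
    define v where "v = - (q / norm a) *\<^sub>R a"
    have "norm v = q"
      using a0 q by (simp add: v_def)
    then obtain z where z: "z \<in> ?Y" "norm (z - v) \<le> A * q ^ 2"
      using mem by blast
    have "a \<bullet> z = a \<bullet> v + a \<bullet> (z - v)"
      by (simp add: inner_diff_right)
    also have "a \<bullet> v = - q * norm a"
      using a0 by (simp add: v_def dot_square_norm power2_eq_square)
    also have "a \<bullet> (z - v) \<le> norm a * (A * q ^ 2)"
      using norm_cauchy_schwarz[of a "z - v"] z(2) by (meson mult_left_mono norm_ge_zero order_trans)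
    also have "norm a * (A * q ^ 2) = (A * q) * (q * norm a)"
      by (simp add: power2_eq_square)
    also have "\<dots> \<le> 1 / 100 * (q * norm a)"
      using Aq q by (intro mult_right_mono) auto
    finally have "a \<bullet> z \<le> - (99 / 100) * (q * norm a)"
      by simp
    moreover have "- (9 / 10) * (q * norm a) \<le> a \<bullet> y"
    proof -
      have "- (a \<bullet> y) \<le> norm a * norm y"
        using Cauchy_Schwarz_ineq2[of a y] by linarith
      also have "\<dots> \<le> norm a * (9 / 10 * q)"
        using y by (intro mult_left_mono) auto
      finally show ?thesis by (simp add: mult_ac)
    qed
    ultimately have "- (9 / 10) * (q * norm a) < - (99 / 100) * (q * norm a)"
      using ac(1) ac(2)[OF z(1)] by linarith
    moreover have "q * norm a > 0"
      using q a0 by simp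
    ultimately show False by linarith
  qed
  show thesis
  proof
    define \<delta>\<^sub>0 where "\<delta>\<^sub>0 = 4 / 10 * r\<^sup>2"
    show d0: "\<delta>\<^sub>0 > 0"
      using r by (simp add: \<delta>\<^sub>0_def)
    show "9 / 20 * (norm (ypart x))\<^sup>2 \<le> x $ None" if x: "x \<in> D" "x $ None \<le> \<delta>\<^sub>0" for x
    proof (cases "norm (ypart x) \<le> r")
      case True
      then show ?thesis using low x by blast
    next
      case False
      \<comment> \<open>Shrinking \<open>x\<close> towards 0 until its tangential part has length
        \<open>r\<close> gives height at least 9/20 r^2, above the bound 4/10 r^2; so this case
        cannot occur.\<close>
      define l where "l = r / norm (ypart x)"
      have l: "0 < l" "l \<le> 1" "l * norm (ypart x) = r"
        using False r by (auto simp: l_def divide_simps)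
      have "9 / 20 * r\<^sup>2 \<le> l * x $ None"
        using low[of "l *\<^sub>R x"] D_scale[OF x(1)] l by simp
      also have "\<dots> \<le> x $ None"
        using l D_nonneg[OF x(1)] by (simp add: mult_left_le_one_le)
      finally have "9 / 20 * r\<^sup>2 \<le> x $ None" .
      moreover have "r\<^sup>2 > 0"
        using r by simp
      ultimately show ?thesis
        using x(2) unfolding \<delta>\<^sub>0_def by linarith
    qed
    show "join y \<delta> \<in> D" if \<delta>: "0 < \<delta>" "\<delta> \<le> \<delta>\<^sub>0" and y: "(norm y)\<^sup>2 \<le> 7 / 5 * \<delta>" for y \<delta>
    proof -
      \<comment> \<open>Chosen so that 11/20 q^2 = \<delta>; then (9/10 q)^2 = 81/55 \<delta>, which
        is more than 7/5 \<delta>.\<close>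
      define q where "q = sqrt (20 / 11 * \<delta>)"
      have q2: "q\<^sup>2 = 20 / 11 * \<delta>"
        using \<delta> by (simp add: q_def)
      have q0: "q > 0"
        using \<delta> by (simp add: q_def)
      have "q\<^sup>2 \<le> r\<^sup>2"
        using \<delta>(2) zero_le_power2[of r] unfolding q2 \<delta>\<^sub>0_def by linarith
      then have qr: "q \<le> r"
        using r by (simp add: abs_le_square_iff[symmetric])
      have "(9 / 10 * q)\<^sup>2 = 81 / 100 * (20 / 11 * \<delta>)"
        unfolding power_mult_distrib q2 by (simp add: power2_eq_square)
      then have "(norm y)\<^sup>2 \<le> (9 / 10 * q)\<^sup>2"
        using y \<delta> by linarith
      then have "norm y \<le> 9 / 10 * q"
        using q0 by (simp add: abs_le_square_iff[symmetric])
      from up[OF q0 qr this] show ?thesis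
        by (simp add: q2)
    qed
  qed
qed

end

subsection \<open>Caps and their sections\<close>

lemma upward_closed_ray:
  fixes F :: "real set"
  assumes "closed F" "\<And>s. s \<in> F \<Longrightarrow> 0 \<le> s" "\<And>s s'. s \<in> F \<Longrightarrow> s \<le> s' \<Longrightarrow> s' \<in> F" "F \<noteq> {}"
  obtains s\<^sub>0 where "F = {s\<^sub>0..}" "s\<^sub>0 \<ge> 0"
proof -
  have bdd: "bdd_below F"
    by (rule bdd_belowI[of _ 0]) (rule assms(2))
  have "Inf F \<in> F"
    by (rule closed_contains_Inf[OF assms(4) bdd assms(1)])
  moreover have "F \<subseteq> {Inf F..}"
    using bdd by (auto intro: cInf_lower)
  ultimately have "F = {Inf F..}"
    using assms(3) by auto
  then show thesis
    using that \<open>Inf F \<in> F\<close> assms(2) by blast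
qed

lemma measure_lborel_cball:
  "r \<ge> 0 \<Longrightarrow> measure lborel (cball (0 :: real ^ 'm) r) = unit_ball_vol (real CARD('m)) * r ^ CARD('m)"
  using content_cball[of r "0 :: real ^ 'm"] by (simp add: measure_completion)

lemma fmeasurable_compact_lborel: "compact A \<Longrightarrow> A \<in> fmeasurable lborel" for A :: "'a::euclidean_space set"
  by (intro fmeasurableI emeasure_bounded_finite compact_imp_bounded) (auto simp: borel_compact)

lemma integrable_indicator_compact:
  "compact A \<Longrightarrow> integrable lborel (indicator A :: 'a::euclidean_space \<Rightarrow> real)"
  using fmeasurable_compact_lborel[of A]
  by (intro integrable_real_indicator) (auto simp: fmeasurable_def)

context orbit_domain
begin

text \<open>One admissible bound is fixed so that all statements about caps share it.\<close>

definition \<delta>\<^sub>0 :: real where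
  "\<delta>\<^sub>0 = (SOME d. d > 0 \<and>
    (\<forall>x. x \<in> D \<longrightarrow> x $ None \<le> d \<longrightarrow> 9 / 20 * (norm (ypart x))\<^sup>2 \<le> x $ None) \<and>
    (\<forall>y \<delta>. 0 < \<delta> \<longrightarrow> \<delta> \<le> d \<longrightarrow> (norm y)\<^sup>2 \<le> 7 / 5 * \<delta> \<longrightarrow> join y \<delta> \<in> D))"

lemma delta0: "\<delta>\<^sub>0 > 0"
    "\<And>x. x \<in> D \<Longrightarrow> x $ None \<le> \<delta>\<^sub>0 \<Longrightarrow> 9 / 20 * (norm (ypart x))\<^sup>2 \<le> x $ None"
    "\<And>y \<delta>. 0 < \<delta> \<Longrightarrow> \<delta> \<le> \<delta>\<^sub>0 \<Longrightarrow> (norm y)\<^sup>2 \<le> 7 / 5 * \<delta> \<Longrightarrow> join y \<delta> \<in> D"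
proof -
  have "\<exists>d. d > 0 \<and>
    (\<forall>x. x \<in> D \<longrightarrow> x $ None \<le> d \<longrightarrow> 9 / 20 * (norm (ypart x))\<^sup>2 \<le> x $ None) \<and>
    (\<forall>y \<delta>. 0 < \<delta> \<longrightarrow> \<delta> \<le> d \<longrightarrow> (norm y)\<^sup>2 \<le> 7 / 5 * \<delta> \<longrightarrow> join y \<delta> \<in> D)"
    using D_sandwich by metis
  from someI_ex[OF this] show "\<delta>\<^sub>0 > 0"
    "\<And>x. x \<in> D \<Longrightarrow> x $ None \<le> \<delta>\<^sub>0 \<Longrightarrow> 9 / 20 * (norm (ypart x))\<^sup>2 \<le> x $ None"
    "\<And>y \<delta>. 0 < \<delta> \<Longrightarrow> \<delta> \<le> \<delta>\<^sub>0 \<Longrightarrow> (norm y)\<^sup>2 \<le> 7 / 5 * \<delta> \<Longrightarrow> join y \<delta> \<in> D"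
    unfolding \<delta>\<^sub>0_def by blast+
qed

definition Y :: "real \<Rightarrow> (real ^ 'm) set" where
  "Y \<delta> = {y. join y \<delta> \<in> D}"

definition Cap :: "real \<Rightarrow> 'm point set" where
  "Cap \<delta> = {x \<in> D. x $ None \<le> \<delta>}"

definition V :: "real \<Rightarrow> real" where
  "V \<delta> = measure lborel (Cap \<delta>)"

lemma closed_Y: "closed (Y \<delta>)"
  using closed_vimage[OF closed_D continuous_join_left, of \<delta>] by (simp add: Y_def vimage_def)

lemma convex_Y: "convex (Y \<delta>)"
  unfolding Y_def by (rule convex_slice[OF convex_D])

lemma Y_subset_cball: "\<delta> \<le> \<delta>\<^sub>0 \<Longrightarrow> Y \<delta> \<subseteq> cball 0 (sqrt (20 / 9 * \<delta>))"
  using delta0(2)[of "join _ \<delta>"] by (force simp: Y_def intro!: real_le_rsqrt)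

lemma cball_subset_Y: "0 < \<delta> \<Longrightarrow> \<delta> \<le> \<delta>\<^sub>0 \<Longrightarrow> cball 0 (sqrt (7 / 5 * \<delta>)) \<subseteq> Y \<delta>"
proof
  fix y :: "real ^ 'm"
  assume d: "0 < \<delta>" "\<delta> \<le> \<delta>\<^sub>0" and "y \<in> cball 0 (sqrt (7 / 5 * \<delta>))"
  then have "norm y \<le> sqrt (7 / 5 * \<delta>)"
    by simp
  then have "(norm y)\<^sup>2 \<le> (sqrt (7 / 5 * \<delta>))\<^sup>2"
    by (intro power_mono) auto
  also have "\<dots> = 7 / 5 * \<delta>"
    using d by simp
  finally show "y \<in> Y \<delta>"
    using delta0(3)[OF d] by (simp add: Y_def)
qed

lemma compact_Y: "\<delta> \<le> \<delta>\<^sub>0 \<Longrightarrow> compact (Y \<delta>)"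
  using closed_Y Y_subset_cball bounded_cball bounded_subset compact_eq_bounded_closed by metis

lemma compact_Cap:
  assumes "\<delta> \<le> \<delta>\<^sub>0"
  shows "compact (Cap \<delta>)"
proof -
  have "closed (Cap \<delta>)"
  proof -
    have "Cap \<delta> = D \<inter> {x. x $ None \<le> \<delta>}"
      by (auto simp: Cap_def)
    moreover have "closed {x :: 'm point. x $ None \<le> \<delta>}"
      by (intro closed_Collect_le continuous_intros)
    ultimately show ?thesis
      using closed_D by auto
  qed
  moreover have "Cap \<delta> \<subseteq> (\<lambda>(y, s). join y s) ` (cball 0 (sqrt (20 / 9 * \<delta>)) \<times> {0..\<delta>})"
  proof
    fix x assume x: "x \<in> Cap \<delta>"
    then have "9 / 20 * (norm (ypart x))\<^sup>2 \<le> x $ None" "x $ None \<le> \<delta>"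
      using assms delta0(2)[of x] by (auto simp: Cap_def)
    then have "(norm (ypart x))\<^sup>2 \<le> 20 / 9 * \<delta>"
      by linarith
    then have "norm (ypart x) \<le> sqrt (20 / 9 * \<delta>)"
      by (rule real_le_rsqrt)
    moreover have "0 \<le> x $ None" "x $ None \<le> \<delta>"
      using x D_nonneg by (auto simp: Cap_def)
    ultimately show "x \<in> (\<lambda>(y, s). join y s) ` (cball 0 (sqrt (20 / 9 * \<delta>)) \<times> {0..\<delta>})"
      by (intro image_eqI[of _ _ "(ypart x, x $ None)"]) auto
  qed
  moreover have "compact ((\<lambda>(y, s). join y s :: 'm point) ` (cball 0 (sqrt (20 / 9 * \<delta>)) \<times> {0..\<delta>}))"
    by (intro compact_continuous_image compact_Times linear_continuous_on
        linear_join[THEN linear_conv_bounded_linear[THEN iffD1]]) auto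
  ultimately show ?thesis
    using bounded_subset compact_eq_bounded_closed compact_imp_bounded by metis
qed

lemma fiber:
  obtains (empty) "{s. join y s \<in> D} = {}" | (ray) s\<^sub>0 where "{s. join y s \<in> D} = {s\<^sub>0..}" "s\<^sub>0 \<ge> 0"
proof (cases "{s. join y s \<in> D} = {}")
  case False
  have cl: "closed {s. join y s \<in> D}"
    using closed_vimage[OF closed_D continuous_join_right, of y] by (simp add: vimage_def)
  obtain s\<^sub>0 where "{s. join y s \<in> D} = {s\<^sub>0..}" "s\<^sub>0 \<ge> 0"
    by (rule upward_closed_ray[OF cl]) (use False D_nonneg[of "join y _"] D_upward in auto)
  then show thesis by (rule ray)
qed (rule empty)

definition len :: "real ^ 'm \<Rightarrow> real \<Rightarrow> real" where
  "len y c = measure lborel {s. join y s \<in> D \<and> s \<le> c}"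

lemma len_empty: "{s. join y s \<in> D} = {} \<Longrightarrow> len y c = 0"
  by (auto simp: len_def)

lemma ray_iff: "{s. join y s \<in> D} = {s\<^sub>0..} \<Longrightarrow> join y s \<in> D \<longleftrightarrow> s\<^sub>0 \<le> s"
  by (metis atLeast_iff mem_Collect_eq)

lemma len_ray:
  assumes "{s. join y s \<in> D} = {s\<^sub>0..}"
  shows "len y c = max 0 (c - s\<^sub>0)"
proof -
  have "join y s \<in> D \<longleftrightarrow> s\<^sub>0 \<le> s" for s
    using assms by (rule ray_iff)
  then have "{s. join y s \<in> D \<and> s \<le> c} = {s\<^sub>0..c}"
    by (simp only: atLeastAtMost_def atLeast_def atMost_def Collect_conj_eq)
  then have "len y c = measure lborel {s\<^sub>0..c}"
    by (simp only: len_def)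
  then show ?thesis
    by (cases "s\<^sub>0 \<le> c") simp_all
qed

text \<open>Provides the dominating bound for the difference quotients in
  \<open>section_moment\<close>.\<close>

lemma len_lipschitz: "\<bar>len y c - len y c'\<bar> \<le> \<bar>c - c'\<bar>"
  by (cases y rule: fiber) (auto simp: len_empty len_ray max_def)

text \<open>The affine action of \<open>\<theta> v\<close> read in frame coordinates;
  \<open>Lin v\<close> is its linear part.\<close>

definition G :: "real ^ 'm \<Rightarrow> 'm point \<Rightarrow> 'm point" where
  "G v x = crd (\<theta> v *v (bh + E x *v bh))"

definition Lin :: "real ^ 'm \<Rightarrow> 'm point \<Rightarrow> 'm point" where
  "Lin v x = crd (\<theta> v *v (E x *v bh))"

lemma linear_Lin: "linear (Lin v)"
  by (auto intro!: linearI simp: Lin_def linear_add[OF linear_E] linear_scale[OF linear_E] mv_simps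
      linear_add[OF linear_crd] linear_scale[OF linear_crd])

lemma G_Lin: "G v x = crd (\<theta> v *v bh) + Lin v x"
  by (simp add: G_def Lin_def mv_simps linear_add[OF linear_crd])

lemma frame_G: "bh + E (G v x) *v bh = \<theta> v *v (bh + E x *v bh)"
  unfolding G_def using decomp[of "\<theta> v *v (bh + E x *v bh)", symmetric] by simp

lemma G_inverse: "G (- v) (G v x) = x"
  unfolding G_def[of "- v"] frame_G by (simp add: linear_add[OF linear_crd])

lemma inj_Lin: "inj (Lin v)"
proof (rule injI)
  fix x y assume "Lin v x = Lin v y"
  then have "G v x = G v y"
    by (simp add: G_Lin)
  then show "x = y"
    by (metis G_inverse)
qed

lemma pt_G: "pt (G v x) = aff_act (\<theta> v) (pt x)"
  by (simp add: pt_def frame_G aff_act_ypart hom_point_pt[unfolded pt_def] del: ypart_simps)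

lemma G_in_D: "G v x \<in> D \<longleftrightarrow> x \<in> D"
  by (metis D_def G_inverse invariant mem_Collect_eq pt_G)

lemma G_None: "G v x $ None = h v + \<phi> v (ypart x) + x $ None * (1 + \<kappa> * h v)"
  by (simp add: G_def tau_crd[symmetric] tau_theta_frame)

text \<open>As \<open>G v\<close> preserves \<open>D\<close>, this is the preimage of the cap,
  although only the cutting hyperplane has moved. Its volume can therefore be computed both by a
  determinant and by slices.\<close>

definition CapT :: "real ^ 'm \<Rightarrow> real \<Rightarrow> 'm point set" where
  "CapT v \<delta> = {x \<in> D. G v x $ None \<le> \<delta>}"

lemma CapT_vimage: "CapT v \<delta> = G v -` Cap \<delta>"
  by (auto simp: CapT_def Cap_def G_in_D)

lemma CapT_image: "CapT v \<delta> = G (- v) ` Cap \<delta>"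
proof -
  have "G v (G (- v) x) = x" for x
    using G_inverse[of "- v"] by simp
  then show ?thesis
    unfolding CapT_vimage by (auto simp: image_iff) (metis G_inverse)
qed

lemma CapT_0: "CapT 0 \<delta> = Cap \<delta>"
  by (simp add: CapT_def Cap_def G_None h_def \<phi>_def)

lemma continuous_G: "continuous_on A (G v)"
  unfolding G_Lin[abs_def]
  by (intro continuous_intros linear_continuous_on linear_Lin[THEN linear_conv_bounded_linear[THEN iffD1]])

lemma compact_CapT: "\<delta> \<le> \<delta>\<^sub>0 \<Longrightarrow> compact (CapT v \<delta>)"
  unfolding CapT_image by (intro compact_continuous_image continuous_G compact_Cap)

lemma measure_CapT: "\<delta> \<le> \<delta>\<^sub>0 \<Longrightarrow> V \<delta> = \<bar>idx_det (Lin v)\<bar> * measure lborel (CapT v \<delta>)"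
  unfolding V_def CapT_vimage G_Lin[abs_def]
  by (rule measure_affine_vimage[OF linear_Lin inj_Lin]) (simp add: borel_compact compact_Cap)

text \<open>The height at which the line over \<open>y\<close> meets the moved hyperplane, from
  solving \<open>G_None\<close> for the height.\<close>

definition \<sigma> :: "real ^ 'm \<Rightarrow> real \<Rightarrow> real ^ 'm \<Rightarrow> real" where
  "\<sigma> v \<delta> y = (\<delta> - h v - \<phi> v y) / (1 + \<kappa> * h v)"

lemma one_plus_kappa_h: "1 + \<kappa> * h v \<ge> 1"
  using kappa_nonneg h_nonneg by simp

lemma slice_CapT: "{s. join y s \<in> CapT v \<delta>} = {s. join y s \<in> D \<and> s \<le> \<sigma> v \<delta> y}"
proof -
  have "h v + \<phi> v y + s * (1 + \<kappa> * h v) \<le> \<delta> \<longleftrightarrow> s \<le> \<sigma> v \<delta> y" for s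
    using one_plus_kappa_h[of v] by (simp add: \<sigma>_def pos_le_divide_eq algebra_simps)
  then show ?thesis
    by (auto simp: CapT_def G_None)
qed

lemma measure_slice_CapT: "measure lborel {s. join y s \<in> CapT v \<delta>} = len y (\<sigma> v \<delta> y)"
  by (simp add: slice_CapT len_def)

lemma sigma_0: "\<sigma> 0 \<delta> y = \<delta>"
  by (simp add: \<sigma>_def h_def \<phi>_def)

lemma fubini_CapT:
  assumes "\<delta> \<le> \<delta>\<^sub>0"
  shows "integrable lborel (\<lambda>y. len y (\<sigma> v \<delta> y))"
    "measure lborel (CapT v \<delta>) = (\<integral>y. len y (\<sigma> v \<delta> y) \<partial>lborel)"
  using fubini_join[OF compact_CapT[OF assms, of v]] by (simp_all add: measure_slice_CapT)

lemma V_integral: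
  assumes "\<delta> \<le> \<delta>\<^sub>0"
  shows "integrable lborel (\<lambda>y. len y \<delta>)" "V \<delta> = (\<integral>y. len y \<delta> \<partial>lborel)"
  using fubini_CapT[OF assms, of 0] by (simp_all add: sigma_0 CapT_0 V_def)

lemma Lin_0_matrix:
  "(\<chi> i j. Lin 0 (axis (ix j) 1) $ ix i) = (mat 1 :: real ^ 'm option idx ^ 'm option idx)"
proof -
  have "Lin 0 x = x" for x
    by (simp add: Lin_def)
  then show ?thesis
    using bij_ix[where 'n="'m option"] by (auto simp: vec_eq_iff mat_def axis_def bij_def inj_eq)
qed

lemma idx_det_Lin_derivative:
  "((\<lambda>t. idx_det (Lin (t *\<^sub>R v))) has_real_derivative tr v) (at 0)"
proof -
  let ?A = "\<lambda>t. (\<chi> i j. Lin (t *\<^sub>R v) (axis (ix j) 1) $ ix i) :: real ^ 'm option idx ^ 'm option idx"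
  let ?X = "(\<chi> i j. crd (X v *v (E (axis (ix j) 1) *v bh)) $ ix i) :: real ^ 'm option idx ^ 'm option idx"
  have "((\<lambda>t. det (?A t)) has_real_derivative trace ?X) (at 0)"
  proof (rule det_derivative_at_identity)
    show "?A 0 = mat 1"
      by (simp add: Lin_0_matrix)
    fix i j
    have "((\<lambda>t. crd (\<theta> (t *\<^sub>R v) *v (E (axis (ix j) 1) *v bh)) $ ix i) has_vector_derivative
        crd (X v *v (E (axis (ix j) 1) *v bh)) $ ix i) (at 0)"
      by (rule bounded_linear.has_vector_derivative[OF bounded_linear_compose[OF bounded_linear_vec_nth] vector_derivative_0])
        (simp add: linear_crd linear_conv_bounded_linear[symmetric])
    then show "((\<lambda>t. ?A t $ i $ j) has_real_derivative ?X $ i $ j) (at 0)"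
      unfolding has_real_derivative_iff_has_vector_derivative by (simp add: Lin_def)
  qed
  moreover have "trace ?X = (\<Sum>i\<in>UNIV. crd (X v *v (E (axis i 1) *v bh)) $ i)"
    unfolding trace_def
    using sum.reindex_bij_betw[OF bij_ix, of "\<lambda>i. crd (X v *v (E (axis i 1) *v bh)) $ i"] by simp
  ultimately show ?thesis
    by (simp add: idx_det_def sum_crd_X)
qed

lemma sigma_derivative: "((\<lambda>t. \<sigma> (t *\<^sub>R v) \<delta> y) has_real_derivative - (v \<bullet> y)) (at 0)"
proof -
  have d: "((\<lambda>t. \<tau> \<bullet> (\<theta> (t *\<^sub>R v) *v z)) has_real_derivative \<tau> \<bullet> (X v *v z)) (at 0)" for z
    unfolding has_real_derivative_iff_has_vector_derivative
    by (rule bounded_linear.has_vector_derivative[OF bounded_linear_inner_right vector_derivative_0])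
  have "((\<lambda>t. h (t *\<^sub>R v)) has_real_derivative 0) (at 0)"
    using d[of bh] by (simp add: h_def)
  moreover have "((\<lambda>t. \<phi> (t *\<^sub>R v) y) has_real_derivative v \<bullet> y) (at 0)"
    using d[of "X y *v bh"] by (simp add: \<phi>_def)
  moreover have "h (0 *\<^sub>R v) = 0" "\<phi> (0 *\<^sub>R v) y = 0"
    by (simp_all add: h_def \<phi>_def)
  ultimately show ?thesis
    unfolding \<sigma>_def by (auto intro!: derivative_eq_intros)
qed

text \<open>If \<open>y\<close> were interior, then l y with some l > 1 would lie in the section,
  and shrinking by 1 / l would give a point over \<open>y\<close> below height \<delta>. Thus the
  exceptional points of the limit in \<open>section_moment\<close> form a null set.\<close>

lemma boundary_height:
  assumes "0 < \<delta>" "{s. join y s \<in> D} = {\<delta>..}"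
  shows "y \<in> frontier (Y \<delta>)"
proof -
  have yY: "y \<in> Y \<delta>"
    using assms by (auto simp: Y_def)
  moreover have "y \<notin> interior (Y \<delta>)"
  proof
    assume "y \<in> interior (Y \<delta>)"
    then obtain r where r: "r > 0" "ball y r \<subseteq> Y \<delta>"
      by (meson mem_interior)
    define l where "l = 1 + r / (2 * (norm y + 1))"
    have l: "l > 1"
      using r by (simp add: l_def add_nonneg_pos)
    have "dist y (l *\<^sub>R y) = r / (2 * (norm y + 1)) * norm y"
      using r by (simp add: l_def dist_norm algebra_simps)
    also have "\<dots> \<le> r / 2"
      by (rule half_radius_scale) (use r in auto)
    also have "\<dots> < r"
      using r by simp
    finally have "l *\<^sub>R y \<in> Y \<delta>"
      using r by auto
    then have "(1 / l) *\<^sub>R join (l *\<^sub>R y) \<delta> \<in> D"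
      using l by (intro D_scale) (auto simp: Y_def)
    moreover have "(1 / l) *\<^sub>R join (l *\<^sub>R y) \<delta> = join y (\<delta> / l)"
      using l by (simp add: vec_option_eq_iff)
    ultimately have "\<delta> / l \<ge> \<delta>"
      using assms(2) by (metis (mono_tags) atLeast_iff mem_Collect_eq)
    then show False
      using l assms(1) by (simp add: pos_le_divide_eq)
  qed
  ultimately show ?thesis
    using closure_subset by (auto simp: frontier_def)
qed

text \<open>The divergence theorem for the affine vector field \<open>X v\<close>, which is tangent to the orbit: the
  volume of the cap cut off by the hyperplane \<open>\<tau> = \<delta>\<close> moved by \<open>\<theta> (t v)\<close> is known in terms of a
  determinant, and its derivative at \<open>t = 0\<close> is the first moment of the section.\<close>

lemma section_moment:
  assumes \<delta>: "0 < \<delta>" "\<delta> \<le> \<delta>\<^sub>0"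
  shows "(\<integral>y. indicator (Y \<delta>) y * (v \<bullet> y) \<partial>lborel) = tr v * V \<delta>"
proof -
  \<comment> \<open>The derivative at 0 is taken along a sequence because dominated convergence is
    applied to sequences.\<close>
  define t where "t n = 1 / (real n + 1)" for n
  have t: "t n > 0" "t n \<le> 1" for n
    by (simp_all add: t_def)
  have t_lim: "filterlim t (at 0) sequentially"
  proof -
    have "t \<longlonglongrightarrow> 0"
      unfolding t_def using LIMSEQ_inverse_real_of_nat by (simp add: inverse_eq_divide add.commute)
    moreover have "\<forall>n. t n \<noteq> 0"
      using t(1) by (metis less_irrefl)
    ultimately show ?thesis
      by (simp add: filterlim_at)
  qed
  let ?d = "\<lambda>s. idx_det (Lin (s *\<^sub>R v))"
  have d0: "idx_det (Lin 0) = 1"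
    by (simp add: idx_det_def Lin_0_matrix)
  have "((\<lambda>s. inverse (?d s)) has_real_derivative - tr v) (at 0)"
    using DERIV_inverse_fun[OF idx_det_Lin_derivative] d0 by simp
  then have lim0: "((\<lambda>s. (inverse (?d s) - 1) / s) \<longlongrightarrow> - tr v) (at 0)"
    by (simp add: has_field_derivative_iff d0)
  have "(?d \<longlongrightarrow> 1) (at 0)"
    using DERIV_isCont[OF idx_det_Lin_derivative] d0 by (simp add: isCont_def)
  then have dpos: "\<forall>\<^sub>F s in at 0. ?d s > 0"
    by (rule order_tendstoD) simp
  then have "\<forall>\<^sub>F s in at 0. (inverse (?d s) - 1) / s = (inverse \<bar>?d s\<bar> - 1) / s"
    by eventually_elim simp
  with lim0 have lim1: "((\<lambda>s. (inverse \<bar>?d s\<bar> - 1) / s) \<longlongrightarrow> - tr v) (at 0)"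
    by (rule Lim_transform_eventually)
  have VT: "measure lborel (CapT (s *\<^sub>R v) \<delta>) = inverse \<bar>?d s\<bar> * V \<delta>" if "?d s \<noteq> 0" for s
    using measure_CapT[OF \<delta>(2), of "s *\<^sub>R v"] that by simp
  have "((\<lambda>s. (inverse \<bar>?d s\<bar> - 1) / s * V \<delta>) \<longlongrightarrow> - tr v * V \<delta>) (at 0)"
    by (intro tendsto_intros lim1)
  moreover have "\<forall>\<^sub>F s in at 0. (inverse \<bar>?d s\<bar> - 1) / s * V \<delta> = (measure lborel (CapT (s *\<^sub>R v) \<delta>) - V \<delta>) / s"
    using dpos by eventually_elim (simp add: VT field_simps)
  ultimately have "((\<lambda>s. (measure lborel (CapT (s *\<^sub>R v) \<delta>) - V \<delta>) / s) \<longlongrightarrow> - tr v * V \<delta>) (at 0)"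
    by (rule Lim_transform_eventually)
  from filterlim_compose[OF this t_lim]
  have L1: "(\<lambda>n. (measure lborel (CapT (t n *\<^sub>R v) \<delta>) - V \<delta>) / t n) \<longlonglongrightarrow> - tr v * V \<delta>" .
  define g where "g n y = (len y (\<sigma> (t n *\<^sub>R v) \<delta> y) - len y \<delta>) / t n" for n y
  have g_int: "(measure lborel (CapT (t n *\<^sub>R v) \<delta>) - V \<delta>) / t n = (\<integral>y. g n y \<partial>lborel)" for n
    using fubini_CapT[OF \<delta>(2), of "t n *\<^sub>R v"] V_integral[OF \<delta>(2)] by (simp add: g_def)
  \<comment> \<open>All moved caps with parameter in [0, 1] form a continuous image of a compact
    set, so one ball supports every integrand.\<close>
  obtain R where R: "R > 0" "\<And>x s. x \<in> CapT (s *\<^sub>R v) \<delta> \<Longrightarrow> s \<in> {0..1} \<Longrightarrow> norm (ypart x) \<le> R"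
  proof -
    let ?I = "(\<lambda>(s, x). ypart (G (- (s *\<^sub>R v)) x)) ` ({0..1::real} \<times> Cap \<delta>)"
    have th: "continuous_on A (\<lambda>p. \<theta> (- (fst p *\<^sub>R v)))" for A :: "(real \<times> 'm point) set"
      by (rule continuous_on_compose2[OF continuous_theta]) (auto intro!: continuous_intros)
    have fr: "continuous_on A (\<lambda>p. bh + E (snd p) *v bh)" for A :: "(real \<times> 'm point) set"
    proof -
      have "linear (\<lambda>x. E x *v bh)"
        by (auto intro!: linearI simp: linear_add[OF linear_E] linear_scale[OF linear_E] mv_simps)
      then have c: "continuous_on UNIV (\<lambda>x. E x *v bh)"
        by (simp add: linear_continuous_on linear_linear)
      have "continuous_on A (\<lambda>p. E (snd p) *v bh)"
        by (rule continuous_on_compose2[OF c continuous_on_snd]) (auto intro: continuous_on_id)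
      then show ?thesis
        by (intro continuous_on_add continuous_on_const)
    qed
    have cy: "continuous_on UNIV (\<lambda>z. ypart (crd z))"
      using linear_compose[OF linear_crd linear_ypart] by (simp add: linear_continuous_on linear_linear o_def)
    have "continuous_on ({0..1} \<times> Cap \<delta>) (\<lambda>p. ypart (G (- (fst p *\<^sub>R v)) (snd p)))"
      unfolding G_def
      by (intro continuous_on_compose2[OF cy] bounded_bilinear.continuous_on[OF bounded_bilinear_matrix_vector_mult] th fr) auto
    then have "compact ?I"
      by (intro compact_continuous_image compact_Times compact_Cap \<delta>) (auto simp: case_prod_unfold)
    then obtain R where R: "R > 0" "\<forall>x\<in>?I. norm x \<le> R"
      using compact_imp_bounded bounded_pos by metis
    show thesis
    proof
      show "R > 0" by fact
      fix x and s :: real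
      assume "x \<in> CapT (s *\<^sub>R v) \<delta>" "s \<in> {0..1}"
      then obtain x' where "x' \<in> Cap \<delta>" "x = G (- (s *\<^sub>R v)) x'"
        unfolding CapT_image by blast
      then have "ypart x \<in> ?I"
        using \<open>s \<in> {0..1}\<close> by (intro image_eqI[of _ _ "(s, x')"]) auto
      then show "norm (ypart x) \<le> R"
        using R by blast
    qed
  qed
  have len0: "len y (\<sigma> (s *\<^sub>R v) \<delta> y) = 0" if "norm y > R" "s \<in> {0..1}" for s y
  proof -
    have "{u. join y u \<in> CapT (s *\<^sub>R v) \<delta>} = {}"
      using R(2)[of "join y _" s] that by fastforce
    then show ?thesis
      using measure_slice_CapT[of y "s *\<^sub>R v" \<delta>] by simp
  qed
  obtain A where A: "A \<ge> 0"
    "\<And>v. norm v \<le> 1 \<Longrightarrow> \<bar>h v\<bar> \<le> A * norm v"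
    "\<And>v y. norm v \<le> 1 \<Longrightarrow> \<bar>\<phi> v y\<bar> \<le> A * norm v * norm y"
    using frame_bounds by metis
  \<comment> \<open>Bounds the rate at which the moved height departs from \<delta>, uniformly for
    \<bar>y\<bar> \<le> R; the denominator of \<sigma> is at least 1.\<close>
  define B where "B = (1 + \<delta> * \<kappa>) * (A * norm v) + A * norm v * R"
  have g_bound: "norm (g n y) \<le> B * indicator (cball 0 R) y" if n: "norm (t n *\<^sub>R v) \<le> 1" for n y
  proof (cases "norm y \<le> R")
    case False
    then show ?thesis
      using len0[of y "t n"] len0[of y 0] t by (simp add: g_def sigma_0 less_imp_le)
  next
    case True
    let ?v = "t n *\<^sub>R v"
    have "\<sigma> ?v \<delta> y - \<delta> = (- h ?v - \<phi> ?v y - \<delta> * \<kappa> * h ?v) / (1 + \<kappa> * h ?v)"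
      using one_plus_kappa_h[of ?v] by (simp add: \<sigma>_def field_simps)
    then have "\<bar>\<sigma> ?v \<delta> y - \<delta>\<bar> = \<bar>- h ?v - \<phi> ?v y - \<delta> * \<kappa> * h ?v\<bar> / (1 + \<kappa> * h ?v)"
      using one_plus_kappa_h[of ?v] by (simp add: abs_divide)
    also have "\<dots> \<le> \<bar>- h ?v - \<phi> ?v y - \<delta> * \<kappa> * h ?v\<bar>"
      using one_plus_kappa_h[of ?v] by (simp add: divide_le_eq mult_right_le_one_le mult_le_cancel_left1)
    also have "\<dots> \<le> (1 + \<delta> * \<kappa>) * \<bar>h ?v\<bar> + \<bar>\<phi> ?v y\<bar>"
    proof -
      have "- h ?v - \<phi> ?v y - \<delta> * \<kappa> * h ?v = - ((1 + \<delta> * \<kappa>) * h ?v) - \<phi> ?v y"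
        by (simp add: algebra_simps)
      also have "\<bar>\<dots>\<bar> \<le> \<bar>(1 + \<delta> * \<kappa>) * h ?v\<bar> + \<bar>\<phi> ?v y\<bar>"
        by linarith
      finally show ?thesis
        using \<delta> kappa_nonneg by (simp add: abs_mult)
    qed
    also have "\<dots> \<le> (1 + \<delta> * \<kappa>) * (A * norm ?v) + A * norm ?v * R"
    proof (rule add_mono)
      show "(1 + \<delta> * \<kappa>) * \<bar>h ?v\<bar> \<le> (1 + \<delta> * \<kappa>) * (A * norm ?v)"
        using \<delta> kappa_nonneg A(2)[OF n] by (intro mult_left_mono) auto
      have "\<bar>\<phi> ?v y\<bar> \<le> A * norm ?v * norm y"
        by (rule A(3)[OF n])
      also have "\<dots> \<le> A * norm ?v * R"
        using True A(1) by (intro mult_left_mono) auto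
      finally show "\<bar>\<phi> ?v y\<bar> \<le> A * norm ?v * R" .
    qed
    also have "\<dots> = t n * B"
      using t(1)[of n] by (simp add: B_def algebra_simps)
    finally have "\<bar>len y (\<sigma> ?v \<delta> y) - len y \<delta>\<bar> \<le> t n * B"
      using len_lipschitz[of y "\<sigma> ?v \<delta> y" \<delta>] by linarith
    then have "norm (g n y) \<le> B"
      using t(1)[of n] by (simp add: g_def abs_divide divide_le_eq mult.commute)
    then show ?thesis
      using True by simp
  qed
  have ev_small: "\<forall>\<^sub>F n in sequentially. norm (t n *\<^sub>R v) \<le> 1"
  proof -
    have "(\<lambda>n. norm (t n *\<^sub>R v)) \<longlonglongrightarrow> norm (0 *\<^sub>R v)"
      using t_lim by (intro tendsto_intros) (simp add: filterlim_at)
    then have "\<forall>\<^sub>F n in sequentially. norm (t n *\<^sub>R v) < 1"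
      by (rule order_tendstoD) simp
    then show ?thesis
      by eventually_elim simp
  qed
  obtain N where N: "\<And>n. n \<ge> N \<Longrightarrow> norm (t n *\<^sub>R v) \<le> 1"
    using ev_small by (auto simp: eventually_sequentially)
  \<comment> \<open>Off the frontier the fibre starts strictly below or strictly above \<delta>, so
    the kink of the truncated length is avoided.\<close>
  have g_lim: "(\<lambda>n. g n y) \<longlonglongrightarrow> - (indicator (Y \<delta>) y * (v \<bullet> y))" if y: "y \<notin> frontier (Y \<delta>)" for y
  proof (cases y rule: fiber)
    case empty
    then have "y \<notin> Y \<delta>"
      by (auto simp: Y_def)
    then show ?thesis
      by (simp add: g_def len_empty[OF empty])
  next
    case (ray s\<^sub>0)
    have slim: "(\<lambda>n. \<sigma> (t n *\<^sub>R v) \<delta> y) \<longlonglongrightarrow> \<delta>"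
    proof -
      have "((\<lambda>s. \<sigma> (s *\<^sub>R v) \<delta> y) \<longlongrightarrow> \<delta>) (at 0)"
        using DERIV_isCont[OF sigma_derivative[of v \<delta> y]] by (simp add: isCont_def sigma_0)
      from filterlim_compose[OF this t_lim] show ?thesis .
    qed
    have "s\<^sub>0 \<noteq> \<delta>"
      using boundary_height[OF \<delta>(1)] ray y by blast
    then consider "s\<^sub>0 < \<delta>" | "s\<^sub>0 > \<delta>"
      by linarith
    then show ?thesis
    proof cases
      case 1
      then have yY: "y \<in> Y \<delta>"
        using ray_iff[OF ray(1)] by (simp add: Y_def)
      have "((\<lambda>s. (\<sigma> (s *\<^sub>R v) \<delta> y - \<delta>) / s) \<longlongrightarrow> - (v \<bullet> y)) (at 0)"
        using sigma_derivative[of v \<delta> y] by (simp add: has_field_derivative_iff sigma_0)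
      from filterlim_compose[OF this t_lim]
      have "(\<lambda>n. (\<sigma> (t n *\<^sub>R v) \<delta> y - \<delta>) / t n) \<longlonglongrightarrow> - (v \<bullet> y)" .
      moreover have "\<forall>\<^sub>F n in sequentially. \<sigma> (t n *\<^sub>R v) \<delta> y > s\<^sub>0"
        using order_tendstoD(1)[OF slim 1] .
      then have "\<forall>\<^sub>F n in sequentially. (\<sigma> (t n *\<^sub>R v) \<delta> y - \<delta>) / t n = g n y"
        by eventually_elim (use 1 in \<open>simp add: g_def len_ray[OF ray(1)]\<close>)
      ultimately have "(\<lambda>n. g n y) \<longlonglongrightarrow> - (v \<bullet> y)"
        by (rule Lim_transform_eventually)
      then show ?thesis
        using yY by simp
    next
      case 2
      then have yY: "y \<notin> Y \<delta>"
        using ray_iff[OF ray(1)] by (simp add: Y_def)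
      have "\<forall>\<^sub>F n in sequentially. \<sigma> (t n *\<^sub>R v) \<delta> y < s\<^sub>0"
        using order_tendstoD(2)[OF slim 2] .
      then have "\<forall>\<^sub>F n in sequentially. 0 = g n y"
        by eventually_elim (use 2 in \<open>simp add: g_def len_ray[OF ray(1)]\<close>)
      then have "(\<lambda>n. g n y) \<longlonglongrightarrow> 0"
        by (rule Lim_transform_eventually[OF tendsto_const])
      then show ?thesis
        using yY by simp
    qed
  qed
  have "(\<lambda>n. \<integral>y. g (n + N) y \<partial>lborel) \<longlonglongrightarrow> (\<integral>y. - (indicator (Y \<delta>) y * (v \<bullet> y)) \<partial>lborel)"
  proof (rule integral_dominated_convergence[where w="\<lambda>y. B * indicator (cball 0 R) y"])
    show "(\<lambda>y. - (indicator (Y \<delta>) y * (v \<bullet> y))) \<in> borel_measurable lborel"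
    proof -
      have "(\<lambda>y. indicator (Y \<delta>) y :: real) \<in> borel_measurable borel"
        using borel_closed[OF closed_Y] by (intro borel_measurable_indicator) auto
      moreover have "(\<lambda>y. v \<bullet> y) \<in> borel_measurable borel"
        by (intro borel_measurable_continuous_onI continuous_intros)
      ultimately show ?thesis
        by (simp add: borel_measurable_uminus borel_measurable_times)
    qed
    show "g (n + N) \<in> borel_measurable lborel" for n
      unfolding g_def using fubini_CapT(1)[OF \<delta>(2)] V_integral(1)[OF \<delta>(2)]
      by (intro borel_measurable_divide borel_measurable_diff) auto
    show "integrable lborel (\<lambda>y. B * indicator (cball 0 R) y)"
      by (rule integrable_mult_right[OF integrable_indicator_compact[OF compact_cball]])
    have "frontier (Y \<delta>) \<in> null_sets lebesgue"
      using negligible_convex_frontier[OF convex_Y] negligible_iff_null_sets by blast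
    then have "frontier (Y \<delta>) \<in> null_sets lborel"
      using null_sets_completion_iff[of "frontier (Y \<delta>)" lborel] by simp
    then have "AE y in lborel. y \<notin> frontier (Y \<delta>)"
      by (rule AE_not_in)
    then show "AE y in lborel. (\<lambda>n. g (n + N) y) \<longlonglongrightarrow> - (indicator (Y \<delta>) y * (v \<bullet> y))"
      by eventually_elim (rule LIMSEQ_ignore_initial_segment[OF g_lim])
    show "AE y in lborel. norm (g (n + N) y) \<le> B * indicator (cball 0 R) y" for n
      by (intro AE_I2 g_bound N) simp
  qed
  moreover have "(\<lambda>n. \<integral>y. g (n + N) y \<partial>lborel) \<longlonglongrightarrow> - tr v * V \<delta>"
    using LIMSEQ_ignore_initial_segment[OF L1, of N] by (simp add: g_int)
  ultimately have "(\<integral>y. - (indicator (Y \<delta>) y * (v \<bullet> y)) \<partial>lborel) = - tr v * V \<delta>"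
    by (rule LIMSEQ_unique)
  then show ?thesis
    by simp
qed

text \<open>Fibres starting above \<delta>/4 have length at most 3/4 \<delta>. By the paraboloid
  bounds the section at \<delta>/4 has at most 3/4 of the area of the one at \<delta>, and 3/4 + 1/4
  * 3/4 = 15/16. All that matters later is a bound below 1.\<close>

lemma V_upper:
  assumes \<delta>: "0 < \<delta>" "\<delta> \<le> \<delta>\<^sub>0"
  shows "V \<delta> \<le> 15 / 16 * \<delta> * measure lborel (Y \<delta>)"
proof -
  let ?a = "measure lborel (Y \<delta>)" and ?a' = "measure lborel (Y (\<delta> / 4))"
  have fin: "integrable lborel (\<lambda>y. indicator (Y \<eta>) y :: real)" if "\<eta> \<le> \<delta>\<^sub>0" for \<eta>
    by (rule integrable_indicator_compact[OF compact_Y[OF that]])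
  have d4: "\<delta> / 4 \<le> \<delta>\<^sub>0" "0 < \<delta> / 4"
    using \<delta> by auto
  have "V \<delta> = (\<integral>y. len y \<delta> \<partial>lborel)"
    by (rule V_integral(2)[OF \<delta>(2)])
  also have "\<dots> \<le> (\<integral>y. 3 / 4 * \<delta> * indicator (Y \<delta>) y + \<delta> / 4 * indicator (Y (\<delta> / 4)) y \<partial>lborel)"
  proof (rule integral_mono)
    show "integrable lborel (\<lambda>y. len y \<delta>)"
      by (rule V_integral(1)[OF \<delta>(2)])
    show "integrable lborel (\<lambda>y. 3 / 4 * \<delta> * indicator (Y \<delta>) y + \<delta> / 4 * indicator (Y (\<delta> / 4)) y)"
      using fin[OF \<delta>(2)] fin[OF d4(1)] by simp
    show "len y \<delta> \<le> 3 / 4 * \<delta> * indicator (Y \<delta>) y + \<delta> / 4 * indicator (Y (\<delta> / 4)) y" for y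
    proof (cases y rule: fiber)
      case empty
      then show ?thesis
        using \<delta> by (simp add: len_empty)
    next
      case (ray s\<^sub>0)
      have "y \<in> Y \<eta> \<longleftrightarrow> s\<^sub>0 \<le> \<eta>" for \<eta>
        using ray_iff[OF ray(1)] by (simp add: Y_def)
      then show ?thesis
        using \<delta> ray(2) by (auto simp: len_ray[OF ray(1)] indicator_def)
    qed
  qed
  also have "\<dots> = 3 / 4 * \<delta> * ?a + \<delta> / 4 * ?a'"
    using fin[OF \<delta>(2)] fin[OF d4(1)] by simp
  finally have le: "V \<delta> \<le> 3 / 4 * \<delta> * ?a + \<delta> / 4 * ?a'" .
  have "?a' \<le> 3 / 4 * ?a"
  proof -
    let ?r = "sqrt (20 / 9 * (\<delta> / 4))" and ?q = "sqrt (7 / 5 * \<delta>)"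
    have "?a' \<le> measure lborel (cball (0 :: real ^ 'm) ?r)"
      by (rule measure_mono_fmeasurable[OF Y_subset_cball[OF d4(1)]]) (use closed_Y in \<open>auto simp: fmeasurable_compact_lborel\<close>)
    also have "\<dots> = unit_ball_vol (real CARD('m)) * ?r ^ CARD('m)"
      using \<delta> by (intro measure_lborel_cball) simp
    also have "\<dots> \<le> unit_ball_vol (real CARD('m)) * (3 / 4 * ?q) ^ CARD('m)"
    proof (intro mult_left_mono power_mono)
      have "?r \<le> sqrt ((3 / 4)\<^sup>2 * (7 / 5 * \<delta>))"
        using \<delta> by (intro real_sqrt_le_mono) (simp add: power2_eq_square)
      also have "\<dots> = 3 / 4 * ?q"
        by (simp only: real_sqrt_mult real_sqrt_abs)
      finally show "?r \<le> 3 / 4 * ?q" .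
    qed (use \<delta> in \<open>auto simp: unit_ball_vol_nonneg\<close>)
    also have "\<dots> = (3 / 4) ^ CARD('m) * (unit_ball_vol (real CARD('m)) * ?q ^ CARD('m))"
      unfolding power_mult_distrib by (simp only: mult_ac)
    also have "\<dots> = (3 / 4) ^ CARD('m) * measure lborel (cball (0 :: real ^ 'm) ?q)"
      using \<delta> by (subst measure_lborel_cball) auto
    also have "\<dots> \<le> (3 / 4) ^ CARD('m) * ?a"
      using cball_subset_Y[OF \<delta>] closed_Y compact_Y[OF \<delta>(2)]
      by (intro mult_left_mono measure_mono_fmeasurable)
        (auto simp: fmeasurable_compact_lborel)
    also have "(3 / 4 :: real) ^ CARD('m) \<le> (3 / 4) ^ 1"
      by (rule power_decreasing) (auto simp: Suc_leI)
    finally show ?thesis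
      by (simp add: mult_right_mono)
  qed
  then have "\<delta> / 4 * ?a' \<le> \<delta> / 4 * (3 / 4 * ?a)"
    using \<delta> by (intro mult_left_mono) auto
  then show ?thesis
    using le by (simp add: algebra_simps)
qed

text \<open>Halving a point of the section shows that over a ball of radius
  \<open>sqrt (7 / 5 * \<delta>) / 2\<close> the fibres have length at least \<delta>/2. The factor
  3/8 compares this ball with the circumscribed one; only positivity of the bound matters
  later.\<close>

lemma V_lower:
  assumes \<delta>: "0 < \<delta>" "\<delta> \<le> \<delta>\<^sub>0"
  shows "(3 / 8) ^ CARD('m) / 2 * \<delta> * measure lborel (Y \<delta>) \<le> V \<delta>"
proof -
  let ?r = "sqrt (20 / 9 * \<delta>)" and ?q = "sqrt (7 / 5 * \<delta>) / 2"
  have "measure lborel (Y \<delta>) \<le> measure lborel (cball (0 :: real ^ 'm) ?r)"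
    by (rule measure_mono_fmeasurable[OF Y_subset_cball[OF \<delta>(2)]]) (use closed_Y in \<open>auto simp: fmeasurable_compact_lborel\<close>)
  then have "(3 / 8) ^ CARD('m) * measure lborel (Y \<delta>) \<le> (3 / 8) ^ CARD('m) * measure lborel (cball (0 :: real ^ 'm) ?r)"
    by (intro mult_left_mono) auto
  also have "\<dots> = (3 / 8) ^ CARD('m) * (unit_ball_vol (real CARD('m)) * ?r ^ CARD('m))"
    using \<delta> by (subst measure_lborel_cball) auto
  also have "\<dots> = unit_ball_vol (real CARD('m)) * (3 / 8 * ?r) ^ CARD('m)"
    unfolding power_mult_distrib by (simp only: mult_ac)
  also have "\<dots> \<le> unit_ball_vol (real CARD('m)) * ?q ^ CARD('m)"
  proof (intro mult_left_mono power_mono)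
    have "3 / 4 * ?r = sqrt ((3 / 4)\<^sup>2 * (20 / 9 * \<delta>))"
      by (simp only: real_sqrt_mult real_sqrt_abs)
    also have "\<dots> \<le> sqrt (7 / 5 * \<delta>)"
      using \<delta> by (intro real_sqrt_le_mono) (simp add: power2_eq_square)
    finally show "3 / 8 * ?r \<le> ?q" by simp
  qed (use \<delta> in \<open>auto simp: unit_ball_vol_nonneg\<close>)
  also have "\<dots> = measure lborel (cball (0 :: real ^ 'm) ?q)"
    using \<delta> by (subst measure_lborel_cball) auto
  finally have le: "(3 / 8) ^ CARD('m) * measure lborel (Y \<delta>) \<le> measure lborel (cball (0 :: real ^ 'm) ?q)" .
  have int: "integrable lborel (indicator (cball (0 :: real ^ 'm) ?q) :: _ \<Rightarrow> real)"
    by (rule integrable_indicator_compact[OF compact_cball])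
  have "\<delta> / 2 * measure lborel (cball (0 :: real ^ 'm) ?q) = (\<integral>y. \<delta> / 2 * indicator (cball (0 :: real ^ 'm) ?q) y \<partial>lborel)"
    by simp
  also have "\<dots> \<le> (\<integral>y. len y \<delta> \<partial>lborel)"
  proof (rule integral_mono)
    show "integrable lborel (\<lambda>y::real ^ 'm. \<delta> / 2 * indicator (cball 0 ?q) y)"
      using int by simp
    show "integrable lborel (\<lambda>y. len y \<delta>)"
      by (rule V_integral(1)[OF \<delta>(2)])
    fix y :: "real ^ 'm"
    show "\<delta> / 2 * indicator (cball 0 ?q) y \<le> len y \<delta>"
    proof (cases "y \<in> cball 0 ?q")
      case True
      then have "2 *\<^sub>R y \<in> Y \<delta>"
        using cball_subset_Y[OF \<delta>] by auto
      then have "(1 / 2) *\<^sub>R join (2 *\<^sub>R y) \<delta> \<in> D"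
        by (intro D_scale) (auto simp: Y_def)
      moreover have "(1 / 2) *\<^sub>R join (2 *\<^sub>R y) \<delta> = join y (\<delta> / 2)"
        by (simp add: vec_option_eq_iff)
      ultimately have half: "\<delta> / 2 \<in> {s. join y s \<in> D}"
        by simp
      then show ?thesis
      proof (cases y rule: fiber)
        case (ray s\<^sub>0)
        then have "s\<^sub>0 \<le> \<delta> / 2"
          using half by simp
        then show ?thesis
          using True \<delta>(1) by (simp add: len_ray[OF ray(1)] max_def)
      qed simp
    qed (simp add: len_def)
  qed
  also have "\<dots> = V \<delta>"
    by (rule V_integral(2)[OF \<delta>(2), symmetric])
  finally have "\<delta> / 2 * measure lborel (cball (0 :: real ^ 'm) ?q) \<le> V \<delta>" .
  moreover have "\<delta> / 2 * ((3 / 8) ^ CARD('m) * measure lborel (Y \<delta>)) \<le> \<delta> / 2 * measure lborel (cball (0 :: real ^ 'm) ?q)"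
    using le \<delta> by (intro mult_left_mono) auto
  ultimately show ?thesis
    by (simp add: algebra_simps)
qed

lemma measure_Y_pos:
  assumes \<delta>: "0 < \<delta>" "\<delta> \<le> \<delta>\<^sub>0"
  shows "measure lborel (Y \<delta>) > 0"
proof -
  have "0 < measure lborel (cball (0 :: real ^ 'm) (sqrt (7 / 5 * \<delta>)))"
    using \<delta> by (subst measure_lborel_cball) (auto intro!: mult_pos_pos simp: unit_ball_vol_pos)
  also have "\<dots> \<le> measure lborel (Y \<delta>)"
    using cball_subset_Y[OF \<delta>] closed_Y compact_Y[OF \<delta>(2)]
    by (intro measure_mono_fmeasurable) (auto simp: fmeasurable_compact_lborel)
  finally show ?thesis .
qed

end

subsection \<open>Centres of mass of affine images\<close>

text \<open>By polarization the normalized map preserves inner products, so its defects of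
  additivity and homogeneity have norm zero. Surjectivity is not assumed, as the maps in question
  parametrize a hyperplane.\<close>

lemma isometry_imp_linear:
  fixes f :: "'a::real_inner \<Rightarrow> 'b::real_inner"
  assumes iso: "\<And>y z. dist (f y) (f z) = dist y z"
  shows "linear (\<lambda>y. f y - f 0)" "\<And>y z. (f y - f 0) \<bullet> (f z - f 0) = y \<bullet> z"
proof -
  define g where "g y = f y - f 0" for y
  have n: "norm (g y) = norm y" for y
    using iso[of y 0] by (simp add: dist_norm g_def)
  have d: "norm (g y - g z) = norm (y - z)" for y z
    using iso[of y z] by (simp add: dist_norm g_def)
  have ip: "g y \<bullet> g z = y \<bullet> z" for y z
    using d[of y z] n[of y] n[of z] by (simp only: dot_norm_neg)
  then show "(f y - f 0) \<bullet> (f z - f 0) = y \<bullet> z" for y z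
    by (simp only: g_def)
  have "linear g"
  proof (rule linearI)
    fix x y and c :: real
    have "(g (x + y) - (g x + g y)) \<bullet> (g (x + y) - (g x + g y)) = 0"
      by (simp only: inner_diff_left inner_diff_right inner_add_left inner_add_right ip)
    then show "g (x + y) = g x + g y"
      by simp
    have "(g (c *\<^sub>R x) - c *\<^sub>R g x) \<bullet> (g (c *\<^sub>R x) - c *\<^sub>R g x) = 0"
      by (simp add: inner_diff_left inner_diff_right ip)
    then show "g (c *\<^sub>R x) = c *\<^sub>R g x"
      by simp
  qed
  then show "linear (\<lambda>y. f y - f 0)"
    by (simp only: g_def[abs_def])
qed

lemma idx_det_nonzero:
  fixes g :: "real ^ 'n \<Rightarrow> real ^ 'n"
  assumes "linear g" "inj g"
  shows "idx_det g \<noteq> 0"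
proof
  assume 0: "idx_det g = 0"
  have "measure lborel (cball (0 :: real ^ 'n) 1) = \<bar>idx_det g\<bar> * measure lborel ((\<lambda>x. 0 + g x) -` cball 0 1)"
    by (rule measure_affine_vimage) (use assms in auto)
  then have "measure lborel (cball (0 :: real ^ 'n) 1) = 0"
    using 0 by simp
  then show False
    using measure_lborel_cball[of 1, where 'm='n] unit_ball_vol_pos[of "real CARD('n)"] by simp
qed

lemma integral_affine_image:
  fixes g :: "real ^ 'n \<Rightarrow> real ^ 'n" and F :: "real ^ 'n \<Rightarrow> 'b::euclidean_space"
  assumes g: "linear g" "inj g" and F: "F \<in> borel_measurable borel"
  shows "(\<integral>x. F x \<partial>lborel) = \<bar>idx_det g\<bar> *\<^sub>R (\<integral>x. F (a + g x) \<partial>lborel)"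
proof -
  have gm [measurable]: "g \<in> borel_measurable borel"
    using g(1) by (simp add: borel_measurable_continuous_onI linear_continuous_on linear_linear)
  have Fm [measurable]: "(\<lambda>x. F (a + x)) \<in> borel_measurable borel"
    using F by measurable
  have "(\<integral>x. F x \<partial>lborel) = (\<integral>x. F x \<partial>distr lborel borel ((+) a))"
    by (simp add: lborel_distr_plus)
  also have "\<dots> = (\<integral>x. F (a + x) \<partial>lborel)"
    using F by (subst integral_distr) auto
  also have "\<dots> = (\<integral>x. F (a + x) \<partial>density (distr lborel borel g) (\<lambda>_. ennreal \<bar>idx_det g\<bar>))"
    using lborel_linear[OF g] by simp
  also have "\<dots> = (\<integral>x. \<bar>idx_det g\<bar> *\<^sub>R F (a + x) \<partial>distr lborel borel g)"
    by (rule integral_density) auto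
  also have "\<dots> = (\<integral>x. \<bar>idx_det g\<bar> *\<^sub>R F (a + g x) \<partial>lborel)"
    by (subst integral_distr) auto
  finally show ?thesis
    by simp
qed

text \<open>Any isometric parametrization covering the image differs from the given affine one by an
  affine automorphism of V. Both the volume and the first moment scale by its determinant, so the
  centre of mass does not depend on the isometry.\<close>

lemma center_of_mass_affine_image:
  fixes M :: "real ^ 'm \<Rightarrow> ('m::finite) point" and Y :: "(real ^ 'm) set"
  assumes M: "linear M" "inj M" and Y: "compact Y" "interior Y \<noteq> {}"
    and m: "measure lborel Y > 0"
  defines "ybar \<equiv> (\<integral>y. indicator Y y *\<^sub>R y \<partial>lborel) /\<^sub>R measure lborel Y"
  shows "is_center_of_mass ((\<lambda>y. c + M y) ` Y) x \<longleftrightarrow> x = c + M ybar"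
proof -
  let ?Q = "\<lambda>y. c + M y"
  have key: "measure lebesgue (f -` (?Q ` Y)) > 0 \<and>
      (f has_integral measure lebesgue (f -` (?Q ` Y)) *\<^sub>R (c + M ybar)) (f -` (?Q ` Y))"
    if iso: "\<And>y z. dist (f y) (f z) = dist y z" and sub: "?Q ` Y \<subseteq> range f" for f :: "real ^ 'm \<Rightarrow> 'm point"
  proof -
    define F where "F y = f y - f 0" for y
    have F: "linear F" "\<And>y z. F y \<bullet> F z = y \<bullet> z"
      using isometry_imp_linear[OF iso] by (simp_all only: F_def[abs_def])
    have fF: "f y = f 0 + F y" for y
      by (simp add: F_def)
    \<comment> \<open>A left inverse of the linear isometry; it pulls the given parametrization back
      to V.\<close>
    define Ft where "Ft = adjoint F"
    have Ft: "linear Ft" "\<And>x y. x \<bullet> Ft y = F x \<bullet> y"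
      using F(1) by (auto simp: Ft_def adjoint_linear adjoint_works)
    have FtF: "Ft (F y) = y" for y
      using Ft(2)[of _ "F y"] F(2) by (metis vector_eq_ldot inner_commute)
    define A where "A y = Ft (M y)" for y
    have A: "linear A"
      unfolding A_def using linear_compose[OF M(1) Ft(1)] by (simp add: o_def)
    define \<alpha> where "\<alpha> = Ft (c - f 0)"
    have fQ: "f (\<alpha> + A y) = ?Q y" if "y \<in> Y" for y
    proof -
      have "?Q y \<in> range f"
        using sub that by blast
      then obtain z where "?Q y = f z"
        by (rule rangeE)
      then have z: "f z = ?Q y"
        by (rule sym)
      then have "F z = (c - f 0) + M y"
        by (simp add: F_def)
      then have "Ft (F z) = \<alpha> + A y"
        by (simp add: \<alpha>_def A_def linear_add[OF Ft(1)])
      then show ?thesis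
        using z by (simp add: FtF)
    qed
    \<comment> \<open>The agreement is known only on \<open>Y\<close>; around an interior point of
      \<open>Y\<close>, differences reach every direction.\<close>
    have FA: "F (A z) = M z" for z
    proof -
      obtain y0 r where r: "r > 0" "ball y0 r \<subseteq> Y"
        using Y(2) by (meson all_not_in_conv mem_interior)
      define s where "s = r / (2 * (norm z + 1))"
      have s: "s > 0"
        using r by (simp add: s_def add_nonneg_pos)
      have "s * norm z \<le> r / 2"
        unfolding s_def by (rule half_radius_scale) (use r in auto)
      then have "y0 \<in> Y" "y0 + s *\<^sub>R z \<in> Y"
        using r s by (auto simp: dist_norm subset_iff)
      then have "f (\<alpha> + A (y0 + s *\<^sub>R z)) - f (\<alpha> + A y0) = ?Q (y0 + s *\<^sub>R z) - ?Q y0"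
        by (simp add: fQ)
      moreover have "f (\<alpha> + A (y0 + s *\<^sub>R z)) - f (\<alpha> + A y0) = s *\<^sub>R F (A z)"
        by (simp add: fF[of "\<alpha> + _"] linear_add[OF F(1)] linear_add[OF A] linear_scale[OF F(1)] linear_scale[OF A])
      moreover have "?Q (y0 + s *\<^sub>R z) - ?Q y0 = s *\<^sub>R M z"
        by (simp add: linear_add[OF M(1)] linear_scale[OF M(1)])
      ultimately show ?thesis
        using s by simp
    qed
    have injA: "inj A"
      by (rule injI) (metis FA M(2) injD)
    obtain y1 where "y1 \<in> Y"
      using Y(2) interior_subset by fastforce
    have fB: "f (\<alpha> + A y) = ?Q y" for y
    proof -
      have "f (\<alpha> + A y) = f (\<alpha> + A y1) + F (A y - A y1)"
        by (simp add: fF[of "\<alpha> + _"] linear_add[OF F(1)] linear_diff[OF F(1)])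
      also have "\<dots> = ?Q y"
        using fQ[OF \<open>y1 \<in> Y\<close>] by (simp add: linear_diff[OF F(1)] FA)
      finally show ?thesis .
    qed
    define Z where "Z = f -` (?Q ` Y)"
    have injf: "inj f"
      by (rule injI) (metis iso dist_eq_0_iff)
    have Zimg: "Z = (\<lambda>y. \<alpha> + A y) ` Y"
      unfolding Z_def
    proof safe
      fix z y assume "f z = c + M y" "y \<in> Y"
      then have "z = \<alpha> + A y"
        using fB injf by (metis injD)
      then show "z \<in> (\<lambda>y. \<alpha> + A y) ` Y"
        using \<open>y \<in> Y\<close> by blast
    qed (auto simp: fB)
    have contA: "continuous_on S A" for S
      using A by (simp add: linear_continuous_on linear_linear)
    have "continuous_on S F" for S
      using F(1) by (simp add: linear_continuous_on linear_linear)
    then have "continuous_on S (\<lambda>y. f 0 + F y)" for S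
      by (intro continuous_on_add continuous_on_const)
    then have contf: "continuous_on S f" for S
      by (simp only: fF[symmetric])
    have compZ: "compact Z"
      unfolding Zimg by (intro compact_continuous_image Y(1) continuous_on_add continuous_on_const contA)
    have vimZ: "(\<lambda>y. \<alpha> + A y) -` Z = Y"
    proof -
      have "inj (\<lambda>y. \<alpha> + A y)"
        using injA by (simp add: inj_def)
      then show ?thesis
        unfolding Zimg by (rule inj_vimage_image_eq)
    qed
    have detA: "idx_det A \<noteq> 0"
      by (rule idx_det_nonzero[OF A injA])
    have mZ: "measure lborel Z = \<bar>idx_det A\<bar> * measure lborel Y"
      using measure_affine_vimage[OF A injA, of Z \<alpha>] compZ by (simp add: vimZ borel_compact)
    have mZ': "measure lebesgue Z = measure lborel Z"
      by (rule measure_completion) (simp add: borel_compact compZ)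
    have [measurable]: "Z \<in> sets borel" "Y \<in> sets borel"
      using compZ Y by (auto simp: borel_compact)
    have fm [measurable]: "f \<in> borel_measurable borel"
      using contf by (rule borel_measurable_continuous_onI)
    have intYf: "integrable lborel (\<lambda>y. indicator Y y *\<^sub>R k y)" if "continuous_on Y k" for k :: "real ^ 'm \<Rightarrow> 'z::euclidean_space"
      using borel_integrable_compact[OF Y(1) that] by (simp add: set_integrable_def)
    have intZ: "integrable lborel (\<lambda>z. indicator Z z *\<^sub>R f z)"
      using borel_integrable_compact[OF compZ contf] by (simp add: set_integrable_def)
    have "(\<integral>z. indicator Z z *\<^sub>R f z \<partial>lborel)
        = \<bar>idx_det A\<bar> *\<^sub>R (\<integral>y. indicator Z (\<alpha> + A y) *\<^sub>R f (\<alpha> + A y) \<partial>lborel)"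
      by (rule integral_affine_image[OF A injA]) (use borel_measurable_integrable[OF intZ] in simp)
    also have "(\<lambda>y. indicator Z (\<alpha> + A y) *\<^sub>R f (\<alpha> + A y)) = (\<lambda>y. indicator Y y *\<^sub>R c + M (indicator Y y *\<^sub>R y))"
    proof
      fix y
      have "\<alpha> + A y \<in> Z \<longleftrightarrow> y \<in> Y"
        using vimZ by blast
      then show "indicator Z (\<alpha> + A y) *\<^sub>R f (\<alpha> + A y) = indicator Y y *\<^sub>R c + M (indicator Y y *\<^sub>R y)"
        by (simp add: fB indicator_def linear_0[OF M(1)])
    qed
    also have "(\<integral>y. indicator Y y *\<^sub>R c + M (indicator Y y *\<^sub>R y) \<partial>lborel)
        = measure lborel Y *\<^sub>R c + M (\<integral>y. indicator Y y *\<^sub>R y \<partial>lborel)"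
    proof -
      have bl: "bounded_linear M"
        using M(1) by (simp add: linear_linear)
      have i1: "integrable lborel (\<lambda>y. indicator Y y *\<^sub>R c)"
        by (rule intYf) (intro continuous_intros)
      have i2: "integrable lborel (\<lambda>y. indicator Y y *\<^sub>R y)"
        by (rule intYf) (intro continuous_intros)
      have i3: "integrable lborel (\<lambda>y. M (indicator Y y *\<^sub>R y))"
        by (rule integrable_bounded_linear[OF bl i2])
      have "(\<integral>y. indicator Y y *\<^sub>R c \<partial>lborel) = measure lborel Y *\<^sub>R c"
        using fmeasurable_compact_lborel[OF Y(1)] by (simp add: fmeasurable_def)
      then show ?thesis
        using Bochner_Integration.integral_add[OF i1 i3] integral_bounded_linear[OF bl i2] by simp
    qed
    finally have I: "(\<integral>z. indicator Z z *\<^sub>R f z \<partial>lborel) = measure lborel Z *\<^sub>R (c + M ybar)"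
      using m by (simp add: mZ ybar_def linear_scale[OF M(1)] scaleR_add_right)
    have "((\<lambda>z. indicator Z z *\<^sub>R f z) has_integral measure lborel Z *\<^sub>R (c + M ybar)) UNIV"
      using has_integral_integral_lborel[OF intZ] I by simp
    moreover have "(\<lambda>z. indicator Z z *\<^sub>R f z) = (\<lambda>z. if z \<in> Z then f z else 0)"
      by (auto simp: indicator_def)
    ultimately have "(f has_integral measure lborel Z *\<^sub>R (c + M ybar)) Z"
      by (simp only: has_integral_restrict_UNIV)
    then show ?thesis
      using m detA unfolding Z_def[symmetric] mZ' by (simp add: mZ)
  qed
  show ?thesis
  proof
    assume "is_center_of_mass (?Q ` Y) x"
    then obtain f :: "real ^ 'm \<Rightarrow> 'm point" where f: "\<And>y z. dist (f y) (f z) = dist y z" "?Q ` Y \<subseteq> range f"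
      "(f has_integral measure lebesgue (f -` (?Q ` Y)) *\<^sub>R x) (f -` (?Q ` Y))"
      unfolding is_center_of_mass_def by blast
    define Z where "Z = f -` (?Q ` Y)"
    have Z: "measure lebesgue Z > 0" "(f has_integral measure lebesgue Z *\<^sub>R (c + M ybar)) Z"
      using key[OF f(1,2)] by (simp_all only: Z_def)
    have "measure lebesgue Z *\<^sub>R x = measure lebesgue Z *\<^sub>R (c + M ybar)"
      by (rule has_integral_unique[OF f(3)[folded Z_def] Z(2)])
    then show "x = c + M ybar"
      using Z(1) by simp
  next
    assume x: "x = c + M ybar"
    \<comment> \<open>For the converse some isometric parametrization must exist: the range of
      \<open>M\<close> has the dimension of V, hence is an isometric copy of it.\<close>
    have sM: "subspace (range M)"
      by (rule linear_subspace_image[OF M(1)]) simp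
    have "dim (range M) = dim (UNIV :: (real ^ 'm) set)"
      by (rule dim_image_eq[OF M(1)]) (use M(2) in \<open>auto intro: inj_on_subset\<close>)
    then have "dim (UNIV :: (real ^ 'm) set) = dim (range M)"
      by (rule sym)
    then obtain F :: "real ^ 'm \<Rightarrow> 'm point" where F: "linear F" "F ` UNIV = range M" "\<And>x. norm (F x) = norm x"
      using isometry_subspaces[OF subspace_UNIV sM, of thesis] by (metis UNIV_I)
    define f where "f z = c + F z" for z
    have iso: "dist (f y) (f z) = dist y z" for y z
      by (simp add: f_def dist_norm linear_diff[OF F(1), symmetric] F(3))
    have sub: "?Q ` Y \<subseteq> range f"
    proof
      fix q assume "q \<in> ?Q ` Y"
      then obtain y where q: "q = c + M y" by blast
      have "M y \<in> range F"
        using F(2) by simp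
      then obtain z where "M y = F z"
        by (rule rangeE)
      then show "q \<in> range f"
        by (simp add: q f_def)
    qed
    show "is_center_of_mass (?Q ` Y) x"
      unfolding is_center_of_mass_def x
      by (rule exI[of _ f]) (use iso sub key[OF iso sub] in simp)
  qed
qed

subsection \<open>Affine normals of the orbit\<close>

context orbit_domain
begin

definition pp :: "real ^ 'm \<Rightarrow> 'm point" where
  "pp u = aff_act (\<theta> u) b"

text \<open>The frame moved to the boundary point \<open>pp u\<close>, as a map from coordinates to
  directions; \<open>di u\<close> is its inverse.\<close>

definition dm :: "real ^ 'm \<Rightarrow> 'm point \<Rightarrow> 'm point" where
  "dm u x = ypart (\<theta> u *v (E x *v bh))"

definition di :: "real ^ 'm \<Rightarrow> 'm point \<Rightarrow> 'm point" where
  "di u d = crd (\<theta> (- u) *v hom_dir d)"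

text \<open>The gradient of the supporting functional at \<open>pp u\<close>; its norm converts
  Euclidean distance from the tangent hyperplane into frame height.\<close>

definition av :: "real ^ 'm \<Rightarrow> 'm point" where
  "av u = (\<chi> i. \<tau> \<bullet> (\<theta> (- u) *v hom_dir (axis i 1)))"

definition w0 :: "real ^ 'm \<Rightarrow> 'm point" where
  "w0 u = av u /\<^sub>R norm (av u)"

definition t0 :: "real ^ 'm" where
  "t0 = (\<chi> i. tr (axis i 1))"

definition \<rho> :: "real \<Rightarrow> real" where
  "\<rho> \<eta> = V \<eta> / (\<eta> * measure lborel (Y \<eta>))"

text \<open>In homogeneous coordinates this is \<open>e\<close> plus \<open>r\<close> times
  \<open>X t0\<close>, applied to the boundary point; \<open>r\<close> = 0 gives the radial
  direction.\<close>

definition dirN :: "real ^ 'm \<Rightarrow> real \<Rightarrow> 'm point" where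
  "dirN u r = dm u (join (r *\<^sub>R t0) 1)"

lemma tr_t0: "tr v = v \<bullet> t0"
  unfolding t0_def by (rule linear_functional_vec[OF linear_tr])

lemma t0_eq_0_iff: "t0 = 0 \<longleftrightarrow> (\<forall>v. tr v = 0)"
  by (metis inner_eq_zero_iff inner_zero_right tr_t0)

lemma hom_point_pp: "hom_point (pp u) = \<theta> u *v bh"
  by (simp add: pp_def hom_point_theta)

lemma frontier_pp: "frontier \<Omega> = range pp"
  by (simp add: frontier_orbit pp_def[abs_def])

lemma linear_hom_dir: "linear hom_dir"
  by (auto intro!: linearI simp: hom_dir_join vec_option_eq_iff)

lemma hom_dir_dm: "hom_dir (dm u x) = \<theta> u *v (E x *v bh)"
  unfolding dm_def by (rule hom_dir_ypart) simp

lemma di_dm [simp]: "di u (dm u x) = x"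
  by (simp add: di_def hom_dir_dm)

lemma dm_di [simp]: "dm u (di u d) = d"
proof -
  have "E (crd (\<theta> (- u) *v hom_dir d)) *v bh = \<theta> (- u) *v hom_dir d"
    by (rule E_crd) (simp add: hom_dir_join)
  then have "dm u (di u d) = ypart (hom_dir d)"
    by (simp add: dm_def di_def)
  then show ?thesis
    by (simp add: hom_dir_join)
qed

lemma linear_dm: "linear (dm u)"
  by (auto intro!: linearI simp: dm_def linear_add[OF linear_E] linear_scale[OF linear_E] mv_simps)

lemma linear_dm_join: "linear (\<lambda>y. dm u (join y 0))"
proof -
  have "linear (\<lambda>y. join y 0 :: 'm point)"
    by (auto intro!: linearI simp: vec_option_eq_iff)
  from linear_compose[OF this linear_dm[of u]] show ?thesis
    by (simp add: o_def)
qed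

lemma linear_di: "linear (di u)"
  by (auto intro!: linearI simp: di_def mv_simps linear_add[OF linear_crd] linear_scale[OF linear_crd]
      linear_add[OF linear_hom_dir] linear_scale[OF linear_hom_dir])

lemma pp_dm: "pp u + dm u x = aff_act (\<theta> u) (pt x)"
  by (simp add: pp_def aff_act_ypart hom_point_pt dm_def mv_simps)

lemma aff_act_inverse: "aff_act (\<theta> (- u)) (aff_act (\<theta> u) x) = x"
  by (simp add: aff_act_ypart[of "\<theta> (- u)"] hom_point_theta)

lemma pp_dm_in: "pp u + dm u x \<in> \<Omega> \<longleftrightarrow> x \<in> D"
  unfolding pp_dm D_def by (metis aff_act_inverse invariant mem_Collect_eq)

lemma av_inner: "av u \<bullet> d = di u d $ None"
proof -
  have "linear (\<lambda>d. \<tau> \<bullet> (\<theta> (- u) *v hom_dir d))"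
    by (auto intro!: linearI simp: mv_simps inner_simps linear_add[OF linear_hom_dir] linear_scale[OF linear_hom_dir])
  from linear_functional_vec[OF this, of d] show ?thesis
    by (simp add: av_def di_def tau_crd inner_commute)
qed

lemma av_dm: "av u \<bullet> dm u x = x $ None"
  by (simp add: av_inner)

lemma av_nonzero: "av u \<noteq> 0"
  using av_dm[of u "join 0 1"] by auto

lemma norm_av: "norm (av u) > 0"
  using av_nonzero by simp

lemma norm_w0: "norm (w0 u) = 1"
  using norm_av[of u] by (simp add: w0_def)

lemma w0_dm: "w0 u \<bullet> dm u x = x $ None / norm (av u)"
  by (simp add: w0_def av_dm divide_inverse mult.commute)

lemma w0_nonneg:
  assumes "x \<in> \<Omega>"
  shows "w0 u \<bullet> (x - pp u) \<ge> 0"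
proof -
  have "di u (x - pp u) \<in> D"
    using pp_dm_in[of u "di u (x - pp u)"] assms by simp
  then have "di u (x - pp u) $ None \<ge> 0"
    by (rule D_nonneg)
  then show ?thesis
    using w0_dm[of u "di u (x - pp u)"] norm_av[of u] by simp
qed

lemma pp_in_dom: "pp u \<in> \<Omega>"
  using frontier_subset_dom frontier_pp by blast

text \<open>The supporting functional has a minimum at \<open>pp u\<close> along every curve in the
  boundary; conversely each direction in its kernel is the velocity of a one-parameter
  subgroup.\<close>

lemma tangent_space_orbit: "tangent_space (frontier \<Omega>) (pp u) = {d. w0 u \<bullet> d = 0}"
proof safe
  fix d assume "d \<in> tangent_space (frontier \<Omega>) (pp u)"
  then obtain \<gamma> where \<gamma>: "\<gamma> 0 = pp u" "\<And>t. \<gamma> t \<in> frontier \<Omega>" "(\<gamma> has_vector_derivative d) (at (0::real))"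
    unfolding tangent_space_def by blast
  let ?f = "\<lambda>t. w0 u \<bullet> (\<gamma> t - pp u)"
  have "((\<lambda>t. \<gamma> t - pp u) has_vector_derivative d - 0) (at 0)"
    by (intro has_vector_derivative_diff \<gamma>(3) has_vector_derivative_const)
  then have "(?f has_real_derivative w0 u \<bullet> d) (at 0)"
    unfolding has_real_derivative_iff_has_vector_derivative
    using bounded_linear.has_vector_derivative[OF bounded_linear_inner_right] by fastforce
  moreover have "\<forall>y. \<bar>0 - y\<bar> < 1 \<longrightarrow> ?f 0 \<le> ?f y"
    using w0_nonneg frontier_subset_dom \<gamma> by auto
  ultimately show "w0 u \<bullet> d = 0"
    by (rule DERIV_local_min[OF _ zero_less_one])
next
  fix d assume "w0 u \<bullet> d = 0"
  then have "di u d $ None = 0"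
    using w0_dm[of u "di u d"] norm_av[of u] by simp
  then have "E (di u d) *v bh = X (ypart (di u d)) *v bh"
    by (simp add: E_mult)
  then have d: "d = ypart (\<theta> u *v (X (ypart (di u d)) *v bh))"
    using dm_di[of u d] by (simp add: dm_def)
  define y where "y = ypart (di u d)"
  let ?\<gamma> = "\<lambda>t. ypart (\<theta> (t *\<^sub>R y) *v (\<theta> u *v bh))"
  have "(?\<gamma> has_vector_derivative ypart (X y *v (\<theta> u *v bh))) (at 0)"
    using bounded_linear.has_vector_derivative[OF _ vector_derivative_0, of ypart] linear_ypart
    by (simp add: linear_linear)
  then have "(?\<gamma> has_vector_derivative d) (at 0)"
    using d by (simp add: X_theta_commute y_def)
  moreover have "?\<gamma> 0 = pp u"
    by (simp add: pp_def aff_act_ypart)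
  moreover have "?\<gamma> t \<in> frontier \<Omega>" for t
  proof -
    have "?\<gamma> t = pp (t *\<^sub>R y + u)"
      by (simp add: pp_def aff_act_ypart hom matrix_vector_mul_assoc)
    then show ?thesis
      by (simp add: frontier_pp)
  qed
  ultimately show "d \<in> tangent_space (frontier \<Omega>) (pp u)"
    unfolding tangent_space_def by (intro CollectI exI[of _ ?\<gamma>] conjI allI)
qed

text \<open>An orbit point strictly above the tangent hyperplane; it decides the sign of the inner
  unit normal.\<close>

lemma h_pos: "\<exists>v. h v > 0"
proof -
  obtain A where A: "A \<ge> 0" "\<And>v. norm v \<le> 1 \<Longrightarrow> \<bar>h v - (norm v)\<^sup>2 / 2\<bar> \<le> A * norm v ^ 3"
    using frame_bounds by metis
  define t where "t = 1 / (4 * (A + 1))"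
  have t: "0 < t" "t \<le> 1" "A * t \<le> 1 / 4"
    using A(1) by (auto simp: t_def field_simps)
  let ?v = "t *\<^sub>R axis undefined 1 :: real ^ 'm"
  have n: "norm ?v = t"
    using t by simp
  have "h ?v \<ge> t\<^sup>2 / 2 - A * t ^ 3"
    using A(2)[of ?v] t unfolding n by linarith
  moreover have "A * t ^ 3 \<le> 1 / 4 * t\<^sup>2"
    using mult_right_mono[OF t(3), of "t\<^sup>2"] by (simp add: power3_eq_cube power2_eq_square mult.assoc)
  ultimately have "h ?v \<ge> t\<^sup>2 / 4"
    by linarith
  moreover have "t\<^sup>2 > 0"
    using t by simp
  ultimately show ?thesis
    by (intro exI[of _ ?v]) linarith
qed

lemma inner_unit_normal_iff: "inner_unit_normal (frontier \<Omega>) (pp u) w \<longleftrightarrow> w = w0 u"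
proof
  assume "w = w0 u"
  then show "inner_unit_normal (frontier \<Omega>) (pp u) w"
    using norm_w0 tangent_space_orbit w0_nonneg frontier_subset_dom by (auto simp: inner_unit_normal_def)
next
  assume w: "inner_unit_normal (frontier \<Omega>) (pp u) w"
  then have n: "norm w = 1" and eq: "{d. w0 u \<bullet> d = 0} = {d. w \<bullet> d = 0}"
    and nn: "\<And>x. x \<in> frontier \<Omega> \<Longrightarrow> w \<bullet> (x - pp u) \<ge> 0"
    using tangent_space_orbit[of u] by (auto simp: inner_unit_normal_def)
  define k where "k = w0 u \<bullet> w"
  have w00: "w0 u \<bullet> w0 u = 1"
    using norm_w0[of u] by (simp add: dot_square_norm)
  have "w0 u \<bullet> (w - k *\<^sub>R w0 u) = 0"
    by (simp add: inner_diff_right k_def w00)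
  moreover from this have "w \<bullet> (w - k *\<^sub>R w0 u) = 0"
    using eq by blast
  ultimately have "(w - k *\<^sub>R w0 u) \<bullet> (w - k *\<^sub>R w0 u) = 0"
    by (simp only: inner_diff_left[of w] inner_scaleR_left)
  then have wk: "w = k *\<^sub>R w0 u"
    by simp
  obtain v where v: "h v > 0"
    using h_pos by blast
  let ?x = "crd (\<theta> v *v bh)"
  have "E ?x *v bh = \<theta> v *v bh - bh"
    using decomp[of "\<theta> v *v bh", symmetric] by (simp add: algebra_simps)
  then have "pp u + dm u ?x = pp (u + v)"
    by (simp add: pp_def dm_def aff_act_ypart mv_simps hom matrix_vector_mul_assoc)
  then have "pp (u + v) - pp u = dm u ?x"
    by (simp add: algebra_simps)
  then have pos: "w0 u \<bullet> (pp (u + v) - pp u) > 0"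
    using v norm_av[of u] by (simp add: w0_dm tau_crd[symmetric] h_def[symmetric])
  have "w \<bullet> (pp (u + v) - pp u) \<ge> 0"
    by (rule nn) (simp add: frontier_pp)
  then have "k \<ge> 0"
    using pos by (simp add: wk zero_le_mult_iff)
  moreover have "\<bar>k\<bar> = 1"
    using n norm_w0[of u] by (simp add: wk)
  ultimately show "w = w0 u"
    by (simp add: wk)
qed

text \<open>Every point of the solid section lies on a chord in one fixed direction. Just beyond an
  end of the chord the domain is left, so both ends are boundary points and the chord lies in the
  hull.\<close>

lemma section_eq:
  assumes \<delta>: "0 < \<delta>" "\<delta> * norm (av u) \<le> \<delta>\<^sub>0"
  shows "hyperplane_section (frontier \<Omega>) (pp u) (w0 u) \<delta>
    = (\<lambda>y. (pp u + dm u (join 0 (\<delta> * norm (av u)))) + dm u (join y 0)) ` Y (\<delta> * norm (av u))"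
proof -
  define \<eta> where "\<eta> = \<delta> * norm (av u)"
  define Qf where "Qf y = (pp u + dm u (join 0 \<eta>)) + dm u (join y 0)" for y
  have \<eta>: "0 < \<eta>" "\<eta> \<le> \<delta>\<^sub>0"
    using \<delta> norm_av[of u] by (auto simp: \<eta>_def)
  have Q: "Qf y = pp u + dm u (join y \<eta>)" for y
  proof -
    have "join y \<eta> = join 0 \<eta> + join y 0"
      by (simp add: vec_option_eq_iff)
    then show ?thesis
      by (simp add: Qf_def linear_add[OF linear_dm])
  qed
  note lin = linear_dm_join[of u]
  have inY: "Qf y \<in> \<Omega> \<longleftrightarrow> y \<in> Y \<eta>" for y
    by (simp only: Q pp_dm_in Y_def mem_Collect_eq)
  have onH: "w0 u \<bullet> (Qf y - pp u) = \<delta>" for y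
    using norm_av[of u] by (simp add: Q w0_dm \<eta>_def)
  let ?K = "frontier \<Omega> \<inter> {x. w0 u \<bullet> (x - pp u) = \<delta>}"
  have "convex hull ?K = Qf ` Y \<eta>"
  proof (rule subset_antisym)
    have "convex (Qf ` Y \<eta>)"
    proof -
      have "Qf ` Y \<eta> = (+) (pp u + dm u (join 0 \<eta>)) ` (\<lambda>y. dm u (join y 0)) ` Y \<eta>"
        by (auto simp: Qf_def image_image)
      moreover have "convex ((+) (pp u + dm u (join 0 \<eta>)) ` (\<lambda>y. dm u (join y 0)) ` Y \<eta>)"
        by (intro convex_translation convex_linear_image lin convex_Y)
      ultimately show ?thesis
        by (simp only:)
    qed
    moreover have "?K \<subseteq> Qf ` Y \<eta>"
    proof
      fix x assume x: "x \<in> ?K"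
      define z where "z = di u (x - pp u)"
      have xz: "x = pp u + dm u z"
        by (simp add: z_def)
      have "z $ None = \<eta>"
        using x norm_av[of u] by (simp add: xz w0_dm \<eta>_def field_simps)
      then have "x = Qf (ypart z)"
        by (metis Q join_ypart xz)
      moreover have "ypart z \<in> Y \<eta>"
        using x frontier_subset_dom calculation inY by auto
      ultimately show "x \<in> Qf ` Y \<eta>"
        by blast
    qed
    ultimately show "convex hull ?K \<subseteq> Qf ` Y \<eta>"
      by (rule hull_minimal[rotated])
    show "Qf ` Y \<eta> \<subseteq> convex hull ?K"
    proof
      fix x assume "x \<in> Qf ` Y \<eta>"
      then obtain y where y: "y \<in> Y \<eta>" "x = Qf y"
        by blast
      let ?d = "axis undefined 1 :: real ^ 'm"
      let ?l = "\<lambda>s. y + s *\<^sub>R ?d"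
      let ?F = "{s. ?l s \<in> Y \<eta>}"
      have contl: "continuous_on UNIV ?l"
        by (intro continuous_intros)
      have "closed ?F"
        using closed_vimage[OF closed_Y contl] by (simp add: vimage_def)
      moreover have "bounded ?F"
      proof -
        obtain R where R: "\<And>z. z \<in> Y \<eta> \<Longrightarrow> norm z \<le> R"
          using compact_imp_bounded[OF compact_Y[OF \<eta>(2)]] bounded_iff by metis
        have "\<bar>s\<bar> \<le> R + norm y" if "s \<in> ?F" for s
        proof -
          have "\<bar>s\<bar> = norm (?l s - y)"
            by simp
          also have "\<dots> \<le> norm (?l s) + norm y"
            by (rule norm_triangle_ineq4)
          finally show ?thesis
            using R[of "?l s"] that by simp
        qed
        then show ?thesis
          unfolding bounded_iff by auto
      qed
      ultimately have cF: "compact ?F"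
        using compact_eq_bounded_closed by blast
      have F0: "0 \<in> ?F"
        using y by simp
      obtain s2 where s2: "s2 \<in> ?F" "\<And>s. s \<in> ?F \<Longrightarrow> s \<le> s2"
        using compact_attains_sup[OF cF] F0 by blast
      obtain s1 where s1: "s1 \<in> ?F" "\<And>s. s \<in> ?F \<Longrightarrow> s1 \<le> s"
        using compact_attains_inf[OF cF] F0 by blast
      have end_pt: "Qf (?l s) \<in> ?K" if s: "s \<in> ?F" and nb: "\<And>e. e > 0 \<Longrightarrow> \<exists>s'. \<bar>s' - s\<bar> < e \<and> s' \<notin> ?F" for s
      proof -
        have "Qf (?l s) \<notin> interior \<Omega>"
        proof
          assume "Qf (?l s) \<in> interior \<Omega>"
          moreover have "continuous_on UNIV (\<lambda>s. Qf (?l s))"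
          proof -
            have "continuous_on UNIV (\<lambda>y. dm u (join y 0))"
              using lin by (simp add: linear_continuous_on linear_linear)
            from continuous_on_compose2[OF this contl] show ?thesis
              unfolding Qf_def by (intro continuous_on_add continuous_on_const) simp
          qed
          then have "open ((\<lambda>s. Qf (?l s)) -` interior \<Omega>)"
            by (intro open_vimage) auto
          ultimately obtain e where e: "e > 0" "\<And>s'. dist s' s < e \<Longrightarrow> Qf (?l s') \<in> interior \<Omega>"
            unfolding open_dist by blast
          obtain s' where "\<bar>s' - s\<bar> < e" "s' \<notin> ?F"
            using nb[OF e(1)] by blast
          moreover have "Qf (?l s') \<in> \<Omega>"
            using e(2)[of s'] \<open>\<bar>s' - s\<bar> < e\<close> interior_subset by (auto simp: dist_real_def)
          ultimately show False
            using inY[of "?l s'"] by simp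
        qed
        moreover have "Qf (?l s) \<in> \<Omega>"
          using inY[of "?l s"] s by simp
        ultimately have "Qf (?l s) \<in> frontier \<Omega>"
          using closed_dom by (simp add: frontier_def)
        then show ?thesis
          using onH[of "?l s"] by simp
      qed
      have "Qf (?l s2) \<in> ?K"
      proof (rule end_pt[OF s2(1)])
        show "\<exists>s'. \<bar>s' - s2\<bar> < e \<and> s' \<notin> ?F" if "e > 0" for e
          using s2(2)[of "s2 + e / 2"] that by (intro exI[of _ "s2 + e / 2"]) auto
      qed
      moreover have "Qf (?l s1) \<in> ?K"
      proof (rule end_pt[OF s1(1)])
        show "\<exists>s'. \<bar>s' - s1\<bar> < e \<and> s' \<notin> ?F" if "e > 0" for e
          using s1(2)[of "s1 - e / 2"] that by (intro exI[of _ "s1 - e / 2"]) auto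
      qed
      ultimately have hull: "closed_segment (Qf (?l s1)) (Qf (?l s2)) \<subseteq> convex hull ?K"
        by (intro closed_segment_subset convex_convex_hull) (auto intro: hull_inc)
      have s12: "s1 \<le> 0" "0 \<le> s2"
        using s1(2)[OF F0] s2(2)[OF F0] by auto
      \<comment> \<open>Solves (1 - l) s1 + l s2 = 0. If s1 = s2, then s1 \<le> 0 \<le> s2 makes
        both zero.\<close>
      define l where "l = (if s1 = s2 then 0 else - s1 / (s2 - s1))"
      have l: "0 \<le> l" "l \<le> 1" "(1 - l) * s1 + l * s2 = 0"
        using s12 by (auto simp: l_def divide_simps algebra_simps)
      have "x = (1 - l) *\<^sub>R Qf (?l s1) + l *\<^sub>R Qf (?l s2)"
      proof -
        let ?c = "pp u + dm u (join 0 \<eta>)" and ?M = "\<lambda>y. dm u (join y 0)"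
        have "(1 - l) *\<^sub>R Qf (?l s1) + l *\<^sub>R Qf (?l s2) = ?c + ?M ((1 - l) *\<^sub>R ?l s1 + l *\<^sub>R ?l s2)"
          by (simp add: Qf_def linear_add[OF lin] linear_scale[OF lin] linear_diff[OF lin] algebra_simps)
        also have "(1 - l) *\<^sub>R ?l s1 + l *\<^sub>R ?l s2 = y + ((1 - l) * s1 + l * s2) *\<^sub>R ?d"
          by (simp add: algebra_simps)
        finally show ?thesis
          using l(3) y by (simp add: Qf_def)
      qed
      then have "x \<in> closed_segment (Qf (?l s1)) (Qf (?l s2))"
        using l by (auto simp: in_segment)
      then show "x \<in> convex hull ?K"
        using hull by blast
    qed
  qed
  then show ?thesis
    by (simp only: hyperplane_section_def \<eta>_def Qf_def[abs_def])
qed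

lemma section_centroid:
  assumes "0 < \<eta>" "\<eta> \<le> \<delta>\<^sub>0"
  shows "(\<integral>y. indicator (Y \<eta>) y *\<^sub>R y \<partial>lborel) /\<^sub>R measure lborel (Y \<eta>) = (\<eta> * \<rho> \<eta>) *\<^sub>R t0"
proof -
  let ?I = "\<integral>y. indicator (Y \<eta>) y *\<^sub>R y \<partial>lborel"
  have int: "integrable lborel (\<lambda>y. indicator (Y \<eta>) y *\<^sub>R y)"
    using borel_integrable_compact[OF compact_Y[OF assms(2)], of "\<lambda>y. y"] by (simp add: set_integrable_def)
  have "v \<bullet> ?I = v \<bullet> (V \<eta> *\<^sub>R t0)" for v
  proof -
    have "v \<bullet> ?I = (\<integral>y. v \<bullet> (indicator (Y \<eta>) y *\<^sub>R y) \<partial>lborel)"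
      by (rule integral_inner_right[OF int, symmetric])
    also have "\<dots> = (\<integral>y. indicator (Y \<eta>) y * (v \<bullet> y) \<partial>lborel)"
      by simp
    also have "\<dots> = tr v * V \<eta>"
      by (rule section_moment[OF assms])
    finally show ?thesis
      by (simp add: tr_t0)
  qed
  then have "?I = V \<eta> *\<^sub>R t0"
    by (metis vector_eq_ldot)
  then show ?thesis
    using assms(1) measure_Y_pos[OF assms] by (simp add: \<rho>_def divide_inverse)
qed

lemma rho_bounds:
  assumes "0 < \<eta>" "\<eta> \<le> \<delta>\<^sub>0"
  shows "(3 / 8) ^ CARD('m) / 2 \<le> \<rho> \<eta>" "\<rho> \<eta> \<le> 15 / 16"
  using V_lower[OF assms] V_upper[OF assms] measure_Y_pos[OF assms] assms(1)
  by (simp_all add: \<rho>_def pos_le_divide_eq pos_divide_le_eq mult_ac)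

lemma center_of_mass_section:
  assumes \<delta>: "0 < \<delta>" "\<delta> * norm (av u) \<le> \<delta>\<^sub>0"
  shows "is_center_of_mass (hyperplane_section (frontier \<Omega>) (pp u) (w0 u) \<delta>) x
    \<longleftrightarrow> x = pp u + (\<delta> * norm (av u)) *\<^sub>R dirN u (\<rho> (\<delta> * norm (av u)))"
proof -
  define \<eta> where "\<eta> = \<delta> * norm (av u)"
  have \<eta>: "0 < \<eta>" "\<eta> \<le> \<delta>\<^sub>0"
    using \<delta> norm_av[of u] by (auto simp: \<eta>_def)
  note lin = linear_dm_join[of u]
  have inj: "inj (\<lambda>y. dm u (join y 0))"
    by (rule injI) (metis di_dm ypart_join)
  have int: "interior (Y \<eta>) \<noteq> {}"
  proof -
    have "ball 0 (sqrt (7 / 5 * \<eta>)) \<subseteq> interior (Y \<eta>)"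
      using cball_subset_Y[OF \<eta>] by (intro interior_maximal) auto
    moreover have "0 \<in> ball (0 :: real ^ 'm) (sqrt (7 / 5 * \<eta>))"
      using \<eta> by simp
    ultimately show ?thesis by blast
  qed
  have "dm u (join 0 \<eta>) + dm u (join ((\<eta> * \<rho> \<eta>) *\<^sub>R t0) 0) = \<eta> *\<^sub>R dirN u (\<rho> \<eta>)"
  proof -
    have "join 0 \<eta> + join ((\<eta> * \<rho> \<eta>) *\<^sub>R t0) 0 = \<eta> *\<^sub>R join (\<rho> \<eta> *\<^sub>R t0) 1"
      by (simp add: vec_option_eq_iff)
    then show ?thesis
      unfolding dirN_def by (metis linear_add[OF linear_dm] linear_scale[OF linear_dm])
  qed
  then show ?thesis
    unfolding section_eq[OF \<delta>] \<eta>_def[symmetric]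
      center_of_mass_affine_image[OF lin inj compact_Y[OF \<eta>(2)] int measure_Y_pos[OF \<eta>]] section_centroid[OF \<eta>]
    by (simp add: add.assoc)
qed

lemma eventually_small: "r > 0 \<Longrightarrow> \<forall>\<^sub>F \<delta> in at_right 0. 0 < \<delta> \<and> \<delta> * norm (av u) \<le> r"
  unfolding eventually_at_right_field
  by (rule exI[of _ "r / norm (av u)"]) (use norm_av[of u] in \<open>auto simp: field_simps\<close>)

text \<open>The assumed affine normal makes the normalized centroids converge; for nonzero
  \<open>t0\<close> this forces \<rho> itself to converge. Recording that limit shows later that
  \<open>r\<close> is the same at all boundary points.\<close>

lemma affine_normal_orbitD:
  assumes "affine_normal (frontier \<Omega>) (pp u) \<nu>"
  obtains k r where "k \<noteq> 0" "\<nu> = k *\<^sub>R dirN u r" "(3 / 8) ^ CARD('m) / 2 \<le> r" "r \<le> 15 / 16"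
    "t0 \<noteq> 0 \<Longrightarrow> (\<rho> \<longlongrightarrow> r) (at_right 0)"
proof -
  obtain w x k where w: "inner_unit_normal (frontier \<Omega>) (pp u) w"
    and com: "\<forall>\<^sub>F \<delta> in at_right 0. is_center_of_mass (hyperplane_section (frontier \<Omega>) (pp u) w \<delta>) (x \<delta>)"
    and k: "k \<noteq> 0" and lim: "((\<lambda>\<delta>. (x \<delta> - pp u) /\<^sub>R \<delta>) \<longlongrightarrow> k *\<^sub>R \<nu>) (at_right (0::real))"
    using assms unfolding affine_normal_def by blast
  have w: "w = w0 u"
    using w inner_unit_normal_iff by blast
  let ?n = "norm (av u)"
  have n: "?n > 0"
    by (rule norm_av)
  have small: "\<forall>\<^sub>F \<delta> in at_right 0. 0 < \<delta> \<and> \<delta> * ?n \<le> \<delta>\<^sub>0"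
    by (rule eventually_small[OF delta0(1)])
  have "\<forall>\<^sub>F \<delta> in at_right 0. (x \<delta> - pp u) /\<^sub>R \<delta> = ?n *\<^sub>R dirN u (\<rho> (\<delta> * ?n))"
    using com small
  proof eventually_elim
    case (elim \<delta>)
    then have "x \<delta> = pp u + (\<delta> * ?n) *\<^sub>R dirN u (\<rho> (\<delta> * ?n))"
      using center_of_mass_section[of \<delta> u "x \<delta>"] unfolding w by blast
    then show ?case
      using elim(2) by simp
  qed
  with lim have lim2: "((\<lambda>\<delta>. ?n *\<^sub>R dirN u (\<rho> (\<delta> * ?n))) \<longlongrightarrow> k *\<^sub>R \<nu>) (at_right 0)"
    by (rule Lim_transform_eventually)
  show thesis
  proof (cases "t0 = 0")
    case True
    then have dN: "dirN u r = dirN u 0" for r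
      by (simp add: dirN_def)
    have "((\<lambda>\<delta>::real. ?n *\<^sub>R dirN u 0) \<longlongrightarrow> k *\<^sub>R \<nu>) (at_right 0)"
      using lim2 unfolding dN[of "\<rho> _"] .
    then have "?n *\<^sub>R dirN u 0 = k *\<^sub>R \<nu>"
      by (simp add: tendsto_const_iff)
    then have "(1 / k) *\<^sub>R (?n *\<^sub>R dirN u 0) = (1 / k) *\<^sub>R (k *\<^sub>R \<nu>)"
      by simp
    then have "\<nu> = (?n / k) *\<^sub>R dirN u 0"
      using k by simp
    \<comment> \<open>As \<open>t0\<close> vanishes, \<open>dirN\<close> does not depend on its
      second argument; any value within the bounds will do.\<close>
    then have "\<nu> = (?n / k) *\<^sub>R dirN u (15 / 16)"
      unfolding dN[of "15 / 16"] .
    moreover have "(3 / 8 :: real) ^ CARD('m) / 2 \<le> 15 / 16"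
      using power_le_one[of "3 / 8 :: real" "CARD('m)"] by simp
    ultimately show thesis
      using that[of "?n / k" "15 / 16"] n k True by simp
  next
    case False
    \<comment> \<open>Pairing the tangential coordinates with \<open>t0\<close> isolates
      \<rho>.\<close>
    have "continuous_on UNIV (\<lambda>d. t0 \<bullet> ypart (di u d))"
      using linear_compose[OF linear_di linear_ypart, of u]
      by (intro continuous_intros linear_continuous_on) (simp add: linear_linear o_def)
    then have "isCont (\<lambda>d. t0 \<bullet> ypart (di u d)) (k *\<^sub>R \<nu>)"
      by (simp add: continuous_on_eq_continuous_at)
    from isCont_tendsto_compose[OF this lim2]
    have "((\<lambda>\<delta>. ?n * (\<rho> (\<delta> * ?n) * (t0 \<bullet> t0))) \<longlongrightarrow> t0 \<bullet> ypart (di u (k *\<^sub>R \<nu>))) (at_right 0)"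
      by (simp add: dirN_def linear_scale[OF linear_di] mult.assoc)
    then have "((\<lambda>\<delta>. ?n * (\<rho> (\<delta> * ?n) * (t0 \<bullet> t0)) / (?n * (t0 \<bullet> t0))) \<longlongrightarrow>
        t0 \<bullet> ypart (di u (k *\<^sub>R \<nu>)) / (?n * (t0 \<bullet> t0))) (at_right 0)"
      using n False by (intro tendsto_intros) auto
    moreover have "?n * (c * (t0 \<bullet> t0)) / (?n * (t0 \<bullet> t0)) = c" for c
      using n False by simp
    ultimately obtain r where r: "((\<lambda>\<delta>. \<rho> (\<delta> * ?n)) \<longlongrightarrow> r) (at_right 0)"
      by auto
    have "((\<lambda>\<delta>. ?n *\<^sub>R dirN u (\<rho> (\<delta> * ?n))) \<longlongrightarrow> ?n *\<^sub>R dirN u r) (at_right 0)"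
    proof -
      have "dirN u s = dm u (join 0 1) + s *\<^sub>R dm u (join t0 0)" for s
      proof -
        have "join (s *\<^sub>R t0) 1 = join 0 1 + s *\<^sub>R join t0 0"
          by (simp add: vec_option_eq_iff)
        then show ?thesis
          by (simp add: dirN_def linear_add[OF linear_dm] linear_scale[OF linear_dm])
      qed
      then show ?thesis
        using r by (auto intro!: tendsto_intros)
    qed
    from tendsto_unique[OF _ lim2 this] have "k *\<^sub>R \<nu> = ?n *\<^sub>R dirN u r"
      by simp
    then have "(1 / k) *\<^sub>R (k *\<^sub>R \<nu>) = (1 / k) *\<^sub>R (?n *\<^sub>R dirN u r)"
      by simp
    then have \<nu>: "\<nu> = (?n / k) *\<^sub>R dirN u r"
      using k by simp
    have "\<forall>\<^sub>F \<delta> in at_right 0. (3 / 8) ^ CARD('m) / 2 \<le> \<rho> (\<delta> * ?n) \<and> \<rho> (\<delta> * ?n) \<le> 15 / 16"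
      using small
    proof eventually_elim
      case (elim \<delta>)
      then show ?case
        using rho_bounds[of "\<delta> * ?n"] n by simp
    qed
    then have ev1: "\<forall>\<^sub>F \<delta> in at_right 0. (3 / 8) ^ CARD('m) / 2 \<le> \<rho> (\<delta> * ?n)"
      and ev2: "\<forall>\<^sub>F \<delta> in at_right 0. \<rho> (\<delta> * ?n) \<le> 15 / 16"
      by (auto elim!: eventually_mono)
    have b1: "(3 / 8) ^ CARD('m) / 2 \<le> r"
      by (rule tendsto_lowerbound[OF r ev1]) simp
    have b2: "r \<le> 15 / 16"
      by (rule tendsto_upperbound[OF r ev2]) simp
    \<comment> \<open>Rescaling \<delta> removes the dependence of the limit on the boundary
      point.\<close>
    have "((\<lambda>\<delta>. \<rho> ((\<delta> / ?n) * ?n)) \<longlongrightarrow> r) (at_right 0)"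
    proof (rule filterlim_compose[OF r])
      show "filterlim (\<lambda>\<delta>. \<delta> / ?n) (at_right 0) (at_right 0)"
        unfolding filterlim_at
      proof
        have "((\<lambda>\<delta>. \<delta> / ?n) \<longlongrightarrow> 0 / ?n) (at_right 0)"
          using n by (intro tendsto_intros) auto
        then show "((\<lambda>\<delta>. \<delta> / ?n) \<longlongrightarrow> 0) (at_right 0)"
          by simp
        show "\<forall>\<^sub>F \<delta> in at_right 0. \<delta> / ?n \<in> {0<..} \<and> \<delta> / ?n \<noteq> 0"
          using n by (auto simp: eventually_at_right_field intro!: exI[of _ 1])
      qed
    qed
    then have "(\<rho> \<longlongrightarrow> r) (at_right 0)"
      using n by simp
    then show thesis
      using that[OF _ \<nu> b1 b2] n k by simp
  qed
qed

lemma affine_normal_orbitI: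
  assumes "t0 = 0"
  shows "affine_normal (frontier \<Omega>) (pp u) (dirN u 0)"
proof -
  let ?n = "norm (av u)"
  have n: "?n > 0"
    by (rule norm_av)
  have w0N: "w0 u \<bullet> dirN u 0 > 0"
    using n by (simp add: dirN_def w0_dm)
  then have nz: "dirN u 0 \<noteq> 0"
    by auto
  have iun: "inner_unit_normal (frontier \<Omega>) (pp u) (w0 u)"
    using inner_unit_normal_iff by blast
  define x where "x \<delta> = pp u + (\<delta> * ?n) *\<^sub>R dirN u 0" for \<delta>
  have dN: "dirN u r = dirN u 0" for r
    using assms by (simp add: dirN_def)
  have com: "\<forall>\<^sub>F \<delta> in at_right 0. is_center_of_mass (hyperplane_section (frontier \<Omega>) (pp u) (w0 u) \<delta>) (x \<delta>)"
    using eventually_small[OF delta0(1), of u]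
  proof eventually_elim
    case (elim \<delta>)
    then show ?case
      using center_of_mass_section[of \<delta> u "x \<delta>"] dN[of "\<rho> (\<delta> * ?n)"] by (simp add: x_def)
  qed
  have lim: "((\<lambda>\<delta>. (x \<delta> - pp u) /\<^sub>R \<delta>) \<longlongrightarrow> ?n *\<^sub>R dirN u 0) (at_right 0)"
  proof (rule Lim_transform_eventually[OF tendsto_const])
    show "\<forall>\<^sub>F \<delta> in at_right 0. ?n *\<^sub>R dirN u 0 = (x \<delta> - pp u) /\<^sub>R \<delta>"
      unfolding eventually_at_right_field by (rule exI[of _ 1]) (simp add: x_def)
  qed
  show ?thesis
    unfolding affine_normal_def
    by (intro conjI exI[of _ "w0 u"] exI[of _ x] exI[of _ ?n] nz iun w0N com lim) (use n in simp)
qed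

end

section \<open>Affine spheres and flow lines in terms of the trace vector\<close>

context orbit_domain
begin

lemma hom_dir_dirN: "hom_dir (dirN u r) = e *v (\<theta> u *v bh) + r *\<^sub>R (X t0 *v (\<theta> u *v bh))"
  by (simp add: dirN_def hom_dir_dm E_mult X_scaleR mv_simps e_theta_commute X_theta_commute add.commute)

lemma linear_tau_derivative:
  assumes "\<And>t. \<tau> \<bullet> (A *v (\<theta> (t *\<^sub>R v) *v z)) = \<tau> \<bullet> (\<theta> (t *\<^sub>R v) *v z) * c"
  shows "\<tau> \<bullet> (A *v (X v *v z)) = \<tau> \<bullet> (X v *v z) * c"
proof -
  have "((\<lambda>t. \<tau> \<bullet> (A *v (\<theta> (t *\<^sub>R v) *v z))) has_vector_derivative \<tau> \<bullet> (A *v (X v *v z))) (at 0)"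
    by (rule bounded_linear.has_vector_derivative[OF bounded_linear_compose[OF bounded_linear_inner_right
          bounded_bilinear.bounded_linear_right[OF bounded_bilinear_matrix_vector_mult]] vector_derivative_0])
  moreover have "((\<lambda>t. \<tau> \<bullet> (\<theta> (t *\<^sub>R v) *v z) * c) has_vector_derivative \<tau> \<bullet> (X v *v z) * c) (at 0)"
    by (rule bounded_linear.has_vector_derivative[OF bounded_linear_compose[OF bounded_linear_mult_left
          bounded_linear_inner_right] vector_derivative_0])
  ultimately show ?thesis
    unfolding assms by (rule vector_derivative_unique_at)
qed

text \<open>If \<open>t0 \<noteq> 0\<close>, then the affine normal \<open>N = e + X w\<close> would be a common eigenvector of all \<open>X v\<close>,
  and comparing traces gives \<open>\<kappa> m + \<bar>w\<bar>\<^sup>2 / r = \<bar>w\<bar>\<^sup>2\<close> with \<open>r < 1\<close>.\<close>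

lemma affine_sphere_imp_t0:
  assumes "affine_sphere (frontier \<Omega>)"
  shows "t0 = 0"
proof (rule ccontr)
  assume t0: "t0 \<noteq> 0"
  obtain z where z: "z \<noteq> 0" "\<And>p. p \<in> frontier \<Omega> \<Longrightarrow>
      \<exists>\<nu>. affine_normal (frontier \<Omega>) p \<nu> \<and> z \<in> span {hom_point p, hom_dir \<nu>}"
    using assms unfolding affine_sphere_def by blast
  have ex: "\<exists>k r. (3 / 8) ^ CARD('m) / 2 \<le> r \<and> r \<le> 15 / 16 \<and> (\<rho> \<longlongrightarrow> r) (at_right 0) \<and>
      z \<in> span {\<theta> u *v bh, k *\<^sub>R hom_dir (dirN u r)}" for u
  proof -
    have "pp u \<in> frontier \<Omega>"
      by (simp add: frontier_pp)
    then obtain \<nu> where \<nu>: "affine_normal (frontier \<Omega>) (pp u) \<nu>" "z \<in> span {hom_point (pp u), hom_dir \<nu>}"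
      using z(2) by blast
    obtain k r where kr: "\<nu> = k *\<^sub>R dirN u r" "(3 / 8) ^ CARD('m) / 2 \<le> r" "r \<le> 15 / 16"
      "t0 \<noteq> 0 \<Longrightarrow> (\<rho> \<longlongrightarrow> r) (at_right 0)"
      using affine_normal_orbitD[OF \<nu>(1)] by blast
    show ?thesis
      using \<nu>(2) kr t0 by (intro exI[of _ k] exI[of _ r]) (simp add: hom_point_pp linear_scale[OF linear_hom_dir])
  qed
  obtain r where r: "(3 / 8) ^ CARD('m) / 2 \<le> r" "r \<le> 15 / 16" "(\<rho> \<longlongrightarrow> r) (at_right 0)"
    using ex[of 0] by blast
  have r0: "r > 0"
  proof -
    have "(0::real) < (3 / 8) ^ CARD('m) / 2"
      by simp
    then show ?thesis
      using r(1) by linarith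
  qed
  define w where "w = r *\<^sub>R t0"
  define N where "N = e *v bh + X w *v bh"
  \<comment> \<open>The normal at \<open>pp (- u)\<close> is a multiple of the translate of
    \<open>N\<close>, with the same \<open>r\<close> everywhere. Moving \<open>z\<close> back by
    \<open>\<theta> u\<close> therefore always lands in the plane of \<open>bh\<close> and
    \<open>N\<close>.\<close>
  have zN: "\<exists>\<alpha> \<gamma>. \<theta> u *v z = \<alpha> *\<^sub>R bh + \<gamma> *\<^sub>R N" for u
  proof -
    obtain k r' where kr: "(\<rho> \<longlongrightarrow> r') (at_right 0)" "z \<in> span {\<theta> (- u) *v bh, k *\<^sub>R hom_dir (dirN (- u) r')}"
      using ex[of "- u"] by blast
    have "r' = r"
      using tendsto_unique[OF _ kr(1) r(3)] by simp
    then obtain \<alpha> \<beta> where "z = \<alpha> *\<^sub>R (\<theta> (- u) *v bh) + \<beta> *\<^sub>R (k *\<^sub>R hom_dir (dirN (- u) r))"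
      using kr(2) by (auto simp: span_insert span_singleton algebra_simps)
    also have "hom_dir (dirN (- u) r) = \<theta> (- u) *v N"
      by (simp add: hom_dir_dirN N_def w_def X_scaleR mv_simps e_theta_commute X_theta_commute)
    finally have "\<theta> u *v z = \<alpha> *\<^sub>R bh + (\<beta> * k) *\<^sub>R N"
      by (simp add: mv_simps)
    then show ?thesis by blast
  qed
  have tauN: "\<tau> \<bullet> N = 1" "\<tau> \<bullet> (X v *v N) = v \<bullet> w" for v
    by (simp_all add: N_def inner_simps mv_simps)
  \<comment> \<open>On that plane the functional \<tau> X v equals (v \<bullet> w) \<tau>; both
    vanish at \<open>bh\<close>. Differentiating along the orbit gives \<open>B\<close> and
    \<open>C\<close>.\<close>
  have A: "\<tau> \<bullet> (X v *v (\<theta> u *v z)) = \<tau> \<bullet> (\<theta> u *v z) * (v \<bullet> w)" for u v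
  proof -
    obtain \<alpha> \<gamma> where "\<theta> u *v z = \<alpha> *\<^sub>R bh + \<gamma> *\<^sub>R N"
      using zN by blast
    then show ?thesis
      by (simp add: mv_simps inner_simps tauN)
  qed
  have B: "\<tau> \<bullet> (X v *v (X v' *v (\<theta> u *v z))) = \<tau> \<bullet> (X v' *v (\<theta> u *v z)) * (v \<bullet> w)" for u v v'
  proof (rule linear_tau_derivative)
    fix t
    show "\<tau> \<bullet> (X v *v (\<theta> (t *\<^sub>R v') *v (\<theta> u *v z))) = \<tau> \<bullet> (\<theta> (t *\<^sub>R v') *v (\<theta> u *v z)) * (v \<bullet> w)"
      using A[of v "t *\<^sub>R v' + u"] by (simp add: hom matrix_vector_mul_assoc[symmetric])
  qed
  have C: "\<tau> \<bullet> (X v *v (X v' *v (X v'' *v z))) = \<tau> \<bullet> (X v' *v (X v'' *v z)) * (v \<bullet> w)" for v v' v''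
  proof -
    have "\<tau> \<bullet> (X v *v (X v'' *v (X v' *v z))) = \<tau> \<bullet> (X v'' *v (X v' *v z)) * (v \<bullet> w)"
      by (rule linear_tau_derivative) (metis B X_theta_commute)
    then show ?thesis
      by (simp add: X_commute[of v'' v'])
  qed
  obtain \<alpha> \<gamma> where z0: "z = \<alpha> *\<^sub>R bh + \<gamma> *\<^sub>R N"
    using zN[of 0] by auto
  have Bz: "\<tau> \<bullet> (X v *v (X v' *v z)) = \<tau> \<bullet> (X v' *v z) * (v \<bullet> w)" for v v'
    using B[of v v' 0] by simp
  have g: "\<tau> \<bullet> (X v *v z) = \<gamma> * (v \<bullet> w)" for v
    by (simp add: z0 mv_simps inner_simps tauN)
  have "\<gamma> \<noteq> 0"
  proof
    assume "\<gamma> = 0"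
    then have "\<tau> \<bullet> (X (axis undefined 1) *v (X (axis undefined 1) *v z)) = \<alpha>"
      by (simp add: z0 mv_simps inner_axis)
    moreover have "\<tau> \<bullet> (X (axis undefined 1) *v (X (axis undefined 1) *v z)) = 0"
      using Bz g \<open>\<gamma> = 0\<close> by simp
    ultimately show False
      using z0 z(1) \<open>\<gamma> = 0\<close> by simp
  qed
  have ww: "w \<bullet> w > 0"
    using t0 r0 by (simp add: w_def)
  \<comment> \<open>By \<open>Bz\<close> the vector X w z has coordinates proportional to those of
    \<open>N\<close>, so the third-order identity \<open>C\<close> becomes one of second order for
    \<open>N\<close>.\<close>
  have XwN: "X w *v z = (\<gamma> * (w \<bullet> w)) *\<^sub>R N"
  proof -
    have "crd (X w *v z) = (\<gamma> * (w \<bullet> w)) *\<^sub>R join w 1"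
      by (simp add: crd_def vec_option_eq_iff Bz g inner_axis')
    then have "E (crd (X w *v z)) *v bh = (\<gamma> * (w \<bullet> w)) *\<^sub>R N"
      by (simp add: linear_scale[OF linear_E] mv_simps E_mult N_def add.commute)
    then show ?thesis
      by (simp add: E_crd)
  qed
  have "\<tau> \<bullet> (X v *v (X v' *v N)) = (v' \<bullet> w) * (v \<bullet> w)" for v v'
  proof -
    have "(\<gamma> * (w \<bullet> w)) * (\<tau> \<bullet> (X v *v (X v' *v N))) = (\<gamma> * (w \<bullet> w)) * ((v' \<bullet> w) * (v \<bullet> w))"
      using C[of v v' w] by (simp add: XwN mv_simps tauN mult_ac)
    then show ?thesis
      using \<open>\<gamma> \<noteq> 0\<close> ww by (simp only: mult_cancel_left) simp
  qed
  then have "(\<Sum>i\<in>UNIV. \<tau> \<bullet> (X (axis i 1) *v (X (axis i 1) *v N))) = (\<Sum>i\<in>UNIV. w $ i * w $ i)"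
    by (simp add: inner_axis')
  also have "\<dots> = w \<bullet> w"
    by (simp add: inner_vec_def)
  also have "(\<Sum>i\<in>UNIV. \<tau> \<bullet> (X (axis i 1) *v (X (axis i 1) *v N))) = \<kappa> * real CARD('m) + tr w"
    by (simp add: N_def mv_simps inner_simps X_e sum.distrib tr_def inner_axis_axis)
  finally have eq: "\<kappa> * real CARD('m) + tr w = w \<bullet> w" .
  have "\<kappa> * real CARD('m) \<ge> 0"
    using kappa_nonneg by simp
  then have "tr w \<le> w \<bullet> w"
    using eq by linarith
  then have "r * (t0 \<bullet> t0) \<le> r * (r * (t0 \<bullet> t0))"
    by (simp add: tr_t0 w_def)
  then have "1 * (t0 \<bullet> t0) \<le> r * (t0 \<bullet> t0)"
    using r0 by simp
  moreover have "t0 \<bullet> t0 > 0"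
    using t0 by simp
  ultimately have "1 \<le> r"
    using mult_le_cancel_right_pos by blast
  then show False
    using r(2) by simp
qed

text \<open>The orbit invariant e b - \<kappa> b lies on every radial line. It is a point at
  infinity if \<kappa> = 0 and represents the fixed point otherwise.\<close>

lemma affine_sphere_if_t0:
  assumes "t0 = 0"
  shows "affine_sphere (frontier \<Omega>)"
proof -
  define z where "z = e *v bh - \<kappa> *\<^sub>R bh"
  have "\<tau> \<bullet> z = 1"
    by (simp add: z_def inner_simps)
  then have "z \<noteq> 0"
    by auto
  moreover have "\<exists>\<nu>. affine_normal (frontier \<Omega>) p \<nu> \<and> z \<in> span {hom_point p, hom_dir \<nu>}" if "p \<in> frontier \<Omega>" for p
  proof -
    obtain u where p: "p = pp u"
      using \<open>p \<in> frontier \<Omega>\<close> frontier_pp by blast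
    have "z = hom_dir (dirN u 0) - \<kappa> *\<^sub>R hom_point p"
      by (simp add: z_def p hom_point_pp hom_dir_dirN e_theta algebra_simps)
    also have "\<dots> \<in> span {hom_point p, hom_dir (dirN u 0)}"
      by (intro span_diff span_scale span_base) auto
    finally show ?thesis
      using affine_normal_orbitI[OF assms, of u] p by blast
  qed
  ultimately show ?thesis
    unfolding affine_sphere_def by blast
qed

lemma fixed_point_unique:
  assumes "\<And>v. aff_act (\<theta> v) C = C"
  shows "\<kappa> \<noteq> 0" "hom_point C = bh - (1 / \<kappa>) *\<^sub>R (e *v bh)"
proof -
  let ?C = "hom_point C"
  have fix_th: "\<theta> v *v ?C = ?C" for v
    using hom_point_theta[of v C] assms by simp
  have XC: "X v *v ?C = 0" for v
  proof -
    have "((\<lambda>t::real. ?C) has_vector_derivative X v *v ?C) (at 0)"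
      using vector_derivative_0[of v ?C] by (simp add: fix_th)
    from vector_derivative_unique_at[OF this has_vector_derivative_const] show ?thesis .
  qed
  define s where "s = crd ?C $ None"
  have "ypart (crd ?C) \<bullet> ypart (crd ?C) = 0"
    using tau_X_crd[of "ypart (crd ?C)" ?C] by (simp add: XC)
  then have y0: "ypart (crd ?C) = 0"
    by simp
  have C: "?C = bh + s *\<^sub>R (e *v bh)"
    using decomp[of ?C] by (simp add: E_mult y0 s_def)
  have "X unit_dir *v (bh + s *\<^sub>R (e *v bh)) = (1 + s * \<kappa>) *\<^sub>R (X unit_dir *v bh)"
    by (simp add: mv_simps X_e algebra_simps)
  then have "(1 + s * \<kappa>) *\<^sub>R (X unit_dir *v bh) = 0"
    using XC[of unit_dir] C by simp
  then have "\<tau> \<bullet> (X unit_dir *v ((1 + s * \<kappa>) *\<^sub>R (X unit_dir *v bh))) = 0"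
    by (simp only:) simp
  then have sk: "1 + s * \<kappa> = 0"
    by (simp add: mv_simps unit_dir_def inner_axis)
  then show "\<kappa> \<noteq> 0"
    by auto
  with sk have "s = - (1 / \<kappa>)"
    by (simp add: field_simps add_eq_0_iff)
  then show "?C = bh - (1 / \<kappa>) *\<^sub>R (e *v bh)"
    by (simp add: C)
qed

text \<open>The radial flow for T = \<open>range \<theta>\<close>. It depends on
  \<open>\<theta>\<close> alone, so that one flow qualifies for the domains of all horospheres at
  once.\<close>

definition radial :: "(real \<Rightarrow> 'm point \<Rightarrow> 'm point) \<Rightarrow> bool" where
  "radial \<Phi> \<longleftrightarrow>
     (if \<exists>C. \<forall>v. aff_act (\<theta> v) C = C
      then \<exists>C. (\<forall>v. aff_act (\<theta> v) C = C) \<and> \<Phi> = (\<lambda>t x. exp (- t) *\<^sub>R (x - C) + C)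
      else \<exists>u. u \<noteq> 0 \<and> {w. \<forall>v. \<theta> v *v hom_dir w = hom_dir w} = span {u} \<and>
             \<Phi> = (\<lambda>t x. x + t *\<^sub>R u))"

text \<open>If there is a fixed point, the vector from \<open>p\<close> to it is a multiple of e p;
  otherwise \<kappa> = 0 and e b itself is the invariant direction.\<close>

lemma radial_derivative:
  assumes "radial \<Phi>"
  shows "\<exists>k. k \<noteq> 0 \<and> ((\<lambda>t. \<Phi> t (pp u)) has_vector_derivative k *\<^sub>R dirN u 0) (at 0)"
proof (cases "\<exists>C. \<forall>v. aff_act (\<theta> v) C = C")
  case True
  then obtain C where C: "\<And>v. aff_act (\<theta> v) C = C" and \<Phi>: "\<Phi> = (\<lambda>t x. exp (- t) *\<^sub>R (x - C) + C)"
    using assms unfolding radial_def by auto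
  note k = fixed_point_unique[OF C]
  have "hom_point C = \<theta> u *v hom_point C"
    using hom_point_theta[of u C] C by simp
  also have "\<dots> = \<theta> u *v bh - (1 / \<kappa>) *\<^sub>R hom_dir (dirN u 0)"
    by (simp add: k mv_simps hom_dir_dirN e_theta_commute)
  finally have "ypart (hom_point C) = ypart (\<theta> u *v bh - (1 / \<kappa>) *\<^sub>R hom_dir (dirN u 0))"
    by simp
  then have CP: "C - pp u = (- (1 / \<kappa>)) *\<^sub>R dirN u 0"
    by (simp add: pp_def aff_act_ypart hom_dir_join)
  have "((\<lambda>t. exp (- t) *\<^sub>R (pp u - C) + C) has_vector_derivative - (pp u - C)) (at 0)"
    by (auto intro!: derivative_eq_intros simp: has_real_derivative_iff_has_vector_derivative[symmetric])
  then have "((\<lambda>t. \<Phi> t (pp u)) has_vector_derivative (- (1 / \<kappa>)) *\<^sub>R dirN u 0) (at 0)"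
    unfolding \<Phi> CP[symmetric] by simp
  then show ?thesis
    using k(1) by (intro exI[of _ "- (1 / \<kappa>)"]) simp
next
  case False
  have "\<exists>u. u \<noteq> 0 \<and> {w. \<forall>v. \<theta> v *v hom_dir w = hom_dir w} = span {u} \<and> \<Phi> = (\<lambda>t x. x + t *\<^sub>R u)"
    using assms unfolding radial_def if_not_P[OF False] .
  then obtain d where d: "d \<noteq> 0" "{w. \<forall>v. \<theta> v *v hom_dir w = hom_dir w} = span {d}" "\<Phi> = (\<lambda>t x. x + t *\<^sub>R d)"
    by blast
  have k0: "\<kappa> = 0"
  proof (rule ccontr)
    assume k: "\<kappa> \<noteq> 0"
    let ?C = "bh - (1 / \<kappa>) *\<^sub>R (e *v bh)"
    have hC: "hom_point (ypart ?C) = ?C"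
      by (rule hom_point_ypart) simp
    have "aff_act (\<theta> v) (ypart ?C) = ypart ?C" for v
      unfolding aff_act_ypart hC fixed_point[OF k] ..
    then show False
      using False by blast
  qed
  have e_fix: "\<theta> v *v (e *v bh) = e *v bh" for v
    using e_theta[of v bh] by (simp add: k0 e_theta_commute)
  have hd: "hom_dir (ypart (e *v bh)) = e *v bh"
    by (rule hom_dir_ypart) simp
  have "ypart (e *v bh) \<in> span {d}"
    unfolding d(2)[symmetric] by (simp add: hd e_fix)
  then obtain c where c: "ypart (e *v bh) = c *\<^sub>R d"
    by (auto simp: span_singleton)
  have "c \<noteq> 0"
  proof
    assume "c = 0"
    then have "hom_dir (ypart (e *v bh)) = hom_dir 0"
      using c by simp
    then have "e *v bh = 0"
      by (simp add: hd linear_0[OF linear_hom_dir])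
    then show False
      using tau_e_b by simp
  qed
  have "dirN u 0 = ypart (e *v bh)"
    by (simp add: dirN_def dm_def E_mult mv_simps e_fix)
  then have "d = (1 / c) *\<^sub>R dirN u 0"
    using c \<open>c \<noteq> 0\<close> by simp
  moreover have "((\<lambda>t. pp u + t *\<^sub>R d) has_vector_derivative d) (at 0)"
    by (auto intro!: derivative_eq_intros)
  ultimately have "((\<lambda>t. \<Phi> t (pp u)) has_vector_derivative (1 / c) *\<^sub>R dirN u 0) (at 0)"
    by (simp add: d(3))
  then show ?thesis
    using \<open>c \<noteq> 0\<close> by (intro exI[of _ "1 / c"]) simp
qed

text \<open>For the forward direction one boundary point suffices: the normal has frame coordinates
  proportional to \<open>join (r *\<^sub>R t0) 1\<close>, the flow line to \<open>join 0 1\<close>,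
  and r > 0.\<close>

lemma flow_lines_iff_t0:
  assumes "radial \<Phi>"
  shows "flow_lines_affine_normal \<Phi> (frontier \<Omega>) \<longleftrightarrow> t0 = 0"
proof
  assume t0: "t0 = 0"
  show "flow_lines_affine_normal \<Phi> (frontier \<Omega>)"
    unfolding flow_lines_affine_normal_def
  proof
    fix p assume "p \<in> frontier \<Omega>"
    then obtain u where "p = pp u"
      using frontier_pp by blast
    then show "\<exists>\<nu> k. affine_normal (frontier \<Omega>) p \<nu> \<and> k \<noteq> 0 \<and> ((\<lambda>t. \<Phi> t p) has_vector_derivative k *\<^sub>R \<nu>) (at 0)"
      using affine_normal_orbitI[OF t0, of u] radial_derivative[OF assms, of u] by blast
  qed
next
  assume "flow_lines_affine_normal \<Phi> (frontier \<Omega>)"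
  moreover have "pp 0 \<in> frontier \<Omega>"
    by (simp add: frontier_pp)
  ultimately obtain \<nu> k where \<nu>: "affine_normal (frontier \<Omega>) (pp 0) \<nu>" "k \<noteq> 0"
    "((\<lambda>t. \<Phi> t (pp 0)) has_vector_derivative k *\<^sub>R \<nu>) (at 0)"
    unfolding flow_lines_affine_normal_def by blast
  obtain k0 where k0: "((\<lambda>t. \<Phi> t (pp 0)) has_vector_derivative k0 *\<^sub>R dirN 0 0) (at 0)"
    using radial_derivative[OF assms] by blast
  obtain k' r where k': "k' \<noteq> 0" "\<nu> = k' *\<^sub>R dirN 0 r" "(3 / 8) ^ CARD('m) / 2 \<le> r"
    using affine_normal_orbitD[OF \<nu>(1)] by blast
  have r: "r > 0"
  proof -
    have "(0::real) < (3 / 8) ^ CARD('m) / 2"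
      by simp
    then show ?thesis
      using k'(3) by linarith
  qed
  have "k *\<^sub>R \<nu> = k0 *\<^sub>R dirN 0 0"
    by (rule vector_derivative_unique_at[OF \<nu>(3) k0])
  then have "di 0 (k *\<^sub>R \<nu>) = di 0 (k0 *\<^sub>R dirN 0 0)"
    by simp
  then have "(k * k') *\<^sub>R join (r *\<^sub>R t0) 1 = k0 *\<^sub>R join 0 1"
    by (simp add: k'(2) linear_scale[OF linear_di] dirN_def)
  then have "ypart ((k * k') *\<^sub>R join (r *\<^sub>R t0) 1) = ypart (k0 *\<^sub>R join 0 1)"
    by simp
  then show "t0 = 0"
    using r \<nu>(2) k'(1) by simp
qed

lemma affine_sphere_iff_t0: "affine_sphere (frontier \<Omega>) \<longleftrightarrow> t0 = 0"
  using affine_sphere_imp_t0 affine_sphere_if_t0 by blast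

end

subsection \<open>The groups \<open>Tr(s,\<dots>,s)\<close>\<close>

text \<open>The last row takes the value 1 on the whole hyperplane. Evaluation at 0 gives its last
  entry; evaluation at its own remaining entries shows that these vanish.\<close>

lemma Aff_None: "A \<in> Aff \<Longrightarrow> (A *v z) $ None = z $ None"
proof -
  assume "A \<in> Aff"
  then have "(A *v hom_point x) $ None = 1" for x
    unfolding Aff_def by (metis (mono_tags, lifting) hom_point_None image_eqI mem_Collect_eq rangeE rangeI)
  then have r: "A $ None \<bullet> hom_point x = 1" for x
    by (simp add: matrix_vector_mul_component)
  have ip: "A $ None \<bullet> y = (A $ None $ None) * y $ None + ypart (A $ None) \<bullet> ypart y" for y
    by (simp add: inner_vec_def sum_UNIV_option)
  have n1: "A $ None $ None = 1"
    using r[of 0] by (simp add: ip)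
  then have "ypart (A $ None) \<bullet> ypart (A $ None) = 0"
    using r[of "ypart (A $ None)"] by (simp add: ip)
  then show ?thesis
    by (simp add: matrix_vector_mul_component ip n1)
qed

lemma AffI:
  assumes "invertible A" "\<And>z. (A *v z) $ None = z $ None"
  shows "A \<in> Aff"
proof -
  obtain B where B: "A ** B = mat 1"
    using assms(1) invertible_def by blast
  have "(*v) A ` range hom_point = range hom_point"
  proof safe
    fix x
    have "A *v hom_point x = hom_point (ypart (A *v hom_point x))"
      by (rule hom_point_ypart[symmetric]) (simp add: assms(2))
    then show "A *v hom_point x \<in> range hom_point"
      by (rule range_eqI)
  next
    fix x
    let ?y = "B *v hom_point x"
    have AB: "A *v ?y = hom_point x"
      by (simp add: matrix_vector_mul_assoc B)
    then have "?y $ None = 1"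
      using assms(2)[of ?y] by simp
    then have "hom_point x = A *v hom_point (ypart ?y)"
      by (simp add: AB hom_point_ypart)
    then show "hom_point x \<in> (*v) A ` range hom_point"
      by blast
  qed
  then show ?thesis
    using assms(1) by (simp add: Aff_def)
qed

lemma join_0_0 [simp]: "join 0 0 = 0"
  by (simp add: vec_option_eq_iff)

lemma nilp_mult: "nilp v *v w = join (join (w $ None *\<^sub>R v) (v \<bullet> ypart (ypart w))) 0"
  unfolding vec_eq_iff
proof
  fix i :: "'a option option"
  have row: "(nilp v *v w) $ i = (\<Sum>j\<in>UNIV. nilp v $ i $ j * w $ j)"
    by (simp add: matrix_vector_mult_def)
  consider "i = None" | "i = Some None" | k where "i = Some (Some k)"
    by (metis not_Some_eq)
  then show "(nilp v *v w) $ i = join (join (w $ None *\<^sub>R v) (v \<bullet> ypart (ypart w))) 0 $ i"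
    unfolding row by cases (simp_all add: nilp_def sum_UNIV_option inner_vec_def mult.commute)
qed

lemma nilp_cubed: "nilp v ** (nilp v ** nilp v) = 0"
  unfolding matrix_eq by (simp add: matrix_vector_mul_assoc[symmetric] nilp_mult vec_option_eq_iff)

lemma matrix_exp_nilp: "matrix_exp (nilp v) = mat 1 + nilp v + (1 / 2) *\<^sub>R (nilp v ** nilp v)"
proof -
  let ?N = "nilp v"
  have p3: "((**) ?N ^^ 3) (mat 1) = 0"
    by (simp add: numeral_3_eq_3 nilp_cubed)
  have z: "((**) ?N ^^ j) 0 = 0" for j
    by (induction j) auto
  have "((**) ?N ^^ j) (mat 1) /\<^sub>R fact j = 0" if "j \<notin> {..<3}" for j
  proof -
    have "3 \<le> j"
      using that by simp
    then have "j = (j - 3) + 3"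
      by simp
    then have "((**) ?N ^^ j) (mat 1) = ((**) ?N ^^ (j - 3)) (((**) ?N ^^ 3) (mat 1))"
      by (metis comp_apply funpow_add)
    then show ?thesis
      by (simp add: p3 z)
  qed
  then have "matrix_exp ?N = (\<Sum>j<3. ((**) ?N ^^ j) (mat 1) /\<^sub>R fact j)"
    unfolding matrix_exp_def by (intro suminf_finite) auto
  also have "\<dots> = mat 1 + ?N + (1 / 2) *\<^sub>R (?N ** ?N)"
    by (simp add: numeral_3_eq_3 lessThan_Suc add_ac inverse_eq_divide)
  finally show ?thesis .
qed

lemma det_matrix_exp_nilp: "det (matrix_exp (nilp v)) = 1"
proof -
  let ?N = "nilp v"
  let ?f = "\<lambda>t::real. mat 1 + t *\<^sub>R ?N + (t\<^sup>2 / 2) *\<^sub>R (?N ** ?N)"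
  have mv: "?f t *v w = w + t *\<^sub>R (?N *v w) + (t\<^sup>2 / 2) *\<^sub>R (?N *v (?N *v w))" for t w
    by (simp add: mv_simps matrix_vector_mul_assoc)
  have N3: "?N *v (?N *v (?N *v w)) = 0" for w
    by (simp add: nilp_mult vec_option_eq_iff)
  have "det (?f 1) = 1"
  proof (rule det_one_parameter_group[of ?f ?N 1])
    show "(?f has_vector_derivative ?N) (at 0)"
      by (auto intro!: derivative_eq_intros)
    show "?f 0 = mat 1"
      by simp
    show "?f (s + t) = ?f s ** ?f t" for s t
      unfolding matrix_eq
      by (simp only: matrix_vector_mul_assoc[symmetric] mv)
        (simp add: mv_simps N3 power2_sum add_divide_distrib algebra_simps)
    show "trace ?N = 0"
      by (simp add: trace_def nilp_def sum_UNIV_option)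
  qed
  then show ?thesis
    by (simp add: matrix_exp_nilp)
qed

lemma det_diag_exp: "det (diag_exp x) = exp (\<Sum>i\<in>UNIV. x $ i)"
proof -
  have "det (diag_exp x) = (\<Prod>i\<in>UNIV. diag_exp x $ i $ i)"
    by (rule det_diagonal) (simp add: diag_exp_def)
  then show ?thesis
    by (simp add: prod_UNIV_option diag_exp_def exp_sum)
qed

lemma det_Tr: "A \<in> Tr s \<Longrightarrow> det A = 1"
  by (auto simp: Tr_def det_diag_exp det_matrix_exp_nilp split: if_splits)

lemma diag_exp_mult: "diag_exp x *v w = join (\<chi> i. exp (x $ i) * w $ Some i) (w $ None)"
  by (simp add: vec_option_eq_iff matrix_vector_mult_def diag_exp_def if_distrib[of "\<lambda>c. c * _"] cong: if_cong)

lemma matrix_mult_inv: "invertible P \<Longrightarrow> P ** matrix_inv P = mat 1" "invertible P \<Longrightarrow> matrix_inv P ** P = mat 1"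
  for P :: "real ^ 'n ^ 'n"
  unfolding invertible_def matrix_inv_def by (metis (mono_tags, lifting) someI_ex)+

lemma Aff_conjugate_det:
  assumes "Aff_conjugate T T'" "\<And>B. B \<in> T' \<Longrightarrow> det B = 1" "A \<in> T"
  shows "det A = 1"
proof -
  obtain P B where P: "P \<in> Aff" "B \<in> T'" "A = P ** B ** matrix_inv P"
    using assms unfolding Aff_conjugate_def by blast
  have "P ** matrix_inv P = mat 1"
    using P(1) matrix_mult_inv(1) by (auto simp: Aff_def)
  then have "det P * det (matrix_inv P) = 1"
    by (metis det_I det_mul)
  then show ?thesis
    using P assms(2) by (simp add: det_mul)
qed

section \<open>Conjugating trace-free groups into \<open>Tr 0\<close> and
  \<open>Tr 1\<close>\<close>

context vector_group_frame
begin

lemma tr_0_if_det: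
  assumes "\<And>v. det (\<theta> v) = 1"
  shows "tr v = 0"
proof -
  have ent: "((\<lambda>t. \<theta> (t *\<^sub>R v) $ i $ j) has_real_derivative X v $ i $ j) (at 0)" for i j
    unfolding has_real_derivative_iff_has_vector_derivative
    by (rule bounded_linear.has_vector_derivative[OF bounded_linear_compose[OF bounded_linear_vec_nth bounded_linear_vec_nth] derivative_0])
  have "((\<lambda>t. det (\<theta> (t *\<^sub>R v))) has_real_derivative trace (X v)) (at 0)"
    by (rule det_derivative_at_identity[OF _ ent]) simp
  then have "((\<lambda>t::real. 1::real) has_real_derivative trace (X v)) (at 0)"
    by (simp add: assms)
  then have "trace (X v) = 0"
    using DERIV_unique DERIV_const by blast
  then show ?thesis
    by (simp add: trace_X)
qed

lemma Aff_conjugate_rangeI: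
  assumes P: "P \<in> Aff"
    and conj: "\<And>v w. \<theta> v *v (P *v w) = P *v (B v *v w)" and range: "range B = T'"
  shows "Aff_conjugate (range \<theta>) T'"
proof -
  have inv: "P ** matrix_inv P = mat 1"
    using P matrix_mult_inv(1) by (auto simp: Aff_def)
  have "\<theta> v = P ** B v ** matrix_inv P" for v
  proof -
    have "\<theta> v ** P = P ** B v"
      unfolding matrix_eq by (simp add: matrix_vector_mul_assoc[symmetric] conj)
    then have "(\<theta> v ** P) ** matrix_inv P = P ** B v ** matrix_inv P"
      by simp
    then show ?thesis
      by (simp add: matrix_mul_assoc[symmetric] inv)
  qed
  then have "range \<theta> = (\<lambda>A. P ** A ** matrix_inv P) ` T'"
    unfolding range[symmetric] image_image by simp
  then show ?thesis
    unfolding Aff_conjugate_def using P by blast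
qed

text \<open>Here the multiplication operators \<open>M\<^sub>u\<close> of the algebra are symmetric and \<open>M\<^sub>u\<^sup>2 = M\<close> of a
  square, so that \<open>tr M = 0\<close> forces the Hilbert-Schmidt norm of \<open>M\<^sub>u\<close> to vanish.\<close>

lemma XX_b_if_kappa_0:
  assumes k: "\<kappa> = 0" and tr0: "\<And>v. tr v = 0"
  shows "X u *v (X v *v bh) = (u \<bullet> v) *\<^sub>R (e *v bh)"
proof -
  define M where "M u y = ypart (crd (X u *v (X y *v bh)))" for u y
  have XX: "X u *v (X y *v bh) = X (M u y) *v bh + (u \<bullet> y) *\<^sub>R (e *v bh)" for u y
  proof -
    have "E (crd (X u *v (X y *v bh))) *v bh = X (M u y) *v bh + (u \<bullet> y) *\<^sub>R (e *v bh)"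
      by (simp add: E_mult M_def tau_crd[symmetric])
    then show ?thesis
      by (simp add: E_crd)
  qed
  have Xe0: "X u *v (e *v z) = 0" for u z
    by (simp add: X_e k)
  have tauM: "v \<bullet> M u y = \<tau> \<bullet> (X v *v (X u *v (X y *v bh)))" for v u y
    unfolding M_def by (rule tau_X_crd[symmetric])
  \<comment> \<open>One factor is absorbed by \<open>tauM\<close>. The other is replaced by X u X i
    b up to a multiple of e b, which every \<open>X\<close> kills because \<kappa> = 0;
    commutativity then sorts the factors.\<close>
  have sq: "M u (axis i 1) \<bullet> M u (axis i 1) = \<tau> \<bullet> (X (axis i 1) *v (X (axis i 1) *v (X u *v (X u *v bh))))" for u i
  proof -
    let ?y = "M u (axis i 1)"
    have "?y \<bullet> ?y = \<tau> \<bullet> (X ?y *v (X u *v (X (axis i 1) *v bh)))"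
      by (rule tauM)
    also have "X ?y *v (X u *v (X (axis i 1) *v bh)) = X u *v (X (axis i 1) *v (X ?y *v bh))"
      by (metis X_commute)
    also have "X ?y *v bh = X u *v (X (axis i 1) *v bh) - (u \<bullet> axis i 1) *\<^sub>R (e *v bh)"
      by (simp add: XX)
    also have "\<tau> \<bullet> (X u *v (X (axis i 1) *v (X u *v (X (axis i 1) *v bh) - (u \<bullet> axis i 1) *\<^sub>R (e *v bh))))
        = \<tau> \<bullet> (X u *v (X (axis i 1) *v (X u *v (X (axis i 1) *v bh))))"
      by (simp add: mv_simps Xe0)
    also have "X u *v (X (axis i 1) *v (X u *v (X (axis i 1) *v bh)))
        = X (axis i 1) *v (X (axis i 1) *v (X u *v (X u *v bh)))"
      by (metis X_commute)
    finally show ?thesis .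
  qed
  have "(\<Sum>i\<in>UNIV. M u (axis i 1) \<bullet> M u (axis i 1)) = tr (M u u)" for u
    unfolding sq tr_def by (rule sum.cong) (simp_all add: XX[of u u] mv_simps Xe0)
  then have "(\<Sum>i\<in>UNIV. M u (axis i 1) \<bullet> M u (axis i 1)) = 0" for u
    by (simp add: tr0)
  then have M0: "M u (axis i 1) = 0" for u i
    by (simp add: sum_nonneg_eq_0_iff)
  have "M u v = 0" for u v
  proof -
    have "axis i 1 \<bullet> M u v = 0" for i
    proof -
      have "axis i 1 \<bullet> M u v = \<tau> \<bullet> (X (axis i 1) *v (X u *v (X v *v bh)))"
        by (rule tauM)
      also have "\<dots> = \<tau> \<bullet> (X v *v (X u *v (X (axis i 1) *v bh)))"
        by (metis X_commute)
      also have "\<dots> = v \<bullet> M u (axis i 1)"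
        by (rule tauM[symmetric])
      finally show ?thesis
        by (simp add: M0)
    qed
    then show ?thesis
      by (simp add: vec_eq_iff inner_axis')
  qed
  then show ?thesis
    using XX[of u v] by simp
qed

text \<open>\<open>P\<close> sends the standard basis to the frame \<open>e b\<close>,
  \<open>X v b\<close>, \<open>b\<close>, in which \<open>X v\<close> acts as \<open>nilp v\<close>.
  The exponential is a quadratic polynomial and is recognized by
  \<open>theta_unique\<close>.\<close>

lemma Aff_conjugate_Tr_0:
  assumes k: "\<kappa> = 0" and tr0: "\<And>v. tr v = 0"
  shows "Aff_conjugate (range \<theta>) (Tr 0)"
proof -
  define P :: "'m hmatrix" where "P = matrix (\<lambda>w. (w $ None) *\<^sub>R bh + E (ypart w) *v bh)"
  define Q :: "'m hmatrix" where "Q = matrix (\<lambda>z. join (crd z) (z $ None))"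
  have P: "P *v w = (w $ None) *\<^sub>R bh + E (ypart w) *v bh" for w
    unfolding P_def
    by (rule matrix_mult_linear)
      (auto intro!: linearI simp: linear_add[OF linear_E] linear_scale[OF linear_E] mv_simps algebra_simps)
  have Q: "Q *v z = join (crd z) (z $ None)" for z
    unfolding Q_def
    by (rule matrix_mult_linear)
      (auto intro!: linearI simp: linear_add[OF linear_crd] linear_scale[OF linear_crd] vec_option_eq_iff)
  have PQ: "P ** Q = mat 1"
    by (simp add: matrix_eq matrix_vector_mul_assoc[symmetric] P Q decomp[symmetric])
  have PA: "P \<in> Aff"
    by (rule AffI) (use PQ invertible_right_inverse in \<open>auto simp: P\<close>)
  have XP: "X v *v (P *v w) = P *v (nilp v *v w)" for v w
    by (simp add: P E_mult mv_simps X_e k XX_b_if_kappa_0[OF k tr0] nilp_mult X_scaleR)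
  show ?thesis
  proof (rule Aff_conjugate_rangeI[OF PA])
    show "range (\<lambda>v :: real ^ 'm. matrix_exp (nilp v)) = Tr 0"
      by (auto simp: Tr_def)
    fix v :: "real ^ 'm" and w :: "'m hpoint"
    let ?N = "nilp v"
    let ?f = "\<lambda>t::real. P *v w + t *\<^sub>R (P *v (?N *v w)) + (t\<^sup>2 / 2) *\<^sub>R (P *v (?N *v (?N *v w)))"
    have N3: "?N *v (?N *v (?N *v w)) = 0"
      by (simp add: nilp_mult vec_option_eq_iff)
    have "\<theta> v *v (P *v w) = ?f 1"
    proof (rule theta_unique[where f="?f" and v=v])
      show "?f 0 = P *v w"
        by simp
      fix t :: real
      have "(?f has_vector_derivative P *v (?N *v w) + t *\<^sub>R (P *v (?N *v (?N *v w)))) (at t)"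
        by (auto intro!: derivative_eq_intros)
      also have "P *v (?N *v w) + t *\<^sub>R (P *v (?N *v (?N *v w))) = X v *v ?f t"
        by (simp add: mv_simps XP N3)
      finally show "(?f has_vector_derivative X v *v ?f t) (at t)" .
    qed
    then show "\<theta> v *v (P *v w) = P *v (matrix_exp ?N *v w)"
      by (simp add: matrix_exp_nilp mv_simps matrix_vector_mul_assoc)
  qed
qed

text \<open>On the maximal ideal, the functional \<tau> at \<open>b\<close> applied to products is a
  positive definite form, in which \<open>e\<close> has square norm \<kappa>; rescaling
  \<open>e\<close> by the root of \<kappa> makes it the standard inner product. Commutativity makes
  multiplication by \<open>X v\<close> self-adjoint, so all \<open>X v\<close> are diagonalized
  together.\<close>

lemma Aff_conjugate_Tr_pos:
  assumes k: "\<kappa> > 0" and tr0: "\<And>v. tr v = 0"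
  shows "Aff_conjugate (range \<theta>) (Tr 1)"
proof -
  define q where "q = sqrt \<kappa>"
  have q: "q > 0" "q * q = \<kappa>"
    using k by (simp_all add: q_def)
  define S where "S x = join (ypart x) (x $ None / q)" for x :: "'m point"
  define Si where "Si x = join (ypart x) (x $ None * q)" for x :: "'m point"
  have SSi: "S (Si x) = x" "Si (S x) = x" for x
    using q by (simp_all add: S_def Si_def)
  have linS: "linear S" "linear Si"
    by (auto intro!: linearI simp: S_def Si_def vec_option_eq_iff add_divide_distrib algebra_simps)
  define A where "A v x = Si (crd (X v *v (E (S x) *v bh)))" for v x
  have linA: "linear (A v)" for v
    by (auto intro!: linearI simp: A_def linear_add[OF linS(1)] linear_scale[OF linS(1)] linear_add[OF linS(2)]
        linear_scale[OF linS(2)] linear_add[OF linear_E] linear_scale[OF linear_E] mv_simps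
        linear_add[OF linear_crd] linear_scale[OF linear_crd])
  have linA': "linear (\<lambda>v. A v x)" for x
    by (auto intro!: linearI simp: A_def X_simps linear_add[OF linS(2)]
        linear_scale[OF linS(2)] mv_simps linear_add[OF linear_crd] linear_scale[OF linear_crd])
  have EA: "E (S (A v x)) *v bh = X v *v (E (S x) *v bh)" for v x
    by (simp add: A_def SSi E_crd)
  \<comment> \<open>The inner product is \<tau> of a threefold product in the algebra, so the
    symmetry of \<open>A v\<close> is just commutativity.\<close>
  have ip: "A v x \<bullet> y = \<tau> \<bullet> (X v *v (E (S x) *v (E (S y) *v bh)))" for v x y
  proof -
    have EX: "E z *v (X v *v w) = X v *v (E z *v w)" for z v w
      by (simp add: E_mult mv_simps e_X_commute X_commute[of _ v])
    have EE: "E z *v (E z' *v w) = E z' *v (E z *v w)" for z z' w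
      by (simp add: E_mult mv_simps e_X_commute X_commute[of "ypart z'"] algebra_simps)
    let ?z = "X v *v (E (S x) *v bh)"
    have "A v x \<bullet> y = crd ?z $ None * q * y $ None + ypart (crd ?z) \<bullet> ypart y"
      by (simp add: A_def Si_def inner_vec_def[of "join _ _"] sum_UNIV_option inner_vec_def[of "ypart _"])
    also have "ypart (crd ?z) \<bullet> ypart y = \<tau> \<bullet> (X (ypart y) *v ?z)"
      by (simp add: tau_X_crd inner_commute)
    also have "crd ?z $ None * q * y $ None = (y $ None / q) * (\<tau> \<bullet> (e *v ?z))"
      using q by (simp add: tau_crd[symmetric] e_X inner_scaleR_right field_simps)
    also have "(y $ None / q) * (\<tau> \<bullet> (e *v ?z)) + \<tau> \<bullet> (X (ypart y) *v ?z) = \<tau> \<bullet> (E (S y) *v ?z)"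
      by (simp add: E_mult S_def inner_simps)
    also have "E (S y) *v ?z = X v *v (E (S x) *v (E (S y) *v bh))"
      by (simp only: EX EE[of "S y" "S x"])
    finally show ?thesis .
  qed
  have symA: "A v x \<bullet> y = x \<bullet> A v y" for v x y
  proof -
    have EE: "E z *v (E z' *v w) = E z' *v (E z *v w)" for z z' w
      by (simp add: E_mult mv_simps e_X_commute X_commute[of "ypart z'"] algebra_simps)
    have "A v x \<bullet> y = A v y \<bullet> x"
      unfolding ip EE[of "S x" "S y"] ..
    then show ?thesis
      by (simp add: inner_commute)
  qed
  have commA: "A u (A v x) = A v (A u x)" for u v x
    unfolding A_def[of u "A v x"] A_def[of v "A u x"] EA by (simp only: X_commute[of u v])
  have "\<exists>B \<subseteq> UNIV. pairwise orthogonal B \<and> (\<forall>b\<in>B. norm b = 1) \<and> span B = (UNIV :: 'm point set) \<and>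
      (\<forall>b\<in>B. \<forall>f\<in>range A. \<exists>c. f b = c *\<^sub>R b)"
    by (rule commuting_selfadjoint_eigenbasis) (use linA symA commA in auto)
  then obtain B :: "'m point set" where B: "pairwise orthogonal B" "\<And>b. b \<in> B \<Longrightarrow> norm b = 1" "span B = UNIV"
    "\<And>b v. b \<in> B \<Longrightarrow> \<exists>c. A v b = c *\<^sub>R b"
    by auto
  have "0 \<notin> B"
    using B(2) by force
  then have ind: "independent B"
    using B(1) pairwise_orthogonal_independent by blast
  then have "finite B" "card B = CARD('m option)"
    using basis_card_eq_dim[of B UNIV] B(3) independent_imp_finite by auto
  then obtain g where g: "bij_betw g (UNIV :: 'm option set) B"
    using finite_same_card_bij[of "UNIV :: 'm option set" B] by auto
  have gB: "g i \<in> B" for i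
    using g by (auto simp: bij_betw_def)
  have gg: "g i \<bullet> g j = (if i = j then 1 else 0)" for i j
  proof (cases "i = j")
    case True
    then show ?thesis
      using B(2)[OF gB[of j]] by (simp add: dot_square_norm)
  next
    case False
    then have "g i \<noteq> g j"
      using g by (auto simp: bij_betw_def inj_def)
    then show ?thesis
      using B(1) gB False by (auto simp: pairwise_def orthogonal_def)
  qed
  define \<Lambda> where "\<Lambda> v = (\<chi> i. g i \<bullet> A v (g i))" for v
  have Ag: "A v (g i) = (\<Lambda> v $ i) *\<^sub>R g i" for v i
  proof -
    obtain c where c: "A v (g i) = c *\<^sub>R g i"
      using B(4)[OF gB] by blast
    then have "\<Lambda> v $ i = c"
      by (simp add: \<Lambda>_def gg)
    then show ?thesis
      using c by simp
  qed
  have lin\<Lambda>: "linear \<Lambda>"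
    by (auto intro!: linearI simp: \<Lambda>_def vec_eq_iff linear_add[OF linA'] linear_scale[OF linA'] inner_simps)
  define p where "p i = E (S (g i)) *v bh" for i
  have Xp: "X v *v p i = (\<Lambda> v $ i) *\<^sub>R p i" for v i
    using EA[of v "g i"] by (simp add: p_def Ag linear_scale[OF linS(1)] linear_scale[OF linear_E] mv_simps)
  \<comment> \<open>The fixed point becomes the origin of the diagonalizing affine frame.\<close>
  define Ch where "Ch = bh - (1 / \<kappa>) *\<^sub>R (e *v bh)"
  have XCh: "X v *v Ch = 0" for v
    using k by (simp add: Ch_def mv_simps X_e)
  define P :: "'m hmatrix" where "P = matrix (\<lambda>w. (w $ None) *\<^sub>R Ch + (\<Sum>i\<in>UNIV. (w $ Some i) *\<^sub>R p i))"
  have P: "P *v w = (w $ None) *\<^sub>R Ch + (\<Sum>i\<in>UNIV. (w $ Some i) *\<^sub>R p i)" for w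
    unfolding P_def
    by (rule matrix_mult_linear)
      (auto intro!: linearI simp: sum.distrib scaleR_add_left scaleR_sum_right scaleR_add_right)
  have PNone: "(P *v w) $ None = w $ None" for w
    by (simp add: P Ch_def p_def)
  have sum_p: "(\<Sum>i\<in>UNIV. c i *\<^sub>R p i) = E (S (\<Sum>i\<in>UNIV. c i *\<^sub>R g i)) *v bh" for c :: "'m option \<Rightarrow> real"
  proof -
    have lin: "linear (\<lambda>x. E (S x) *v bh)"
      by (auto intro!: linearI simp: linear_add[OF linS(1)] linear_scale[OF linS(1)]
          linear_add[OF linear_E] linear_scale[OF linear_E] mv_simps)
    show ?thesis
      unfolding p_def linear_sum[OF lin] linear_scale[OF lin] ..
  qed
  have "inj ((*v) P)"
  proof -
    have "w = 0" if "P *v w = 0" for w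
    proof -
      have w0: "w $ None = 0"
        using PNone[of w] that by simp
      then have "E (S (\<Sum>i\<in>UNIV. w $ Some i *\<^sub>R g i)) *v bh = 0"
        using that by (simp add: P sum_p)
      then have "E (S (\<Sum>i\<in>UNIV. w $ Some i *\<^sub>R g i)) *v bh = E 0 *v bh"
        by (simp add: linear_0[OF linear_E])
      then have "S (\<Sum>i\<in>UNIV. w $ Some i *\<^sub>R g i) = 0"
        by (simp only: E_inj)
      then have "Si (S (\<Sum>i\<in>UNIV. w $ Some i *\<^sub>R g i)) = Si 0"
        by simp
      then have sum0: "(\<Sum>i\<in>UNIV. w $ Some i *\<^sub>R g i) = 0"
        by (simp add: SSi linear_0[OF linS(2)])
      have "w $ Some j = 0" for j
      proof -
        have "w $ Some j = (\<Sum>i\<in>UNIV. w $ Some i *\<^sub>R g i) \<bullet> g j"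
          by (simp add: inner_sum_left gg if_distrib cong: if_cong)
        then show ?thesis
          by (simp add: sum0)
      qed
      then show ?thesis
        using w0 by (simp add: vec_option_eq_iff)
    qed
    then show ?thesis
      by (simp add: linear_injective_0)
  qed
  then have invP: "invertible P"
    using matrix_left_invertible_injective invertible_left_inverse by blast
  have PA: "P \<in> Aff"
    by (rule AffI[OF invP PNone])
  have conj: "\<theta> v *v (P *v w) = P *v (diag_exp (\<Lambda> v) *v w)" for v w
  proof -
    let ?f = "\<lambda>t. (w $ None) *\<^sub>R Ch + (\<Sum>i\<in>UNIV. (exp (t * \<Lambda> v $ i) * w $ Some i) *\<^sub>R p i)"
    have "\<theta> v *v (P *v w) = ?f 1"
    proof (rule theta_unique[where f="?f" and v=v])
      show "?f 0 = P *v w"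
        by (simp add: P)
      fix t :: real
      have d: "((\<lambda>t. (exp (t * \<Lambda> v $ i) * w $ Some i) *\<^sub>R p i) has_vector_derivative
          (\<Lambda> v $ i * exp (t * \<Lambda> v $ i) * w $ Some i) *\<^sub>R p i) (at t)" for i
      proof -
        have "((\<lambda>t. exp (t * \<Lambda> v $ i) * w $ Some i) has_real_derivative \<Lambda> v $ i * exp (t * \<Lambda> v $ i) * w $ Some i) (at t)"
          by (auto intro!: derivative_eq_intros)
        then have "((\<lambda>t. exp (t * \<Lambda> v $ i) * w $ Some i) has_vector_derivative \<Lambda> v $ i * exp (t * \<Lambda> v $ i) * w $ Some i) (at t)"
          by (rule has_real_derivative_iff_has_vector_derivative[THEN iffD1])
        from bounded_linear.has_vector_derivative[OF bounded_linear_scaleR_left this] show ?thesis .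
      qed
      have "(?f has_vector_derivative 0 + (\<Sum>i\<in>UNIV. (\<Lambda> v $ i * exp (t * \<Lambda> v $ i) * w $ Some i) *\<^sub>R p i)) (at t)"
        by (intro has_vector_derivative_add has_vector_derivative_const has_vector_derivative_sum d)
      moreover have "X v *v ?f t = (\<Sum>i\<in>UNIV. (\<Lambda> v $ i * exp (t * \<Lambda> v $ i) * w $ Some i) *\<^sub>R p i)"
      proof -
        have "X v *v (\<Sum>i\<in>UNIV. c i *\<^sub>R p i) = (\<Sum>i\<in>UNIV. (\<Lambda> v $ i * c i) *\<^sub>R p i)" for c :: "'m option \<Rightarrow> real"
          by (simp add: linear_sum[OF matrix_vector_mul_linear] mv_simps Xp mult.commute)
        then show ?thesis
          by (simp add: mv_simps XCh mult.assoc)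
      qed
      ultimately show "(?f has_vector_derivative X v *v ?f t) (at t)"
        by simp
    qed
    then show ?thesis
      by (simp add: P diag_exp_mult)
  qed
  have sum\<Lambda>: "(\<Sum>i\<in>UNIV. \<Lambda> v $ i) = 0" for v
  proof -
    let ?D = "(\<chi> i j. if i = j then (case i of None \<Rightarrow> 0 | Some k \<Rightarrow> \<Lambda> v $ k) else 0) :: 'm hmatrix"
    have D: "?D *v w = join (\<chi> i. \<Lambda> v $ i * w $ Some i) 0" for w
      by (simp add: vec_option_eq_iff matrix_vector_mult_def if_distrib[of "\<lambda>c. c * _"] cong: if_cong)
    have "X v *v (P *v w) = P *v (?D *v w)" for w
      unfolding D by (simp add: P mv_simps XCh linear_sum[OF matrix_vector_mul_linear] Xp mult.commute)
    then have XP: "X v ** P = P ** ?D"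
      unfolding matrix_eq by (simp add: matrix_vector_mul_assoc[symmetric])
    obtain R where R: "P ** R = mat 1" "R ** P = mat 1"
      using invP invertible_def by blast
    have "trace (X v) = trace (X v ** P ** R)"
      by (simp add: matrix_mul_assoc[symmetric] R)
    also have "\<dots> = trace (R ** (P ** ?D))"
      unfolding XP by (rule trace_mul_sym)
    also have "\<dots> = trace ?D"
      by (simp add: matrix_mul_assoc R)
    also have "\<dots> = (\<Sum>i\<in>UNIV. \<Lambda> v $ i)"
      by (simp add: trace_def sum_UNIV_option[where 'm="'m option"])
    finally show ?thesis
      by (simp add: trace_X tr0)
  qed
  have inj\<Lambda>: "inj \<Lambda>"
  proof -
    have "v = 0" if "\<Lambda> v = 0" for v
    proof -
      have Pz: "X v *v (P *v w) = 0" for w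
        by (simp add: P mv_simps XCh linear_sum[OF matrix_vector_mul_linear] Xp that)
      obtain R where R: "P ** R = mat 1"
        using invP invertible_def by blast
      have "X v *v bh = X v *v (P *v (R *v bh))"
        by (simp add: matrix_vector_mul_assoc R)
      also have "\<dots> = X 0 *v bh"
        by (simp only: Pz X_0 matrix_vector_mult_0)
      finally show ?thesis
        by (simp only: X_b_inj)
    qed
    then show ?thesis
      using lin\<Lambda> by (simp add: linear_injective_0)
  qed
  \<comment> \<open>The trace condition puts the eigenvalue vectors into the hyperplane of sum zero;
    injectivity and dimension make them fill it.\<close>
  have "range \<Lambda> = {x. (1 :: 'm point) \<bullet> x = 0}"
  proof (rule subspace_dim_equal)
    show "subspace (range \<Lambda>)"
      by (rule linear_subspace_image[OF lin\<Lambda>]) simp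
    show "subspace {x. (1 :: 'm point) \<bullet> x = 0}"
      by (rule subspace_hyperplane)
    show "range \<Lambda> \<subseteq> {x. (1 :: 'm point) \<bullet> x = 0}"
      by (auto simp: inner_vec_def sum\<Lambda>)
    have "(1 :: 'm point) \<noteq> 0"
      by (simp add: vec_eq_iff)
    then have "dim {x. (1 :: 'm point) \<bullet> x = 0} = CARD('m)"
      by (simp add: dim_hyperplane)
    moreover have "dim (range \<Lambda>) = dim (UNIV :: (real ^ 'm) set)"
      by (rule dim_image_eq[OF lin\<Lambda>]) (use inj\<Lambda> in \<open>auto intro: inj_on_subset\<close>)
    ultimately show "dim {x. (1 :: 'm point) \<bullet> x = 0} \<le> dim (range \<Lambda>)"
      by simp
  qed
  then have "range (\<lambda>v. diag_exp (\<Lambda> v)) = diag_exp ` {x. (\<Sum>i\<in>UNIV. x $ i) = 0}"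
    by (simp add: image_image[symmetric] inner_vec_def)
  also have "\<dots> = Tr 1"
    by (auto simp: Tr_def)
  finally show ?thesis
    by (rule Aff_conjugate_rangeI[OF PA conj])
qed

end

subsection \<open>All horospheres are images of the boundary\<close>

lemma interior_homeomorphic_image:
  fixes f :: "'a::topological_space \<Rightarrow> 'b::topological_space"
  assumes "continuous_on UNIV f" "continuous_on UNIV g" "\<And>x. g (f x) = x" "\<And>y. f (g y) = y"
  shows "interior (f ` S) = f ` interior S"
proof
  have im: "f ` A = g -` A" for A
    using assms(3,4) by (auto simp: image_iff) (metis assms(4))
  have "open (g -` interior S)"
    by (intro open_vimage assms) simp
  moreover have "g -` interior S \<subseteq> g -` S"
    by (rule vimage_mono[OF interior_subset])
  ultimately show "f ` interior S \<subseteq> interior (f ` S)"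
    unfolding im by (rule interior_maximal[rotated])
  have "open (f -` interior (f ` S))"
    by (intro open_vimage assms) simp
  moreover have "f -` interior (f ` S) \<subseteq> S"
  proof
    fix x assume "x \<in> f -` interior (f ` S)"
    then have "f x \<in> f ` S"
      using interior_subset by blast
    then show "x \<in> S"
      using assms(3) by (metis imageE)
  qed
  ultimately have "f -` interior (f ` S) \<subseteq> interior S"
    by (rule interior_maximal[rotated])
  then show "interior (f ` S) \<subseteq> f ` interior S"
    using assms(4) by (metis image_eqI subsetI subset_iff vimage_eq)
qed

lemma frontier_homeomorphic_image:
  fixes f :: "'a::topological_space \<Rightarrow> 'b::topological_space"
  assumes "continuous_on UNIV f" "continuous_on UNIV g" "\<And>x. g (f x) = x" "\<And>y. f (g y) = y"
  shows "frontier (f ` S) = f ` frontier S"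
proof -
  have "inj f" "surj f"
    using assms(3,4) by (metis injI, metis surjI)
  then have compl: "f ` (- A) = - f ` A" for A
    by (simp add: bij_image_Compl_eq bij_def)
  have "closure (f ` S) = - interior (f ` (- S))"
    by (simp add: closure_interior compl)
  also have "\<dots> = f ` closure S"
    by (simp add: interior_homeomorphic_image[OF assms] compl[symmetric] closure_interior)
  finally show ?thesis
    unfolding frontier_def interior_homeomorphic_image[OF assms]
    by (simp add: image_set_diff[OF \<open>inj f\<close>])
qed

lemma aff_act_affine: "aff_act A x = aff_act A 0 + ypart (A *v hom_dir x)"
proof -
  have "hom_point x = hom_point 0 + hom_dir x"
    by (simp add: vec_option_eq_iff hom_point_join hom_dir_join)
  then show ?thesis
    by (simp add: aff_act_ypart mv_simps)
qed

lemma linear_aff_act_dir: "linear (\<lambda>x. ypart (A *v hom_dir x))"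
  by (auto intro!: linearI simp: hom_dir_join mv_simps vec_eq_iff)
    (simp_all add: matrix_vector_mult_def sum_UNIV_option algebra_simps sum.distrib sum_distrib_left)

lemma continuous_aff_act: "continuous_on S (aff_act A)"
proof -
  have "continuous_on S (\<lambda>x. aff_act A 0 + ypart (A *v hom_dir x))"
    using linear_aff_act_dir[of A]
    by (intro continuous_on_add continuous_on_const) (simp add: linear_continuous_on linear_linear)
  then show ?thesis
    by (simp only: aff_act_affine[symmetric])
qed

lemma convex_aff_act: "convex S \<Longrightarrow> convex (aff_act A ` S)"
proof -
  assume "convex S"
  then have "convex ((+) (aff_act A 0) ` (\<lambda>x. ypart (A *v hom_dir x)) ` S)"
    by (intro convex_translation convex_linear_image linear_aff_act_dir)
  then show ?thesis
    by (simp only: image_image aff_act_affine[symmetric])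
qed

context orbit_domain
begin

text \<open>The formula for the fixed point may be based at any point of the affine space in place
  of \<open>b\<close>, because \<open>e\<close> acts as \<kappa> on directions.\<close>

lemma e_mult_Ch:
  assumes "\<kappa> \<noteq> 0" "z $ None = 1"
  shows "bh - (1 / \<kappa>) *\<^sub>R (e *v bh) = z - (1 / \<kappa>) *\<^sub>R (e *v z)"
proof -
  let ?x = "crd z"
  have z: "z = bh + E ?x *v bh"
    using decomp[of z] assms(2) by simp
  have "e *v (E ?x *v bh) = \<kappa> *\<^sub>R (E ?x *v bh)"
    by (simp add: E_mult mv_simps e_X e_e scaleR_add_right)
  moreover have "e *v z = e *v bh + e *v (E ?x *v bh)"
    by (subst z) (simp add: mv_simps)
  ultimately have "(1 / \<kappa>) *\<^sub>R (e *v z) = (1 / \<kappa>) *\<^sub>R (e *v bh) + E ?x *v bh"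
    using assms(1) by (simp add: scaleR_add_right)
  moreover have "z - E ?x *v bh = bh"
    by (subst z) simp
  ultimately show ?thesis
    by (simp add: algebra_simps)
qed

text \<open>From an interior point one follows the radial line outwards to the boundary: in
  direction - e b if \<kappa> = 0, and towards the fixed point, which lies outside the domain, if
  \<kappa> > 0.\<close>

lemma exists_shift:
  assumes x: "x \<in> \<Omega>"
  shows "\<exists>\<mu> u. \<mu> \<ge> 0 \<and> hom_point x = \<theta> u *v bh + \<mu> *\<^sub>R (e *v (\<theta> u *v bh))"
proof (cases "x \<in> interior \<Omega>")
  case False
  then have "x \<in> frontier \<Omega>"
    using x closed_dom by (simp add: frontier_def)
  then obtain u where "x = pp u"
    using frontier_pp by blast
  then show ?thesis
    by (intro exI[of _ 0] exI[of _ u]) (simp add: hom_point_pp)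
next
  case True
  show ?thesis
  proof (cases "\<kappa> = 0")
    case k0: True
    define s where "s = \<tau> \<bullet> hom_point x"
    have s: "s \<ge> 0"
      unfolding s_def by (rule tau_nonneg[OF x])
    define y where "y = x + ypart ((- s) *\<^sub>R (e *v bh))"
    have yh: "hom_point y = hom_point x + (- s) *\<^sub>R (e *v bh)"
      unfolding y_def by (rule hom_point_add_dir) simp
    have "y \<notin> interior \<Omega>"
      using tau_theta_interior[of y 0] by (auto simp: yh inner_simps s_def)
    then obtain l u where l: "0 \<le> l" "l < 1" "l *\<^sub>R x + (1 - l) *\<^sub>R y = aff_act (\<theta> u) b"
      using crosses_frontier[OF True] by blast
    have "\<theta> u *v bh = l *\<^sub>R hom_point x + (1 - l) *\<^sub>R hom_point y"
      using hom_point_theta[of u b] hom_point_convex[of l x y] l(3) by simp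
    also have "\<dots> = hom_point x - ((1 - l) * s) *\<^sub>R (e *v bh)"
      by (simp add: yh algebra_simps)
    finally have "hom_point x = \<theta> u *v bh + ((1 - l) * s) *\<^sub>R (e *v bh)"
      by simp
    also have "e *v bh = e *v (\<theta> u *v bh)"
      by (simp add: e_theta k0)
    finally show ?thesis
      using l s by (intro exI[of _ "(1 - l) * s"] exI[of _ u]) simp
  next
    case False
    then have k: "\<kappa> > 0"
      using kappa_nonneg by simp
    define Ch where "Ch = bh - (1 / \<kappa>) *\<^sub>R (e *v bh)"
    define C where "C = ypart Ch"
    have Ch: "hom_point C = Ch"
      unfolding C_def by (rule hom_point_ypart) (simp add: Ch_def)
    have tC: "\<tau> \<bullet> (\<theta> v *v Ch) < 0" for v
      using k by (simp add: Ch_def fixed_point[OF False] inner_simps)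
    then have "C \<notin> \<Omega>"
      using tau_theta_nonneg[of C 0] tC[of 0] by (auto simp: Ch)
    then have "C \<notin> interior \<Omega>"
      using interior_subset by blast
    then obtain l u where l: "0 \<le> l" "l < 1" "l *\<^sub>R x + (1 - l) *\<^sub>R C = aff_act (\<theta> u) b"
      using crosses_frontier[OF True] by blast
    let ?q = "\<theta> u *v bh"
    have q: "?q = l *\<^sub>R hom_point x + (1 - l) *\<^sub>R Ch"
      using hom_point_theta[of u b] hom_point_convex[of l x C] l(3) by (simp add: Ch)
    have l0: "l > 0"
    proof (rule ccontr)
      assume "\<not> l > 0"
      then have "C = pp u"
        using l by (simp add: pp_def)
      then show False
        using pp_in_dom \<open>C \<notin> \<Omega>\<close> by blast
    qed
    have Cq: "Ch = ?q - (1 / \<kappa>) *\<^sub>R (e *v ?q)"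
      unfolding Ch_def by (rule e_mult_Ch[OF False]) simp
    have "l *\<^sub>R hom_point x = ?q - (1 - l) *\<^sub>R Ch"
      by (simp add: q)
    also have "\<dots> = l *\<^sub>R ?q + ((1 - l) / \<kappa>) *\<^sub>R (e *v ?q)"
      unfolding Cq by (simp add: algebra_simps)
    finally have "(1 / l) *\<^sub>R (l *\<^sub>R hom_point x) = (1 / l) *\<^sub>R (l *\<^sub>R ?q + ((1 - l) / \<kappa>) *\<^sub>R (e *v ?q))"
      by (simp only:)
    then have "hom_point x = ?q + ((1 - l) / (l * \<kappa>)) *\<^sub>R (e *v ?q)"
      using l0 by (simp add: scaleR_add_right)
    moreover have "(1 - l) / (l * \<kappa>) \<ge> 0"
      using l l0 k by simp
    ultimately show ?thesis
      by blast
  qed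
qed

text \<open>The matrix 1 + \<mu> e commutes with the group, so it transports domain, base point and
  functional while leaving \<open>\<theta>\<close> and \<open>X\<close> unchanged.\<close>

lemma shifted_domain:
  assumes \<mu>: "\<mu> \<ge> 0"
  obtains b' \<tau>' \<Omega>' where "hom_point b' = bh + \<mu> *\<^sub>R (e *v bh)" "orbit_domain \<theta> X b' \<tau>' \<Omega>'"
proof -
  define F where "F = mat 1 + \<mu> *\<^sub>R e"
  \<comment> \<open>The inverse of \<open>F\<close>, by e^2 = \<kappa> e; the denominator is
    positive because \<mu> and \<kappa> are nonnegative.\<close>
  define G' where "G' = mat 1 + (- (\<mu> / (1 + \<mu> * \<kappa>))) *\<^sub>R e"
  have pos: "1 + \<mu> * \<kappa> > 0"
    using \<mu> kappa_nonneg by (simp add: add_pos_nonneg)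
  have F: "F *v z = z + \<mu> *\<^sub>R (e *v z)" for z
    by (simp add: F_def mv_simps)
  have G': "G' *v z = z - (\<mu> / (1 + \<mu> * \<kappa>)) *\<^sub>R (e *v z)" for z
    by (simp add: G'_def mv_simps)
  have coeff: "\<mu> - \<mu> / (1 + \<mu> * \<kappa>) - \<mu> * (\<mu> / (1 + \<mu> * \<kappa>)) * \<kappa> = 0"
    using pos by (simp add: field_simps)
  have FG: "F *v (G' *v z) = z" "G' *v (F *v z) = z" for z
  proof -
    have "F *v (G' *v z) = z + (\<mu> - \<mu> / (1 + \<mu> * \<kappa>) - \<mu> * (\<mu> / (1 + \<mu> * \<kappa>)) * \<kappa>) *\<^sub>R (e *v z)"
      by (simp add: F G' mv_simps e_e algebra_simps)
    then show "F *v (G' *v z) = z"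
      by (simp only: coeff) simp
    have "G' *v (F *v z) = z + (\<mu> - \<mu> / (1 + \<mu> * \<kappa>) - \<mu> * (\<mu> / (1 + \<mu> * \<kappa>)) * \<kappa>) *\<^sub>R (e *v z)"
      by (simp add: F G' mv_simps e_e algebra_simps)
    then show "G' *v (F *v z) = z"
      by (simp only: coeff) simp
  qed
  have F_None: "(F *v z) $ None = z $ None" and G_None': "(G' *v z) $ None = z $ None" for z
    by (simp_all add: F G')
  have hF: "hom_point (aff_act F x) = F *v hom_point x" for x
    unfolding aff_act_ypart by (rule hom_point_ypart) (simp add: F_None)
  have hG: "hom_point (aff_act G' x) = G' *v hom_point x" for x
    unfolding aff_act_ypart by (rule hom_point_ypart) (simp add: G_None')
  have inv1: "aff_act G' (aff_act F x) = x" for x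
    unfolding aff_act_ypart[of G'] hF FG by simp
  have inv2: "aff_act F (aff_act G' x) = x" for x
    unfolding aff_act_ypart[of F] hG FG by simp
  have XF: "X v *v (F *v z) = F *v (X v *v z)" for v z
    by (simp add: F mv_simps e_X_commute)
  have thF: "\<theta> v *v (F *v z) = F *v (\<theta> v *v z)" for v z
    by (simp add: F mv_simps e_theta_commute)
  have actF: "aff_act (\<theta> v) (aff_act F x) = aff_act F (aff_act (\<theta> v) x)" for v x
  proof -
    have "hom_point (aff_act (\<theta> v) (aff_act F x)) = hom_point (aff_act F (aff_act (\<theta> v) x))"
      by (simp only: hom_point_theta hF thF)
    then show ?thesis
      by (metis ypart_hom_point)
  qed
  define b' where "b' = aff_act F b"
  define \<tau>' where "\<tau>' = \<tau> v* G'"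
  define \<Omega>' where "\<Omega>' = aff_act F ` \<Omega>"
  have tau': "\<tau>' \<bullet> (F *v z) = \<tau> \<bullet> z" for z
    by (simp add: \<tau>'_def dot_lmul_matrix FG)
  have hb': "hom_point b' = F *v bh"
    by (simp add: b'_def hF)
  note homeo = continuous_aff_act[of UNIV F] continuous_aff_act[of UNIV G'] inv1 inv2
  have fr: "frontier \<Omega>' = aff_act F ` frontier \<Omega>"
    unfolding \<Omega>'_def by (rule frontier_homeomorphic_image[OF homeo])
  have "orbit_domain \<theta> X b' \<tau>' \<Omega>'"
  proof unfold_locales
    show "\<tau>' \<bullet> hom_point b' = 0"
      by (simp add: hb' tau')
    show "\<tau>' \<bullet> (X v *v hom_point b') = 0" for v
      by (simp add: hb' XF tau')
    show "\<tau>' \<bullet> (X u *v (X v *v hom_point b')) = u \<bullet> v" for u v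
      by (simp add: hb' XF tau')
    show "closed \<Omega>'"
    proof -
      have "\<Omega>' = aff_act G' -` \<Omega>"
        unfolding \<Omega>'_def using inv1 inv2 by (auto simp: image_iff) (metis inv2)
      then show ?thesis
        using closed_vimage[OF closed_dom homeo(2)] by simp
    qed
    show "convex \<Omega>'"
      unfolding \<Omega>'_def by (rule convex_aff_act[OF convex_dom])
    show "interior \<Omega>' \<noteq> {}"
      unfolding \<Omega>'_def interior_homeomorphic_image[OF homeo] using interior_dom by simp
    show "\<not> compact (frontier \<Omega>')"
    proof
      assume "compact (frontier \<Omega>')"
      then have "compact (aff_act G' ` frontier \<Omega>')"
        by (intro compact_continuous_image continuous_aff_act)
      moreover have "aff_act G' ` frontier \<Omega>' = frontier \<Omega>"
        by (simp add: fr image_image inv1)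
      ultimately show False
        using noncompact by simp
    qed
    show "aff_act (\<theta> v) x \<in> \<Omega>'" if "x \<in> \<Omega>'" for x v
      using that invariant unfolding \<Omega>'_def by (auto simp: actF)
    show "frontier \<Omega>' = range (\<lambda>v. aff_act (\<theta> v) b')"
      unfolding fr frontier_orbit b'_def by (simp add: actF image_image)
    show "0 \<le> \<tau>' \<bullet> hom_point x" if "x \<in> \<Omega>'" for x
      using that tau_nonneg unfolding \<Omega>'_def by (auto simp: hF tau')
  qed
  moreover have "hom_point b' = bh + \<mu> *\<^sub>R (e *v bh)"
    by (simp add: hb' F)
  ultimately show thesis
    by (rule that[rotated])
qed

lemma trace_iff_t0: "t0 = 0 \<longleftrightarrow> (\<forall>v. trace (X v) = 0)"
  by (simp add: t0_eq_0_iff trace_X)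

text \<open>The criterion is phrased with the matrix trace because that mentions neither the base
  point nor the functional, and so transfers between horospheres.\<close>

lemma horosphere_iff:
  assumes "x \<in> \<Omega>" "radial \<Phi>" and S: "S = range (\<lambda>v. aff_act (\<theta> v) x)"
  shows "flow_lines_affine_normal \<Phi> S \<longleftrightarrow> (\<forall>v. trace (X v) = 0)"
    and "affine_sphere S \<longleftrightarrow> (\<forall>v. trace (X v) = 0)"
proof -
  obtain \<mu> u where \<mu>: "\<mu> \<ge> 0" and x: "hom_point x = \<theta> u *v bh + \<mu> *\<^sub>R (e *v (\<theta> u *v bh))"
    using exists_shift[OF assms(1)] by blast
  obtain b' \<tau>' \<Omega>' where b': "hom_point b' = bh + \<mu> *\<^sub>R (e *v bh)" and dom: "orbit_domain \<theta> X b' \<tau>' \<Omega>'"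
    using shifted_domain[OF \<mu>] by blast
  interpret O: orbit_domain \<theta> X b' \<tau>' \<Omega>' by (rule dom)
  have xb: "hom_point x = \<theta> u *v hom_point b'"
    by (simp add: x b' mv_simps e_theta_commute)
  have act: "aff_act (\<theta> v) x = aff_act (\<theta> (v + u)) b'" for v
    by (simp add: aff_act_ypart xb hom matrix_vector_mul_assoc)
  have "S = frontier \<Omega>'"
    unfolding S O.frontier_orbit
  proof safe
    fix v
    show "aff_act (\<theta> v) x \<in> range (\<lambda>v. aff_act (\<theta> v) b')"
      unfolding act by (rule rangeI)
    have "aff_act (\<theta> v) b' = aff_act (\<theta> (v - u)) x"
      by (simp add: act)
    then show "aff_act (\<theta> v) b' \<in> range (\<lambda>v. aff_act (\<theta> v) x)"
      by (rule range_eqI)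
  qed
  then show "flow_lines_affine_normal \<Phi> S \<longleftrightarrow> (\<forall>v. trace (X v) = 0)"
    and "affine_sphere S \<longleftrightarrow> (\<forall>v. trace (X v) = 0)"
    using O.flow_lines_iff_t0[OF assms(2)] O.affine_sphere_iff_t0 O.trace_iff_t0 by simp_all
qed

end

subsection \<open>The shape invariant\<close>

lemma second_derivative_cubic:
  fixes a0 a1 a2 a3 :: real
  shows "(deriv ^^ 2) (\<lambda>t. a0 + a1 * t + a2 * t\<^sup>2 + a3 * t ^ 3) 0 = 2 * a2"
proof -
  have "deriv (\<lambda>t. a0 + a1 * t + a2 * t\<^sup>2 + a3 * t ^ 3) = (\<lambda>t. a1 + 2 * a2 * t + 3 * a3 * t\<^sup>2)"
    by (rule ext, rule DERIV_imp_deriv) (auto intro!: derivative_eq_intros)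
  moreover have "deriv (\<lambda>t. a1 + 2 * a2 * t + 3 * a3 * t\<^sup>2) 0 = 2 * a2"
    by (rule DERIV_imp_deriv) (auto intro!: derivative_eq_intros)
  ultimately show ?thesis
    by (simp add: numeral_2_eq_2)
qed

text \<open>By symmetry of the trilinear form, the coefficient of t^2 along an axis is three times
  the form with that axis in two slots; differentiating twice gives the factor 6.\<close>

lemma (in vector_group_frame) laplacian_cubic:
  assumes "\<And>v. f v = k * (\<tau> \<bullet> (X v *v (X v *v (X v *v bh))))"
  shows "laplacian f x = 6 * k * tr x"
proof -
  have "(deriv ^^ 2) (\<lambda>t. f (x + t *\<^sub>R axis i 1)) 0
      = 6 * k * (\<tau> \<bullet> (X (axis i 1) *v (X (axis i 1) *v (X x *v bh))))" for i
  proof -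
    let ?a = "axis i 1 :: real ^ 'm"
    let ?c = "\<lambda>u v w. \<tau> \<bullet> (X u *v (X v *v (X w *v bh)))"
    have "f (x + t *\<^sub>R ?a) = k * ?c x x x + (3 * k * ?c ?a x x) * t + (3 * k * ?c ?a ?a x) * t\<^sup>2 + (k * ?c ?a ?a ?a) * t ^ 3" for t
    proof -
      have s: "?c x ?a x = ?c ?a x x" "?c x x ?a = ?c ?a x x" "?c ?a x ?a = ?c ?a ?a x" "?c x ?a ?a = ?c ?a ?a x"
        by (metis X_commute)+
      show ?thesis
        unfolding assms by (simp add: X_simps mv_simps inner_simps s algebra_simps power2_eq_square power3_eq_cube)
    qed
    then have "(\<lambda>t. f (x + t *\<^sub>R ?a)) = (\<lambda>t. k * ?c x x x + (3 * k * ?c ?a x x) * t + (3 * k * ?c ?a ?a x) * t\<^sup>2 + (k * ?c ?a ?a ?a) * t ^ 3)"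
      by (rule ext)
    then show ?thesis
      by (simp only: second_derivative_cubic)
  qed
  then show ?thesis
    by (simp add: laplacian_def tr_def sum_distrib_left)
qed

text \<open>An orthonormal eigenbasis of the operator representing \<open>B\<close>, each vector
  divided by the root of its eigenvalue, gives the columns of \<open>L\<close>.\<close>

lemma positive_form_normalization:
  fixes B :: "real ^ 'm \<Rightarrow> real ^ ('m::finite) \<Rightarrow> real"
  assumes lin: "\<And>u. linear (B u)" and sym: "\<And>u v. B u v = B v u" and pos: "\<And>v. v \<noteq> 0 \<Longrightarrow> B v v > 0"
  shows "\<exists>L :: real ^ 'm ^ 'm. invertible L \<and> (\<forall>v. B (L *v v) (L *v v) = (norm v)\<^sup>2)"
proof -
  define f where "f u = (\<chi> i. B u (axis i 1))" for u
  have f: "f u \<bullet> v = B u v" for u v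
    using linear_functional_vec[OF lin, of u v] by (simp add: f_def inner_commute)
  have lin': "linear (\<lambda>u. B u v)" for v
    using lin[of v] by (simp add: sym[of _ v])
  have linf: "linear f"
    by (auto intro!: linearI simp: f_def vec_eq_iff linear_add[OF lin'] linear_scale[OF lin'])
  have symf: "f x \<bullet> y = x \<bullet> f y" for x y
    using f[of x y] f[of y x] sym[of x y] by (simp add: inner_commute)
  have "\<exists>A \<subseteq> UNIV. pairwise orthogonal A \<and> (\<forall>b\<in>A. norm b = 1) \<and> span A = (UNIV :: (real ^ 'm) set) \<and>
      (\<forall>b\<in>A. \<forall>f\<in>{f}. \<exists>c. f b = c *\<^sub>R b)"
    by (rule commuting_selfadjoint_eigenbasis) (use linf symf in auto)
  then obtain A :: "(real ^ 'm) set" where A: "pairwise orthogonal A" "\<And>b. b \<in> A \<Longrightarrow> norm b = 1" "span A = UNIV"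
    "\<And>b. b \<in> A \<Longrightarrow> \<exists>c. f b = c *\<^sub>R b"
    by auto
  have "0 \<notin> A"
    using A(2) by force
  then have ind: "independent A"
    using A(1) pairwise_orthogonal_independent by blast
  then have "finite A" "card A = CARD('m)"
    using basis_card_eq_dim[of A UNIV] A(3) independent_imp_finite by auto
  then obtain g where g: "bij_betw g (UNIV :: 'm set) A"
    using finite_same_card_bij[of "UNIV :: 'm set" A] by auto
  have gA: "g i \<in> A" for i
    using g by (auto simp: bij_betw_def)
  have gg: "g i \<bullet> g j = (if i = j then 1 else 0)" for i j
  proof (cases "i = j")
    case True
    then show ?thesis
      using A(2)[OF gA[of j]] by (simp add: dot_square_norm)
  next
    case False
    then have "g i \<noteq> g j"
      using g by (auto simp: bij_betw_def inj_def)
    then show ?thesis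
      using A(1) gA False by (auto simp: pairwise_def orthogonal_def)
  qed
  define c where "c i = B (g i) (g i)" for i
  have fg: "f (g i) = c i *\<^sub>R g i" for i
  proof -
    obtain d where d: "f (g i) = d *\<^sub>R g i"
      using A(4)[OF gA] by blast
    then have "c i = d"
      unfolding c_def f[symmetric] by (simp add: gg)
    then show ?thesis
      using d by simp
  qed
  have Bg: "B (g i) (g j) = (if i = j then c i else 0)" for i j
    unfolding f[symmetric] fg by (simp add: gg)
  have c: "c i > 0" for i
    unfolding c_def using gA[of i] \<open>0 \<notin> A\<close> by (intro pos) metis
  define L :: "real ^ 'm ^ 'm" where "L = matrix (\<lambda>v. \<Sum>i\<in>UNIV. (v $ i / sqrt (c i)) *\<^sub>R g i)"
  have L: "L *v v = (\<Sum>i\<in>UNIV. (v $ i / sqrt (c i)) *\<^sub>R g i)" for v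
    unfolding L_def
    by (rule matrix_mult_linear)
      (auto intro!: linearI simp: sum.distrib scaleR_add_left add_divide_distrib scaleR_sum_right)
  have BL: "B (L *v v) (L *v v) = (norm v)\<^sup>2" for v
  proof -
    have "B (L *v v) (L *v v) = (\<Sum>i\<in>UNIV. \<Sum>j\<in>UNIV. (v $ i / sqrt (c i)) * ((v $ j / sqrt (c j)) * B (g j) (g i)))"
      unfolding L by (simp only: linear_sum[OF lin'] linear_scale[OF lin'] linear_sum[OF lin] linear_scale[OF lin] sum_distrib_left real_scaleR_def)
    also have "\<dots> = (\<Sum>i\<in>UNIV. v $ i * v $ i)"
    proof (rule sum.cong[OF refl])
      fix i
      have "(v $ i / sqrt (c i)) * ((v $ i / sqrt (c i)) * c i) = v $ i * v $ i"
        using c[of i] by (simp add: field_simps)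
      then show "(\<Sum>j\<in>UNIV. (v $ i / sqrt (c i)) * ((v $ j / sqrt (c j)) * B (g j) (g i))) = v $ i * v $ i"
        by (simp add: Bg if_distrib cong: if_cong)
    qed
    also have "\<dots> = (norm v)\<^sup>2"
      by (simp add: power2_norm_eq_inner inner_vec_def)
    finally show ?thesis .
  qed
  have "v = 0" if "L *v v = 0" for v
    using BL[of v] that linear_0[OF lin] by simp
  then have "inj ((*v) L)"
    by (simp add: linear_injective_0)
  then have "invertible L"
    using matrix_left_invertible_injective invertible_left_inverse by blast
  then show ?thesis
    using BL by blast
qed

lemma inner_join: "join y s \<bullet> z = y \<bullet> ypart z + s * z $ None"
  by (simp add: inner_vec_def sum_UNIV_option)

lemma (in vector_group) jet3_height:
  assumes t0: "\<tau> \<bullet> z = 0" and t1: "\<tau> \<bullet> (X v *v z) = 0"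
  shows "jet3 (\<lambda>u. \<tau> \<bullet> (\<theta> u *v z)) v
    = \<tau> \<bullet> (X v *v (X v *v z)) / 2 + \<tau> \<bullet> (X v *v (X v *v (X v *v z))) / 6"
proof -
  define F where "F M t = \<tau> \<bullet> (M *v (\<theta> (t *\<^sub>R v) *v z))" for M :: "'m hmatrix" and t
  have d: "deriv (F M) = F (M ** X v)" for M
  proof
    fix t
    have "((\<lambda>t. \<tau> \<bullet> (M *v (\<theta> (t *\<^sub>R v) *v z))) has_vector_derivative \<tau> \<bullet> (M *v (X v *v (\<theta> (t *\<^sub>R v) *v z)))) (at t)"
      by (rule bounded_linear.has_vector_derivative[OF bounded_linear_compose[OF bounded_linear_inner_right
            bounded_bilinear.bounded_linear_right[OF bounded_bilinear_matrix_vector_mult]] vector_derivative])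
    then have "(F M has_real_derivative F (M ** X v) t) (at t)"
      unfolding has_real_derivative_iff_has_vector_derivative F_def[abs_def]
      by (simp add: matrix_vector_mul_assoc[symmetric])
    then show "deriv (F M) t = F (M ** X v) t"
      by (rule DERIV_imp_deriv)
  qed
  have g0: "(\<lambda>t. \<tau> \<bullet> (\<theta> (t *\<^sub>R v) *v z)) = F (mat 1)"
    by (simp add: F_def[abs_def])
  have "jet3 (\<lambda>u. \<tau> \<bullet> (\<theta> u *v z)) v = (\<Sum>k\<le>3. (deriv ^^ k) (F (mat 1)) 0 / fact k)"
    unfolding jet3_def g0 ..
  also have "\<dots> = F (mat 1) 0 + F (X v) 0 + F (X v ** X v) 0 / 2 + F (X v ** X v ** X v) 0 / 6"
    by (simp add: numeral_3_eq_3 atMost_Suc d)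
  finally show ?thesis
    by (simp add: F_def matrix_vector_mul_assoc[symmetric] t0 t1)
qed

theorem proposition6p17:
  fixes \<Omega> S :: "(real ^ ('m::finite) option) set"
    and T :: "(real ^ 'm option option ^ 'm option option) set"
    and \<theta> :: "real ^ 'm \<Rightarrow> real ^ 'm option option ^ 'm option option"
    and \<Phi> :: "real \<Rightarrow> real ^ 'm option \<Rightarrow> real ^ 'm option"
    and \<beta> c :: "real ^ 'm \<Rightarrow> real"
  assumes "marked_translation_group \<Omega> T \<theta>"
    and "horosphere \<Omega> T S"
    and "radial_flow \<Omega> T \<Phi>"
    and "\<beta> \<in> homogeneous_poly 2"
    and "det (form_matrix \<beta>) = 1"
    and "\<forall>v. v \<noteq> 0 \<longrightarrow> \<beta> v > 0"
    and "c \<in> homogeneous_poly 3"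
    and "(\<lambda>v. \<beta> v + c v) \<in> shape_class \<Omega> \<theta>"
  shows "(flow_lines_affine_normal \<Phi> S \<longleftrightarrow> affine_sphere S) \<and>
         (affine_sphere S \<longleftrightarrow> harmonic_wrt \<beta> c) \<and>
         (harmonic_wrt \<beta> c \<longleftrightarrow> (\<exists>s\<ge>0. Aff_conjugate T (Tr s)))"
proof -
  have tg: "translation_group \<Omega> T" and iso: "lie_group_iso \<theta> T"
    using assms(1) by (simp_all only: marked_translation_group_def)
  have scd: "strictly_convex_domain \<Omega>" and TA: "T \<subseteq> Aff"
    and act: "\<And>A. A \<in> T \<Longrightarrow> aff_act A ` \<Omega> = \<Omega>"
    and trans1: "\<And>x y. x \<in> frontier \<Omega> \<Longrightarrow> y \<in> frontier \<Omega> \<Longrightarrow> \<exists>!A. A \<in> T \<and> aff_act A x = y"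
    using tg unfolding translation_group_def by simp_all
  have closed: "closed \<Omega>" and convex: "convex \<Omega>" and int: "interior \<Omega> \<noteq> {}"
    and nonc: "\<not> compact (frontier \<Omega>)"
    using scd unfolding strictly_convex_domain_def by simp_all
  have trans: "\<exists>A\<in>T. aff_act A x = y" if "x \<in> frontier \<Omega>" "y \<in> frontier \<Omega>" for x y
    using trans1[OF that] by blast
  have hom: "\<theta> (u + v) = \<theta> u ** \<theta> v" for u v
    using iso unfolding lie_group_iso_def by blast
  obtain \<eta> where \<eta>: "homeomorphism UNIV T \<theta> \<eta>"
    using iso unfolding lie_group_iso_def by blast
  have cont: "continuous_on UNIV \<theta>" and rng: "range \<theta> = T"
    using \<eta> by (simp_all add: homeomorphism_def)
  have thT: "\<theta> v \<in> T" for v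
    using rng by blast
  have thA: "\<theta> v \<in> Aff" for v
    using thT TA by blast
  have th0: "\<theta> 0 = mat 1"
  proof -
    have inv: "matrix_inv (\<theta> 0) ** \<theta> 0 = mat 1"
      using thA[of 0] by (intro matrix_mult_inv) (simp add: Aff_def)
    have "\<theta> 0 = (matrix_inv (\<theta> 0) ** \<theta> 0) ** \<theta> 0"
      by (simp add: inv)
    also have "\<dots> = matrix_inv (\<theta> 0) ** \<theta> (0 + 0)"
      unfolding hom by (simp only: matrix_mul_assoc)
    also have "\<dots> = mat 1"
      by (simp add: inv)
    finally show ?thesis .
  qed
  have "\<forall>v. \<exists>X. ((\<lambda>t. \<theta> (t *\<^sub>R v)) has_vector_derivative X) (at 0)"
  proof
    fix v
    show "\<exists>X. ((\<lambda>t. \<theta> (t *\<^sub>R v)) has_vector_derivative X) (at 0)"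
    proof (rule one_parameter_group_differentiable)
      show "continuous_on UNIV (\<lambda>t. \<theta> (t *\<^sub>R v))"
        by (rule continuous_on_compose2[OF cont]) (auto intro!: continuous_intros)
    qed (simp_all add: th0 hom scaleR_add_left)
  qed
  then obtain X where X: "\<And>v. ((\<lambda>t. \<theta> (t *\<^sub>R v)) has_vector_derivative X v) (at 0)"
    by metis
  interpret VG: vector_group \<theta> X
    by unfold_locales (use hom th0 cont X Aff_None[OF thA] in auto)
  have hom_th: "hom_point (aff_act (\<theta> v) x) = \<theta> v *v hom_point x" for v x
    unfolding aff_act_ypart by (rule hom_point_ypart) simp

  obtain b H a d r where b: "b \<in> frontier \<Omega>" and sH: "supporting_hyperplane \<Omega> b H"
    and aH: "\<And>x. x \<in> H \<Longrightarrow> a \<bullet> x + d = 0" and a_pos: "\<And>x. x \<in> interior \<Omega> \<Longrightarrow> a \<bullet> x + d > 0" and r: "r > 0"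
    and shape: "(\<lambda>v. \<beta> v + c v) = (\<lambda>v. r * jet3 (\<lambda>u. a \<bullet> aff_act (\<theta> u) b + d) v)"
    using assms(8) unfolding shape_class_def by blast
  have bO: "b \<in> \<Omega>"
    using b closed frontier_subset_closed by blast
  define \<tau>\<^sub>0 where "\<tau>\<^sub>0 = join a d"
  have tau: "\<tau>\<^sub>0 \<bullet> hom_point x = a \<bullet> x + d" for x
    by (simp add: \<tau>\<^sub>0_def inner_join)
  have "b \<in> H"
    using sH unfolding supporting_hyperplane_def by auto
  then have tau_b: "\<tau>\<^sub>0 \<bullet> hom_point b = 0"
    using aH tau by simp
  have tau_nonneg: "\<tau>\<^sub>0 \<bullet> hom_point x \<ge> 0" if "x \<in> \<Omega>" for x
  proof -
    have "closure (interior \<Omega>) \<subseteq> {x. 0 \<le> a \<bullet> x + d}"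
      using a_pos by (intro closure_minimal closed_Collect_le continuous_intros) (auto intro: less_imp_le)
    moreover have "closure (interior \<Omega>) = \<Omega>"
      using convex_closure_interior[OF convex int] closed by simp
    ultimately show ?thesis
      using that by (auto simp: tau)
  qed
  have invariant: "aff_act (\<theta> v) x \<in> \<Omega>" if "x \<in> \<Omega>" for v x
    using act[OF thT] that by blast
  \<comment> \<open>The height is nonnegative along the orbit and zero at \<open>b\<close>, so its
    derivative there vanishes.\<close>
  have tau_X: "\<tau>\<^sub>0 \<bullet> (X v *v hom_point b) = 0" for v
  proof -
    let ?f = "\<lambda>t. \<tau>\<^sub>0 \<bullet> (\<theta> (t *\<^sub>R v) *v hom_point b)"
    have "(?f has_real_derivative \<tau>\<^sub>0 \<bullet> (X v *v hom_point b)) (at 0)"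
      unfolding has_real_derivative_iff_has_vector_derivative
      by (rule bounded_linear.has_vector_derivative[OF bounded_linear_inner_right VG.vector_derivative_0])
    moreover have "\<forall>t. \<bar>0 - t\<bar> < 1 \<longrightarrow> ?f 0 \<le> ?f t"
      using tau_nonneg[OF invariant[OF bO]] by (simp add: hom_th tau_b)
    ultimately show ?thesis
      by (rule DERIV_local_min[OF _ zero_less_one])
  qed
  define q2 where "q2 v = \<tau>\<^sub>0 \<bullet> (X v *v (X v *v hom_point b))" for v
  define q3 where "q3 v = \<tau>\<^sub>0 \<bullet> (X v *v (X v *v (X v *v hom_point b)))" for v
  have bc: "\<beta> v + c v = r * (q2 v / 2 + q3 v / 6)" for v
  proof -
    have "(\<lambda>u. a \<bullet> aff_act (\<theta> u) b + d) = (\<lambda>u. \<tau>\<^sub>0 \<bullet> (\<theta> u *v hom_point b))"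
      by (simp add: tau[symmetric] hom_th)
    then show ?thesis
      using fun_cong[OF shape, of v] VG.jet3_height[OF tau_b tau_X] by (simp add: q2_def q3_def)
  qed
  \<comment> \<open>Only the sum \<beta> + c is given by the jet; parity separates its even and odd
    parts.\<close>
  have neg: "\<beta> (- v) = \<beta> v" "c (- v) = - c v" "q2 (- v) = q2 v" "q3 (- v) = - q3 v" for v
  proof -
    have "\<beta> ((- 1) *\<^sub>R v) = (- 1)\<^sup>2 * \<beta> v" "c ((- 1) *\<^sub>R v) = (- 1) ^ 3 * c v"
      using assms(4,7) unfolding homogeneous_poly_def by blast+
    then show "\<beta> (- v) = \<beta> v" "c (- v) = - c v"
      by simp_all
    have "X (- v) *v z = - (X v *v z)" for z
      using matrix_vector_scaleR_left[of "- 1" "X v" z] by (simp add: VG.X_minus)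
    then show "q2 (- v) = q2 v" "q3 (- v) = - q3 v"
      by (simp_all add: q2_def q3_def linear_neg[OF matrix_vector_mul_linear])
  qed
  have beta: "\<beta> v = r / 2 * q2 v" and cubic: "c v = r / 6 * q3 v" for v
    using bc[of v] bc[of "- v"] neg[of v] by (simp_all add: algebra_simps)

  define Bf where "Bf u v = r / 2 * (\<tau>\<^sub>0 \<bullet> (X u *v (X v *v hom_point b)))" for u v
  have Bf_lin: "linear (Bf u)" for u
    by (auto intro!: linearI simp: Bf_def VG.X_simps mv_simps inner_simps algebra_simps)
  have Bf_sym: "Bf u v = Bf v u" for u v
    unfolding Bf_def by (simp only: VG.X_commute[of u v])
  have Bf_beta: "Bf v v = \<beta> v" for v
    by (simp add: Bf_def beta q2_def)
  obtain L\<^sub>0 :: "real ^ 'm ^ 'm" where L0: "invertible L\<^sub>0" "\<And>v. \<beta> (L\<^sub>0 *v v) = (norm v)\<^sup>2"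
    using positive_form_normalization[of Bf, OF Bf_lin Bf_sym] assms(6) unfolding Bf_beta by blast
  \<comment> \<open>With this factor the second-order form of \<tau> at \<open>b\<close> is the
    polarization of \<beta>, which \<open>L\<close> turns into the inner product.\<close>
  define \<tau> where "\<tau> = (r / 2) *\<^sub>R \<tau>\<^sub>0"
  \<comment> \<open>\<open>harmonic_wrt\<close> asks for some normalizing matrix. Every such
    \<open>L\<close> yields a frame, so the trace criterion is the same for all of them.\<close>
  have frame: "vector_group_frame (\<lambda>v. \<theta> (L *v v)) (\<lambda>v. X (L *v v)) b \<tau>"
    if L: "\<And>v. \<beta> (L *v v) = (norm v)\<^sup>2" for L :: "real ^ 'm ^ 'm"
  proof unfold_locales
    show "\<theta> (L *v (u + v)) = \<theta> (L *v u) ** \<theta> (L *v v)" for u v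
      by (simp add: mv_simps hom)
    show "\<theta> (L *v 0) = mat 1"
      by (simp add: th0)
    show "continuous_on UNIV (\<lambda>v. \<theta> (L *v v))"
      by (rule continuous_on_compose2[OF cont]) (auto intro!: linear_continuous_on matrix_vector_mul_bounded_linear)
    show "((\<lambda>t. \<theta> (L *v (t *\<^sub>R v))) has_vector_derivative X (L *v v)) (at 0)" for v
      using X[of "L *v v"] by (simp add: mv_simps)
    show "(\<theta> (L *v v) *v z) $ None = z $ None" for v z
      by simp
    show "\<tau> \<bullet> hom_point b = 0" "\<tau> \<bullet> (X (L *v v) *v hom_point b) = 0" for v
      by (simp_all add: \<tau>_def tau_b tau_X)
    show "\<tau> \<bullet> (X (L *v u) *v (X (L *v v) *v hom_point b)) = u \<bullet> v" for u v
    proof -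
      have "Bf (L *v u + L *v v) (L *v u + L *v v) = (norm (u + v))\<^sup>2"
        unfolding Bf_beta using L[of "u + v"] by (simp add: mv_simps)
      moreover have "Bf (L *v u + L *v v) (L *v u + L *v v)
          = Bf (L *v u) (L *v u) + 2 * Bf (L *v u) (L *v v) + Bf (L *v v) (L *v v)"
        using Bf_sym[of "L *v u" "L *v v"]
        by (simp only: linear_add[OF Bf_lin] Bf_sym[of "L *v u + L *v v"])
      moreover have "(norm (u + v))\<^sup>2 = (norm u)\<^sup>2 + 2 * (u \<bullet> v) + (norm v)\<^sup>2"
        by (simp add: power2_norm_eq_inner inner_simps inner_commute)
      ultimately have "Bf (L *v u) (L *v v) = u \<bullet> v"
        unfolding Bf_beta L by simp
      then show ?thesis
        by (simp add: Bf_def \<tau>_def)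
    qed
  qed
  have surjL: "\<exists>w. v = L *v w" if "invertible L" for v and L :: "real ^ 'm ^ 'm"
  proof -
    have "v = L *v (matrix_inv L *v v)"
      by (simp add: matrix_vector_mul_assoc matrix_mult_inv(1)[OF that])
    then show ?thesis by blast
  qed
  let ?tr0 = "\<forall>v. trace (X v) = 0"
  have harmonic_L: "(\<forall>x. laplacian (\<lambda>v. c (L *v v)) x = 0) \<longleftrightarrow> ?tr0"
    if "invertible L" and L: "\<And>v. \<beta> (L *v v) = (norm v)\<^sup>2" for L :: "real ^ 'm ^ 'm"
  proof -
    interpret F: vector_group_frame "\<lambda>v. \<theta> (L *v v)" "\<lambda>v. X (L *v v)" b \<tau>
      by (rule frame[OF L])
    \<comment> \<open>The cubic part carries r / 6 and \<tau> carries r / 2, whence 1 / 3.\<close>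
    have "laplacian (\<lambda>v. c (L *v v)) x = 6 * (1 / 3) * F.tr x" for x
      by (rule F.laplacian_cubic) (simp add: cubic q3_def \<tau>_def)
    then have "(\<forall>x. laplacian (\<lambda>v. c (L *v v)) x = 0) \<longleftrightarrow> (\<forall>x. trace (X (L *v x)) = 0)"
      by (simp add: F.trace_X)
    also have "\<dots> \<longleftrightarrow> ?tr0"
      using surjL[OF that(1)] by metis
    finally show ?thesis .
  qed
  have harmonic: "harmonic_wrt \<beta> c \<longleftrightarrow> ?tr0"
    unfolding harmonic_wrt_def using harmonic_L L0 by blast

  have frontier_inv: "aff_act (\<theta> v) ` frontier \<Omega> = frontier \<Omega>" for v
  proof -
    have inv: "aff_act (\<theta> (- w)) (aff_act (\<theta> w) x) = x" for w x
      unfolding aff_act_ypart[of "\<theta> (- w)"] hom_th by simp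
    have "frontier (aff_act (\<theta> v) ` \<Omega>) = aff_act (\<theta> v) ` frontier \<Omega>"
    proof (rule frontier_homeomorphic_image[OF continuous_aff_act continuous_aff_act])
      show "aff_act (\<theta> (- v)) (aff_act (\<theta> v) x) = x" for x
        by (rule inv)
      show "aff_act (\<theta> v) (aff_act (\<theta> (- v)) x) = x" for x
        using inv[of "- v" x] by simp
    qed
    then show ?thesis
      by (simp add: act[OF thT])
  qed
  have orbit: "frontier \<Omega> = range (\<lambda>v. aff_act (\<theta> (L\<^sub>0 *v v)) b)"
  proof (rule subset_antisym)
    show "frontier \<Omega> \<subseteq> range (\<lambda>v. aff_act (\<theta> (L\<^sub>0 *v v)) b)"
    proof
      fix y assume "y \<in> frontier \<Omega>"
      then obtain A where "A \<in> T" "aff_act A b = y"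
        using trans[OF b] by blast
      then obtain v where "y = aff_act (\<theta> v) b"
        using rng by blast
      moreover obtain w where "v = L\<^sub>0 *v w"
        using surjL[OF L0(1)] by blast
      ultimately show "y \<in> range (\<lambda>v. aff_act (\<theta> (L\<^sub>0 *v v)) b)"
        by blast
    qed
    show "range (\<lambda>v. aff_act (\<theta> (L\<^sub>0 *v v)) b) \<subseteq> frontier \<Omega>"
      using frontier_inv b by blast
  qed
  interpret D: orbit_domain "\<lambda>v. \<theta> (L\<^sub>0 *v v)" "\<lambda>v. X (L\<^sub>0 *v v)" b \<tau> \<Omega>
  proof -
    interpret F: vector_group_frame "\<lambda>v. \<theta> (L\<^sub>0 *v v)" "\<lambda>v. X (L\<^sub>0 *v v)" b \<tau>
      by (rule frame[OF L0(2)])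
    show "orbit_domain (\<lambda>v. \<theta> (L\<^sub>0 *v v)) (\<lambda>v. X (L\<^sub>0 *v v)) b \<tau> \<Omega>"
      by unfold_locales (use closed convex int nonc invariant orbit tau_nonneg r in \<open>auto simp: \<tau>_def\<close>)
  qed
  have rng0: "range (\<lambda>v. \<theta> (L\<^sub>0 *v v)) = T"
  proof -
    have "range (\<lambda>v. \<theta> (L\<^sub>0 *v v)) = \<theta> ` range (\<lambda>v. L\<^sub>0 *v v)"
      by (simp add: image_image)
    also have "range (\<lambda>v. L\<^sub>0 *v v) = UNIV"
      using surjL[OF L0(1)] by blast
    finally show ?thesis
      using rng by simp
  qed
  have tr0_iff: "(\<forall>v. D.tr v = 0) \<longleftrightarrow> ?tr0"
    unfolding D.trace_X[symmetric] using surjL[OF L0(1)] by metis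
  have conj: "(\<exists>s\<ge>0. Aff_conjugate T (Tr s)) \<longleftrightarrow> ?tr0"
  proof
    assume "\<exists>s\<ge>0. Aff_conjugate T (Tr s)"
    then obtain s where s: "Aff_conjugate T (Tr s)"
      by blast
    have "det (\<theta> v) = 1" for v
      by (rule Aff_conjugate_det[OF s det_Tr thT])
    then show ?tr0
      unfolding tr0_iff[symmetric] using D.tr_0_if_det by blast
  next
    assume ?tr0
    then have tr0: "\<And>v. D.tr v = 0"
      using tr0_iff by blast
    show "\<exists>s\<ge>0. Aff_conjugate T (Tr s)"
    proof (cases "D.\<kappa> = 0")
      case True
      then show ?thesis
        using D.Aff_conjugate_Tr_0[OF True tr0] unfolding rng0 by blast
    next
      case False
      then have "D.\<kappa> > 0"
        using D.kappa_nonneg by simp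
      \<comment> \<open>\<open>Tr s\<close> is the same group for every s > 0.\<close>
      then have "Aff_conjugate T (Tr 1)"
        using D.Aff_conjugate_Tr_pos[OF _ tr0] unfolding rng0 by blast
      then show ?thesis
        by (intro exI[of _ 1]) simp
    qed
  qed
  obtain x\<^sub>0 where x0: "x\<^sub>0 \<in> \<Omega>" "S = (\<lambda>A. aff_act A x\<^sub>0) ` T"
    using assms(2) unfolding horosphere_def by blast
  have S: "S = range (\<lambda>v. aff_act (\<theta> (L\<^sub>0 *v v)) x\<^sub>0)"
    unfolding x0(2) rng0[symmetric] image_image ..
  have all_T: "(\<forall>A\<in>T. P A) \<longleftrightarrow> (\<forall>v. P (\<theta> (L\<^sub>0 *v v)))" for P
    unfolding rng0[symmetric] by blast
  have "D.radial \<Phi>"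
    using assms(3) unfolding radial_flow_def D.radial_def all_T by (auto split: if_splits)
  note iff = D.horosphere_iff[OF x0(1) this S]
  have "(\<forall>v. trace (X (L\<^sub>0 *v v)) = 0) \<longleftrightarrow> ?tr0"
    using surjL[OF L0(1)] by metis
  then show ?thesis
    using iff harmonic conj by blast
qed

end
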